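(* Let $A$ be a commutative ring and $R=A[\xi_i]_{i\ge1}$. Let $\lambda$ and $\mu$ be $\infty$-compositions with index sets $\mathcal{I}$ and $\mathcal{K}$, let $e$ and $d$ be reduced weightings on $\mathcal{I}$ and $\mathcal{K}$ (with respect to $\lambda$ and $\mu$ respectively), and let $Z\subset\mathbf{U}^{\mathcal{I}}$ and $Y\subset\mathbf{U}^{\mathcal{K}}$ be closed subsets. Put $\mathfrak{p}=\mathfrak{P}(\lambda,e;Z)$ and $\mathfrak{q}=\mathfrak{P}(\mu,d;Y)$. Then $\mathfrak{p}\subset\mathfrak{q}$ if and only if $Y\subset\Theta^{\lambda,e}_{\mu,d}(Z)$.
   Context: $[\infty]=\{1,2,\ldots\}$; $\mathfrak{S}=\bigcup_{n\ge1}\mathfrak{S}_n$ is the group of permutations of $[\infty]$ moving finitely many elements, acting on $R$ by $A$-algebra automorphisms permuting the $\xi_i$. An $\infty$-composition on a finite index set $\mathcal{I}$ is a function $\lambda\colon\mathcal{I}\to\mathbf{Z}_{\ge1}\cup\{\infty\}$ taking the value $\infty$ at least once; $\mathcal{I}^\infty=\{\alpha:\lambda_\alpha=\infty\}$. A weighting on $\mathcal{I}$ is a function $e\colon\mathcal{I}\to\mathbf{Z}_{\ge1}$; it is ($\lambda$-)reduced if $e_\alpha=1$ whenever $\lambda_\alpha<\infty$. A partition of $[\infty]$ of type $\lambda$ is a family $\mathcal{U}=\{U_\alpha\}_{\alpha\in\mathcal{I}}$ of disjoint non-empty subsets covering $[\infty]$ with $\#U_\alpha=\lambda_\alpha$;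 $\pi\colon[\infty]\to\mathcal{I}$ is given by $i\in U_{\pi(i)}$. For a finite set $\mathcal{I}$, $\mathbf{A}^{\mathcal{I}}=\operatorname{Spec}A[t_\alpha]_{\alpha\in\mathcal{I}}$, and $\mathbf{U}^{\mathcal{I}}\subset\mathbf{A}^{\mathcal{I}}$ is the spectrum of $\tilde{S}_{\mathcal{U},0}=A[t_\alpha]_{\alpha\in\mathcal{I}}[(t_\alpha-t_\beta)^{-1}]_{\alpha\ne\beta}$. Put $\tilde{S}_{\mathcal{U}}=\tilde{S}_{\mathcal{U},0}[\epsilon_i]_{i\ge1}$. For a subset $Z\subset\mathbf{U}^{\mathcal{I}}$ let $\mathfrak{I}_0(Z)\subset\tilde{S}_{\mathcal{U},0}$ be its radical ideal, and let $\mathfrak{Q}_{\mathcal{U}}(\lambda,e;Z)$ be the ideal of $\tilde{S}_{\mathcal{U}}$ generated by $\mathfrak{I}_0(Z)$ and all $\epsilon_i^{e(\pi(i))}$, $i\ge1$. Let $\iota\colon R\to\tilde{S}_{\mathcal{U}}$ be the $A$-algebra map $\xi_i\mapsto t_{\pi(i)}+\epsilon_i$. Then $\mathfrak{P}(\lambda,e;Z)=\{f\in R:\iota(\sigma f)\in\mathfrak{Q}_{\mathcal{U}}(\lambda,e;Z)\text{ for all }\sigma\in\mathfrak{S}\}$, which is independent of the choice of $\mathcal{U}$ of type $\lambda$. A good pair between $(\mu,d)$ and $(\lambda,e)$ is a pair $(\mathcal{E},\phi)$ with $\mathcal{E}\subset\mathcal{I}$ and $\phi\colon\mathcal{E}\to\mathcal{K}$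 a function such that, with $\mathcal{E}_\beta=\phi^{-1}(\beta)$ and $\mathcal{E}_\beta^\infty=\mathcal{E}_\beta\cap\mathcal{I}^\infty$: (G1) $\mu_\beta\le\sum_{\alpha\in\mathcal{E}_\beta}\lambda_\alpha$ for all $\beta\in\mathcal{K}$; (G2) $d_\beta\le\sum_{\alpha\in\mathcal{E}_\beta^\infty}e_\alpha$ for all $\beta\in\mathcal{K}^\infty$. Let $i\colon\mathbf{A}^{\mathcal{K}}\to\mathbf{A}^{\mathcal{E}}$ be the map $(y_\beta)\mapsto(y_{\phi(\alpha)})_{\alpha\in\mathcal{E}}$ and $p\colon\mathbf{A}^{\mathcal{I}}\to\mathbf{A}^{\mathcal{E}}$ the projection. Put $\Theta^\phi_{\mathcal{E}}(Z)=i^{-1}(\overline{p(Z)})\cap\mathbf{U}^{\mathcal{K}}$ (bar = Zariski closure in $\mathbf{A}^{\mathcal{E}}$), and let $\Theta^{\lambda,e}_{\mu,d}(Z)\subset\mathbf{U}^{\mathcal{K}}$ be the union of $\Theta^\phi_{\mathcal{E}}(Z)$ over all good pairs $(\mathcal{E},\phi)$ between $(\mu,d)$ and $(\lambda,e)$. *)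

theory Defs
  imports
    "HOL-Library.Poly_Mapping"
    "HOL-Library.Extended_Nat"
    "HOL-Combinatorics.Permutations"
    "HOL-Algebra.Algebraic_Closure_Type"
    "HOL-Analysis.Abstract_Topology"
begin

section \<open>Polynomial rings\<close>

text \<open>
  The type \<open>('v, 'a) mpoly\<close> is the polynomial ring over \<open>'a\<close> with one
  variable for each element of \<open>'v\<close>; the keys are the exponent vectors.
\<close>

type_synonym ('v, 'a) mpoly = "('v \<Rightarrow>\<^sub>0 nat) \<Rightarrow>\<^sub>0 'a"

definition PConst :: "'a::zero \<Rightarrow> ('v, 'a) mpoly" where
  "PConst c = Poly_Mapping.single 0 c"

definition PVar :: "'v \<Rightarrow> ('v, 'a::zero_neq_one) mpoly" where
  "PVar v = Poly_Mapping.single (Poly_Mapping.single v 1) 1"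

definition pvars :: "('v, 'a::zero) mpoly \<Rightarrow> 'v set" where
  "pvars f = (\<Union>m\<in>Poly_Mapping.keys f. Poly_Mapping.keys m)"

text \<open>
  For a ring homomorphism \<open>h\<close>, \<open>peval h g\<close> is the ring homomorphism that restricts to \<open>h\<close>
  on constants and sends the variable \<open>v\<close> to \<open>g v\<close>.
\<close>

definition peval ::
  "('a \<Rightarrow> 'b) \<Rightarrow> ('v \<Rightarrow> 'b) \<Rightarrow> ('v, 'a::comm_ring_1) mpoly \<Rightarrow> 'b::comm_ring_1" where
  "peval h g f = (\<Sum>m\<in>Poly_Mapping.keys f. h (Poly_Mapping.lookup f m) *
      (\<Prod>v\<in>Poly_Mapping.keys m. g v ^ Poly_Mapping.lookup m v))"

text \<open>The subring \<open>A[t\<^sub>\<alpha>]\<close>, \<open>\<alpha> \<in> E\<close>, of the polynomial ring in all variables.\<close>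

definition poly_ring :: "'v set \<Rightarrow> ('v, 'a::comm_ring_1) mpoly ring" where
  "poly_ring E = ring_of_type_algebra\<lparr>carrier := {f. pvars f \<subseteq> E}\<rparr>"


section \<open>Prime spectra\<close>

definition Spec :: "('r, 'm) ring_scheme \<Rightarrow> 'r set set" where
  "Spec R = {P. primeideal P R}"

definition zariski :: "('r, 'm) ring_scheme \<Rightarrow> 'r set topology" where
  "zariski R = topology (\<lambda>W. \<exists>J\<subseteq>carrier R. W = {P \<in> Spec R. \<not> J \<subseteq> P})"

definition spec_map ::
  "('r, 'm) ring_scheme \<Rightarrow> ('r \<Rightarrow> 's) \<Rightarrow> 's set \<Rightarrow> 'r set" where
  "spec_map R h P = {f \<in> carrier R. h f \<in> P}"

lemma istopology_zariski:
  "istopology (\<lambda>W. \<exists>J\<subseteq>carrier R. W = {P \<in> Spec R. \<not> J \<subseteq> P})"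
proof -
  have inter: "\<exists>J\<subseteq>carrier R. {P \<in> Spec R. \<not> J1 \<subseteq> P} \<inter> {P \<in> Spec R. \<not> J2 \<subseteq> P} = {P \<in> Spec R. \<not> J \<subseteq> P}"
    if J: "J1 \<subseteq> carrier R" "J2 \<subseteq> carrier R" for J1 J2
  proof (cases "Spec R = {}")
    case True
    then show ?thesis by auto
  next
    case False
    then obtain P0 where "primeideal P0 R" by (auto simp: Spec_def)
    then interpret cring R by (rule primeideal.axioms)
    let ?J = "{a \<otimes>\<^bsub>R\<^esub> b |a b. a \<in> J1 \<and> b \<in> J2}"
    have "?J \<subseteq> P \<longleftrightarrow> J1 \<subseteq> P \<or> J2 \<subseteq> P" if "P \<in> Spec R" for P
    proof -
      interpret P: primeideal P R using that by (simp add: Spec_def)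
      show ?thesis
      proof
        assume sub: "?J \<subseteq> P"
        show "J1 \<subseteq> P \<or> J2 \<subseteq> P"
        proof (rule ccontr)
          assume "\<not> ?thesis"
          then obtain a b where ab: "a \<in> J1" "a \<notin> P" "b \<in> J2" "b \<notin> P" by blast
          then have "a \<otimes>\<^bsub>R\<^esub> b \<in> P" using sub by blast
          then show False using ab J P.I_prime by blast
        qed
      next
        assume "J1 \<subseteq> P \<or> J2 \<subseteq> P"
        then show "?J \<subseteq> P"
          using J P.I_l_closed P.I_r_closed by blast
      qed
    qed
    then have "{P \<in> Spec R. \<not> J1 \<subseteq> P} \<inter> {P \<in> Spec R. \<not> J2 \<subseteq> P} = {P \<in> Spec R. \<not> ?J \<subseteq> P}"
      by blast
    moreover have "?J \<subseteq> carrier R" using J by auto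
    ultimately show ?thesis by blast
  qed
  have union: "\<exists>J\<subseteq>carrier R. \<Union>\<K> = {P \<in> Spec R. \<not> J \<subseteq> P}"
    if "\<forall>K\<in>\<K>. \<exists>J\<subseteq>carrier R. K = {P \<in> Spec R. \<not> J \<subseteq> P}" for \<K>
  proof -
    from that obtain J where J: "\<And>K. K \<in> \<K> \<Longrightarrow> J K \<subseteq> carrier R"
      "\<And>K. K \<in> \<K> \<Longrightarrow> K = {P \<in> Spec R. \<not> J K \<subseteq> P}" by metis
    have mem: "P \<in> K \<longleftrightarrow> P \<in> Spec R \<and> \<not> J K \<subseteq> P" if "K \<in> \<K>" for K P
      using J(2)[OF that] by blast
    have "P \<in> \<Union>\<K> \<longleftrightarrow> P \<in> Spec R \<and> \<not> (\<Union>K\<in>\<K>. J K) \<subseteq> P" for P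
      unfolding Union_iff UN_subset_iff using mem by blast
    moreover have "(\<Union>K\<in>\<K>. J K) \<subseteq> carrier R"
      using J(1) by blast
    ultimately show ?thesis by (intro exI[of _ "\<Union>K\<in>\<K>. J K"]) blast
  qed
  show ?thesis
    unfolding istopology_def
  proof (intro conjI allI impI)
    fix S T
    assume "\<exists>J\<subseteq>carrier R. S = {P \<in> Spec R. \<not> J \<subseteq> P}"
      "\<exists>J\<subseteq>carrier R. T = {P \<in> Spec R. \<not> J \<subseteq> P}"
    then obtain J1 J2 where "J1 \<subseteq> carrier R" "J2 \<subseteq> carrier R"
      "S = {P \<in> Spec R. \<not> J1 \<subseteq> P}" "T = {P \<in> Spec R. \<not> J2 \<subseteq> P}"
      by (elim exE conjE)
    then show "\<exists>J\<subseteq>carrier R. S \<inter> T = {P \<in> Spec R. \<not> J \<subseteq> P}"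
      using inter[of J1 J2] by simp
  next
    fix \<K>
    assume "\<forall>K\<in>\<K>. \<exists>J\<subseteq>carrier R. K = {P \<in> Spec R. \<not> J \<subseteq> P}"
    then show "\<exists>J\<subseteq>carrier R. \<Union>\<K> = {P \<in> Spec R. \<not> J \<subseteq> P}" by (rule union)
  qed
qed

lemma openin_zariski:
  "openin (zariski R) W \<longleftrightarrow> (\<exists>J\<subseteq>carrier R. W = {P \<in> Spec R. \<not> J \<subseteq> P})"
  unfolding zariski_def by (simp add: istopology_zariski)

lemma topspace_zariski: "topspace (zariski R) = Spec R"
proof -
  have "P \<in> {Q \<in> Spec R. \<not> carrier R \<subseteq> Q}" if "P \<in> Spec R" for P
  proof -
    interpret primeideal P R using that by (simp add: Spec_def)
    show ?thesis using that I_notcarr a_subset by auto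
  qed
  then have "openin (zariski R) (Spec R)"
    unfolding openin_zariski by (intro exI[of _ "carrier R"]) blast
  moreover have "W \<subseteq> Spec R" if "openin (zariski R) W" for W
    using that unfolding openin_zariski by blast
  ultimately show ?thesis unfolding topspace_def by blast
qed

lemma closedin_zariski:
  "closedin (zariski R) Z \<longleftrightarrow> (\<exists>J\<subseteq>carrier R. Z = {P \<in> Spec R. J \<subseteq> P})"
proof -
  have *: "Z \<subseteq> Spec R \<and> Spec R - Z = {P \<in> Spec R. \<not> J \<subseteq> P} \<longleftrightarrow> Z = {P \<in> Spec R. J \<subseteq> P}" for J
    by blast
  have "closedin (zariski R) Z \<longleftrightarrow> (\<exists>J\<subseteq>carrier R. Z \<subseteq> Spec R \<and> Spec R - Z = {P \<in> Spec R. \<not> J \<subseteq> P})"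
    by (auto simp only: closedin_def openin_zariski topspace_zariski)
  then show ?thesis by (simp only: *)
qed


section \<open>The coordinate ring of the configuration space\<close>

inductive_set diff_monoid :: "('v, 'a::comm_ring_1) mpoly set" where
  one: "1 \<in> diff_monoid"
| mult: "s \<in> diff_monoid \<Longrightarrow> \<alpha> \<noteq> \<beta> \<Longrightarrow> s * (PVar \<alpha> - PVar \<beta>) \<in> diff_monoid"

lemma diff_monoid_mult:
  assumes "s \<in> diff_monoid" "t \<in> diff_monoid"
  shows "s * t \<in> diff_monoid"
  using assms(2)
proof induction
  case one
  then show ?case using assms(1) by simp
next
  case (mult t \<alpha> \<beta>)
  then show ?case by (simp add: diff_monoid.mult flip: mult.assoc)
qed

lemma lookup_PVar_mult:
  fixes f :: "('v, 'a::comm_ring_1) mpoly"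
  shows "Poly_Mapping.lookup (PVar v * f) (Poly_Mapping.single v 1 + m) = Poly_Mapping.lookup f m"
proof -
  have *: "Poly_Mapping.lookup (PVar v :: ('v, 'a) mpoly) l * c =
      (c when l = Poly_Mapping.single v 1)" for l c
    by (auto simp: PVar_def lookup_single when_def)
  have "Poly_Mapping.lookup (PVar v * f) (Poly_Mapping.single v 1 + m) =
     Sum_any (\<lambda>l. Sum_any (\<lambda>q. Poly_Mapping.lookup f q when Poly_Mapping.single v 1 + m = l + q)
        when l = Poly_Mapping.single v 1)"
    unfolding lookup_mult * ..
  then show ?thesis by simp
qed

lemma lookup_PVar_mult_eq_0:
  fixes f :: "('v, 'a::comm_ring_1) mpoly"
  assumes "Poly_Mapping.lookup m v = 0"
  shows "Poly_Mapping.lookup (PVar v * f) m = 0"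
proof -
  have *: "Poly_Mapping.lookup (PVar v :: ('v, 'a) mpoly) l * c =
      (c when l = Poly_Mapping.single v 1)" for l c
    by (auto simp: PVar_def lookup_single when_def)
  have **: "m \<noteq> Poly_Mapping.single v 1 + q" for q
    using assms by (metis One_nat_def add_is_0 lookup_add lookup_single_eq nat.distinct(1))
  have "Poly_Mapping.lookup (PVar v * f) m =
     Sum_any (\<lambda>l. Sum_any (\<lambda>q. Poly_Mapping.lookup f q when m = l + q)
        when l = Poly_Mapping.single v 1)"
    unfolding lookup_mult * ..
  then show ?thesis using ** by simp
qed

lemma PVar_diff_regular:
  fixes f :: "('v, 'a::comm_ring_1) mpoly"
  assumes "\<alpha> \<noteq> \<beta>" "f * (PVar \<alpha> - PVar \<beta>) = 0"
  shows "f = 0"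
proof -
  have eq: "PVar \<alpha> * f = PVar \<beta> * f"
    using assms(2) by (simp add: algebra_simps)
  have "Poly_Mapping.lookup f m = 0" if "Poly_Mapping.lookup m \<beta> = n" for m n
    using that
  proof (induction n arbitrary: m)
    case 0
    have "Poly_Mapping.lookup (PVar \<beta> * f) (Poly_Mapping.single \<alpha> 1 + m) = 0"
      using 0 assms(1) by (intro lookup_PVar_mult_eq_0) (simp add: lookup_add lookup_single)
    then show ?case using lookup_PVar_mult[of \<alpha> f m] eq by simp
  next
    case (Suc n)
    define m' where "m' = m - Poly_Mapping.single \<beta> 1"
    have m: "m = Poly_Mapping.single \<beta> 1 + m'"
      unfolding m'_def using Suc.prems
      by (intro poly_mapping_eqI) (auto simp: lookup_add lookup_minus lookup_single when_def)
    have "Poly_Mapping.lookup f m =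
        Poly_Mapping.lookup (PVar \<beta> * f) (Poly_Mapping.single \<alpha> 1 + m)"
      using lookup_PVar_mult[of \<alpha> f m] eq by simp
    also have "\<dots> = Poly_Mapping.lookup (PVar \<beta> * f)
        (Poly_Mapping.single \<beta> 1 + (Poly_Mapping.single \<alpha> 1 + m'))"
      unfolding m by (simp add: add.left_commute)
    also have "\<dots> = Poly_Mapping.lookup f (Poly_Mapping.single \<alpha> 1 + m')"
      by (rule lookup_PVar_mult)
    also have "\<dots> = 0"
      using Suc.prems assms(1) by (intro Suc.IH) (simp add: m lookup_add lookup_single)
    finally show ?case .
  qed
  then show ?thesis by (intro poly_mapping_eqI) simp
qed

lemma diff_monoid_regular:
  "s \<in> diff_monoid \<Longrightarrow> f * s = 0 \<Longrightarrow> f = (0 :: ('v, 'a::comm_ring_1) mpoly)"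
proof (induction s arbitrary: f rule: diff_monoid.induct)
  case (mult s \<alpha> \<beta>)
  have "f * s * (PVar \<alpha> - PVar \<beta>) = 0"
    using mult.prems by (simp only: mult.assoc)
  with mult.hyps(2) have "f * s = 0" by (rule PVar_diff_regular)
  then show ?case by (rule mult.IH)
qed simp

text \<open>
  The localization of \<open>('v, 'a) mpoly\<close> at the multiplicative set \<^const>\<open>diff_monoid\<close>,
  i.e. \<open>A[t\<^sub>\<alpha>][(t\<^sub>\<alpha> - t\<^sub>\<beta>)\<^sup>-\<^sup>1]\<close>, as classes of fractions.
\<close>

definition frac_rel ::
  "('v, 'a::comm_ring_1) mpoly \<times> ('v, 'a) mpoly \<Rightarrow> ('v, 'a) mpoly \<times> ('v, 'a) mpoly \<Rightarrow> bool" where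
  "frac_rel x y \<longleftrightarrow> snd x \<in> diff_monoid \<and> snd y \<in> diff_monoid \<and>
     (\<exists>u\<in>diff_monoid. u * (fst x * snd y - fst y * snd x) = 0)"

lemma frac_rel_iff:
  "frac_rel x y \<longleftrightarrow> snd x \<in> diff_monoid \<and> snd y \<in> diff_monoid \<and> fst x * snd y = fst y * snd x"
proof
  assume xy: "frac_rel x y"
  then obtain u where "u \<in> diff_monoid" "u * (fst x * snd y - fst y * snd x) = 0"
    by (auto simp: frac_rel_def)
  then have "fst x * snd y - fst y * snd x = 0"
    using diff_monoid_regular[of u "fst x * snd y - fst y * snd x"] by (simp add: mult.commute)
  then show "snd x \<in> diff_monoid \<and> snd y \<in> diff_monoid \<and> fst x * snd y = fst y * snd x"
    using xy by (simp add: frac_rel_def)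
next
  assume "snd x \<in> diff_monoid \<and> snd y \<in> diff_monoid \<and> fst x * snd y = fst y * snd x"
  then show "frac_rel x y"
    unfolding frac_rel_def by (auto intro!: bexI[of _ 1] diff_monoid.one)
qed

lemma part_equivp_frac_rel:
  "part_equivp (frac_rel :: ('v, 'a::comm_ring_1) mpoly \<times> ('v, 'a) mpoly \<Rightarrow> _)"
  (is "part_equivp ?R")
proof (rule part_equivpI)
  show "\<exists>x. ?R x x"
    by (rule exI[of _ "(0, 1)"]) (simp add: frac_rel_iff diff_monoid.one)
  show "symp ?R"
    by (rule sympI) (simp add: frac_rel_iff)
  show "transp ?R"
  proof (rule transpI)
    fix x y z :: "('v, 'a) mpoly \<times> ('v, 'a) mpoly"
    assume xy: "frac_rel x y" and yz: "frac_rel y z"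
    have "(fst x * snd z - fst z * snd x) * snd y =
        (fst x * snd y) * snd z - (fst z * snd y) * snd x"
      by (simp add: algebra_simps)
    also have "\<dots> = (fst y * snd x) * snd z - (fst y * snd z) * snd x"
      using xy yz by (simp add: frac_rel_iff)
    also have "\<dots> = 0" by (simp add: algebra_simps)
    finally have eq: "(fst x * snd z - fst z * snd x) * snd y = 0" .
    have dens: "snd x \<in> diff_monoid" "snd y \<in> diff_monoid" "snd z \<in> diff_monoid"
      using xy yz by (simp_all only: frac_rel_iff)
    have "fst x * snd z - fst z * snd x = 0"
      using dens(2) eq by (rule diff_monoid_regular)
    then show "frac_rel x z"
      using dens by (simp add: frac_rel_iff)
  qed
qed

quotient_type (overloaded) ('v, 'a) conf_ring =
  "('v, 'a::comm_ring_1) mpoly \<times> ('v, 'a) mpoly" / partial: frac_rel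
  by (rule part_equivp_frac_rel)

instantiation conf_ring :: (type, comm_ring_1) comm_ring_1
begin

lift_definition zero_conf_ring :: "('a, 'b) conf_ring" is "(0, 1)"
  by (simp add: frac_rel_iff diff_monoid.one)

lift_definition one_conf_ring :: "('a, 'b) conf_ring" is "(1, 1)"
  by (simp add: frac_rel_iff diff_monoid.one)

lift_definition plus_conf_ring ::
  "('a, 'b) conf_ring \<Rightarrow> ('a, 'b) conf_ring \<Rightarrow> ('a, 'b) conf_ring"
  is "\<lambda>x y. (fst x * snd y + fst y * snd x, snd x * snd y)"
proof -
  fix x x' y y' :: "('a, 'b) mpoly \<times> ('a, 'b) mpoly"
  assume a: "frac_rel x x'" "frac_rel y y'"
  have "(fst x * snd y + fst y * snd x) * (snd x' * snd y') =
      (fst x * snd x') * (snd y * snd y') + (fst y * snd y') * (snd x * snd x')"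
    by (simp add: algebra_simps)
  also have "\<dots> = (fst x' * snd x) * (snd y * snd y') + (fst y' * snd y) * (snd x * snd x')"
    using a by (simp add: frac_rel_iff)
  also have "\<dots> = (fst x' * snd y' + fst y' * snd x') * (snd x * snd y)"
    by (simp add: algebra_simps)
  finally show "frac_rel (fst x * snd y + fst y * snd x, snd x * snd y)
      (fst x' * snd y' + fst y' * snd x', snd x' * snd y')"
    using a by (simp add: frac_rel_iff diff_monoid_mult)
qed

lift_definition uminus_conf_ring :: "('a, 'b) conf_ring \<Rightarrow> ('a, 'b) conf_ring"
  is "\<lambda>x. (- fst x, snd x)"
  by (simp add: frac_rel_iff)

definition minus_conf_ring ::
  "('a, 'b) conf_ring \<Rightarrow> ('a, 'b) conf_ring \<Rightarrow> ('a, 'b) conf_ring" where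
  "minus_conf_ring x y = x + - y"

lift_definition times_conf_ring ::
  "('a, 'b) conf_ring \<Rightarrow> ('a, 'b) conf_ring \<Rightarrow> ('a, 'b) conf_ring"
  is "\<lambda>x y. (fst x * fst y, snd x * snd y)"
proof -
  fix x x' y y' :: "('a, 'b) mpoly \<times> ('a, 'b) mpoly"
  assume a: "frac_rel x x'" "frac_rel y y'"
  have "(fst x * fst y) * (snd x' * snd y') = (fst x * snd x') * (fst y * snd y')"
    by (simp add: algebra_simps)
  also have "\<dots> = (fst x' * snd x) * (fst y' * snd y)"
    using a by (simp add: frac_rel_iff)
  also have "\<dots> = (fst x' * fst y') * (snd x * snd y)"
    by (simp add: algebra_simps)
  finally show "frac_rel (fst x * fst y, snd x * snd y) (fst x' * fst y', snd x' * snd y')"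
    using a by (simp add: frac_rel_iff diff_monoid_mult)
qed

instance
proof
  fix a b c :: "('a, 'b) conf_ring"
  show "a * b * c = a * (b * c)"
    by transfer (simp add: frac_rel_iff diff_monoid_mult algebra_simps)
  show "a * b = b * a"
    by transfer (simp add: frac_rel_iff diff_monoid_mult algebra_simps)
  show "1 * a = a"
    by transfer (simp add: frac_rel_iff)
  show "a + b + c = a + (b + c)"
    by transfer (simp add: frac_rel_iff diff_monoid_mult algebra_simps)
  show "a + b = b + a"
    by transfer (simp add: frac_rel_iff diff_monoid_mult algebra_simps)
  show "0 + a = a"
    by transfer (simp add: frac_rel_iff)
  show "- a + a = 0"
    by transfer (simp add: frac_rel_iff diff_monoid_mult diff_monoid.one algebra_simps)
  show "a - b = a + - b"
    by (rule minus_conf_ring_def)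
  show "(a + b) * c = a * c + b * c"
    by transfer (simp add: frac_rel_iff diff_monoid_mult algebra_simps)
  show "(0 :: ('a, 'b) conf_ring) \<noteq> 1"
    by transfer (simp add: frac_rel_iff)
qed

end

definition to_conf :: "('v, 'a::comm_ring_1) mpoly \<Rightarrow> ('v, 'a) conf_ring" where
  "to_conf f = abs_conf_ring (f, 1)"

text \<open>
  The scheme \<open>U\<^sup>I\<close>; its points are prime ideals of the localization, and \<open>emb\<close> is the
  open immersion into \<open>A\<^sup>I\<close>.
\<close>

definition conf_space :: "('v, 'a::comm_ring_1) conf_ring set topology" where
  "conf_space = zariski ring_of_type_algebra"

definition emb :: "('v, 'a::comm_ring_1) conf_ring set \<Rightarrow> ('v, 'a) mpoly set" where
  "emb P = spec_map (poly_ring UNIV) to_conf P"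


section \<open>Compositions, weightings and partitions\<close>

definition inf_composition :: "('i \<Rightarrow> enat) \<Rightarrow> bool" where
  "inf_composition lam \<longleftrightarrow> (\<forall>\<alpha>. 1 \<le> lam \<alpha>) \<and> (\<exists>\<alpha>. lam \<alpha> = \<infinity>)"

definition weighting :: "('i \<Rightarrow> nat) \<Rightarrow> bool" where
  "weighting e \<longleftrightarrow> (\<forall>\<alpha>. 1 \<le> e \<alpha>)"

definition reduced :: "('i \<Rightarrow> enat) \<Rightarrow> ('i \<Rightarrow> nat) \<Rightarrow> bool" where
  "reduced lam e \<longleftrightarrow> (\<forall>\<alpha>. lam \<alpha> < \<infinity> \<longrightarrow> e \<alpha> = 1)"

definition set_size :: "'b set \<Rightarrow> enat" where
  "set_size S = (if finite S then enat (card S) else \<infinity>)"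

text \<open>The countable index set \<open>[\<infinity>]\<close> of the variables \<open>\<xi>\<^sub>i\<close> is modelled by \<^typ>\<open>nat\<close>.\<close>

definition partition_of_type :: "('i \<Rightarrow> enat) \<Rightarrow> ('i \<Rightarrow> nat set) \<Rightarrow> bool" where
  "partition_of_type lam U \<longleftrightarrow> disjoint_family U \<and> (\<forall>\<alpha>. U \<alpha> \<noteq> {}) \<and> (\<Union>\<alpha>. U \<alpha>) = UNIV \<and>
     (\<forall>\<alpha>. set_size (U \<alpha>) = lam \<alpha>)"

definition part_index :: "('i \<Rightarrow> nat set) \<Rightarrow> nat \<Rightarrow> 'i" where
  "part_index U i = (THE \<alpha>. i \<in> U \<alpha>)"


section \<open>The ideals \<open>\<PP>(\<lambda>, e; Z)\<close>\<close>

definition fin_perms :: "(nat \<Rightarrow> nat) set" where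
  "fin_perms = (\<Union>n. {\<sigma>. \<sigma> permutes {..<n}})"

definition perm_act :: "(nat \<Rightarrow> nat) \<Rightarrow> (nat, 'a::comm_ring_1) mpoly \<Rightarrow> (nat, 'a) mpoly" where
  "perm_act \<sigma> = peval PConst (\<lambda>i. PVar (\<sigma> i))"

definition iota ::
  "('i \<Rightarrow> nat set) \<Rightarrow> (nat, 'a::comm_ring_1) mpoly \<Rightarrow> (nat, ('i, 'a) conf_ring) mpoly" where
  "iota U = peval (\<lambda>c. PConst (to_conf (PConst c)))
     (\<lambda>i. PConst (to_conf (PVar (part_index U i))) + PVar i)"

text \<open>For empty \<open>Z\<close> this is the unit ideal.\<close>

definition radical_ideal ::
  "('i, 'a::comm_ring_1) conf_ring set set \<Rightarrow> ('i, 'a) conf_ring set" where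
  "radical_ideal Z = \<Inter>Z"

definition QQ :: "('i \<Rightarrow> nat) \<Rightarrow> ('i \<Rightarrow> nat set) \<Rightarrow> ('i, 'a::comm_ring_1) conf_ring set set \<Rightarrow>
    (nat, ('i, 'a) conf_ring) mpoly set" where
  "QQ e U Z = Idl\<^bsub>ring_of_type_algebra\<^esub>
     (PConst ` radical_ideal Z \<union> range (\<lambda>i. PVar i ^ e (part_index U i)))"

text \<open>The composition \<open>\<lambda>\<close> enters through the partition \<open>U\<close> of type \<open>\<lambda>\<close>.\<close>

definition PP :: "('i \<Rightarrow> nat) \<Rightarrow> ('i \<Rightarrow> nat set) \<Rightarrow> ('i, 'a::comm_ring_1) conf_ring set set \<Rightarrow>
    (nat, 'a) mpoly set" where
  "PP e U Z = {f. \<forall>\<sigma>\<in>fin_perms. iota U (perm_act \<sigma> f) \<in> QQ e U Z}"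


section \<open>Good pairs and the loci \<open>\<Theta>\<close>\<close>

text \<open>Only the values of \<open>\<phi>\<close> on \<open>E\<close> are relevant.\<close>

definition good_pair :: "('k \<Rightarrow> enat) \<Rightarrow> ('k \<Rightarrow> nat) \<Rightarrow> ('i \<Rightarrow> enat) \<Rightarrow> ('i \<Rightarrow> nat) \<Rightarrow>
    'i set \<Rightarrow> ('i \<Rightarrow> 'k) \<Rightarrow> bool" where
  "good_pair mu d lam e E \<phi> \<longleftrightarrow>
     (\<forall>\<beta>. mu \<beta> \<le> (\<Sum>\<alpha> | \<alpha> \<in> E \<and> \<phi> \<alpha> = \<beta>. lam \<alpha>)) \<and>
     (\<forall>\<beta>. mu \<beta> = \<infinity> \<longrightarrow> d \<beta> \<le> (\<Sum>\<alpha> | \<alpha> \<in> E \<and> \<phi> \<alpha> = \<beta> \<and> lam \<alpha> = \<infinity>. e \<alpha>))"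

definition proj_map :: "'i set \<Rightarrow> ('i, 'a::comm_ring_1) mpoly set \<Rightarrow> ('i, 'a) mpoly set" where
  "proj_map E P = spec_map (poly_ring E) (\<lambda>f. f) P"

text \<open>
  The map \<open>(y\<^sub>\<beta>) \<mapsto> (y\<^bsub>\<phi> \<alpha>\<^esub>)\<close> from \<open>A\<^sup>K\<close> to \<open>A\<^sup>E\<close> is dual to \<open>t\<^sub>\<alpha> \<mapsto> t\<^bsub>\<phi> \<alpha>\<^esub>\<close>.
\<close>

definition diag_map ::
  "'i set \<Rightarrow> ('i \<Rightarrow> 'k) \<Rightarrow> ('k, 'a::comm_ring_1) mpoly set \<Rightarrow> ('i, 'a) mpoly set" where
  "diag_map E \<phi> P = spec_map (poly_ring E) (peval PConst (\<lambda>\<alpha>. PVar (\<phi> \<alpha>))) P"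

definition Theta_pair :: "'i set \<Rightarrow> ('i \<Rightarrow> 'k) \<Rightarrow> ('i, 'a::comm_ring_1) conf_ring set set \<Rightarrow>
    ('k, 'a) conf_ring set set" where
  "Theta_pair E \<phi> Z = {Q \<in> topspace conf_space.
     diag_map E \<phi> (emb Q) \<in> zariski (poly_ring E) closure_of ((\<lambda>P. proj_map E (emb P)) ` Z)}"

definition Theta :: "('k \<Rightarrow> enat) \<Rightarrow> ('k \<Rightarrow> nat) \<Rightarrow> ('i \<Rightarrow> enat) \<Rightarrow> ('i \<Rightarrow> nat) \<Rightarrow>
    ('i, 'a::comm_ring_1) conf_ring set set \<Rightarrow> ('k, 'a) conf_ring set set" where
  "Theta mu d lam e Z = \<Union>{Theta_pair E \<phi> Z |E \<phi>. good_pair mu d lam e E \<phi>}"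

end

theory Submission
  imports Defs
begin

text \<open>
  The two conditions of \<^const>\<open>good_pair\<close> are called (G1) and (G2), and \<open>\<rho> i\<close> is the block of
  \<open>i\<close> for \<open>\<mu>\<close>.  By a comparison of coefficients (\<open>QQ_eq_jet_ideal\<close>), a polynomial \<open>f\<close> lies in
  \<open>\<PP>(\<lambda>, e; Z)\<close> iff for every point \<open>P\<close> of \<open>Z\<close> and every assignment \<open>p\<close> of the variables of \<open>f\<close>
  to the blocks, using block \<open>\<alpha>\<close> at most \<open>\<lambda>\<^sub>\<alpha>\<close> times, the Taylor coefficients of
  \<open>f(t\<^bsub>p i\<^esub> + \<epsilon>\<^sub>i)\<close> at the monomials \<open>\<epsilon>\<^sup>k\<close> with \<open>k\<^sub>i < e\<^bsub>p i\<^esub>\<close> vanish at \<open>P\<close>; say that \<open>f\<close>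
  vanishes at the assignment \<open>p\<close>.

  Suppose that \<open>Q \<in> Y\<close> lies in \<open>\<Theta>\<close> through the good pair \<open>(E, \<phi>)\<close>.  The Taylor coefficient of
  order \<open>k\<^sub>i\<close> at a point is the divided difference at \<open>k\<^sub>i + 1\<close> equal nodes.  By (G2) and (G1), it is
  the specialization along \<open>\<phi>\<close> of a divided difference of \<open>f\<close> at nodes \<open>t\<^sub>\<alpha>\<close> with
  \<open>\<phi> \<alpha> = \<rho> i\<close>, each used at most \<open>e\<^sub>\<alpha>\<close> times.  Divided differences are polynomials
  in the nodes (\<open>divdiff\<close>); where the differences of the nodes are invertible, they are linear
  combinations of Taylor coefficients at the single nodes (\<open>divdiff_partial_fractions\<close>), so
  those of a member of \<open>\<PP>(\<lambda>, e; Z)\<close> vanish on \<open>Z\<close>.  A polynomial in \<open>t\<^sub>\<alpha>\<close>, \<open>\<alpha> \<in> E\<close>, that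
  vanishes on \<open>Z\<close> vanishes on the closure of the projection of \<open>Z\<close>, hence at \<open>Q\<close> after
  substitution along \<open>\<phi>\<close>.  This is \<open>PP_subset_of_Theta\<close>.

  Suppose conversely that \<open>Q \<in> Y\<close> lies outside \<open>\<Theta>\<close>.  A polynomial \<open>f\<close> in \<open>\<PP>(\<lambda>, e; Z)\<close> but not
  in \<open>\<PP>(\<mu>, d; Y)\<close> is a product of three kinds of factors, in variables indexed by a finite set that
  meets the finite blocks of \<open>\<mu>\<close> entirely and the infinite ones in many points.  Powers of
  \<open>\<xi>\<^sub>i - \<xi>\<^sub>j\<close> for \<open>i\<close>, \<open>j\<close> in different blocks of \<open>\<mu>\<close> vanish at all assignments \<open>p\<close> except
  those for which \<open>\<rho> = \<phi> \<circ> p\<close> for some \<open>\<phi>\<close>.  Such a \<open>\<phi>\<close> satisfies (G1) automatically, and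
  a product of Vandermonde determinants in \<open>d\<^sub>\<beta>\<close> variables each vanishes if (G2) fails at \<open>\<beta>\<close>,
  since the variables of one of them are then roots of a monic polynomial of degree less than
  \<open>d\<^sub>\<beta>\<close> (\<open>vandermonde_mem\<close>).  If \<open>\<phi>\<close> gives a good pair, there is a polynomial in the \<open>t\<^sub>\<alpha>\<close> that
  vanishes on \<open>Z\<close> but not at the image of \<open>Q\<close>; its powers, with \<open>t\<^sub>\<alpha>\<close> replaced by some \<open>\<xi>\<^sub>i\<close>
  with \<open>p i = \<alpha>\<close>, are the remaining factors.  At \<open>Q\<close>, all factors but the Vandermonde products
  are nonzero constants up to nilpotents (\<open>regular_mod_jet_ideal\<close>), and the Vandermonde
  products survive because of their leading monomials (\<open>prod_vandermonde_notin\<close>).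
  This is \<open>subset_Theta_of_PP_subset\<close>.
\<close>

section \<open>Ideals and homomorphisms of commutative rings\<close>

text \<open>
  Ideals of a ring that is given by a type.  They correspond to the ideals of
  \<^const>\<open>ring_of_type_algebra\<close>.
\<close>

locale type_ideal =
  fixes N :: "'r::comm_ring_1 set"
  assumes zero_mem: "0 \<in> N"
    and add_mem: "a \<in> N \<Longrightarrow> b \<in> N \<Longrightarrow> a + b \<in> N"
    and mult_mem: "a \<in> N \<Longrightarrow> r * a \<in> N"
begin

lemma mult_mem_left: "a \<in> N \<Longrightarrow> a * r \<in> N"
  using mult_mem[of a r] by (simp add: mult.commute)

lemma uminus_mem: "a \<in> N \<Longrightarrow> - a \<in> N"
  using mult_mem[of a "-1"] by simp

lemma diff_mem: "a \<in> N \<Longrightarrow> b \<in> N \<Longrightarrow> a - b \<in> N"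
  using add_mem[of a "- b"] uminus_mem[of b] by simp

lemma sum_mem: "(\<And>x. x \<in> A \<Longrightarrow> f x \<in> N) \<Longrightarrow> sum f A \<in> N"
  by (induction A rule: infinite_finite_induct) (auto intro: zero_mem add_mem)

lemma Sum_any_mem: "(\<And>x. f x \<in> N) \<Longrightarrow> Sum_any f \<in> N"
  by (simp add: Sum_any.expand_set sum_mem)

lemma prod_mem: "finite A \<Longrightarrow> x \<in> A \<Longrightarrow> f x \<in> N \<Longrightarrow> prod f A \<in> N"
  by (simp add: prod.remove[of A x] mult_mem_left)

lemma power_mem_mono: "a ^ n \<in> N \<Longrightarrow> n \<le> m \<Longrightarrow> a ^ m \<in> N"
  using mult_mem_left[of "a ^ n" "a ^ (m - n)"] by (simp flip: power_add)

lemma power_add_mem: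
  assumes "a ^ n \<in> N" "b ^ m \<in> N"
  shows "(a + b) ^ (n + m) \<in> N"
  unfolding binomial_ring
proof (rule sum_mem)
  fix k
  show "of_nat (n + m choose k) * a ^ k * b ^ (n + m - k) \<in> N"
  proof (cases "n \<le> k")
    case True
    with assms(1) have "a ^ k \<in> N" by (rule power_mem_mono)
    then show ?thesis by (intro mult_mem_left mult_mem)
  next
    case False
    then have "b ^ (n + m - k) \<in> N" using assms(2) by (auto intro: power_mem_mono[of b m])
    then show ?thesis by (rule mult_mem)
  qed
qed

lemma power_diff_mem:
  assumes "a ^ n \<in> N" "b ^ m \<in> N"
  shows "(a - b) ^ (n + m) \<in> N"
proof -
  have "(- b) ^ m \<in> N" unfolding power_minus[of b] using assms(2) by (rule mult_mem)
  with assms(1) have "(a + - b) ^ (n + m) \<in> N" by (rule power_add_mem)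
  then show ?thesis by simp
qed

text \<open>
  An element of the ideal plus a combination of nilpotents \<open>a x\<close>: the exponent depends only on
  the orders of nilpotency, not on the coefficients \<open>c\<close>.
\<close>

lemma power_add_sum_mem:
  assumes "finite A" "c0 \<in> N" "\<And>x. x \<in> A \<Longrightarrow> a x ^ n x \<in> N"
  shows "(c0 + (\<Sum>x\<in>A. c x * a x)) ^ Suc (sum n A) \<in> N"
  using assms(1,3)
proof (induction A rule: finite_induct)
  case empty
  then show ?case using assms(2) by simp
next
  case (insert x A)
  have "(c x * a x) ^ n x \<in> N"
    using insert.prems[of x] by (simp add: power_mult_distrib mult_mem)
  then have "((c0 + (\<Sum>x\<in>A. c x * a x)) + c x * a x) ^ (Suc (sum n A) + n x) \<in> N"
    using insert by (intro power_add_mem) auto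
  moreover have "(c0 + (\<Sum>x\<in>A. c x * a x)) + c x * a x = c0 + (\<Sum>x\<in>insert x A. c x * a x)"
    using insert.hyps by (simp add: algebra_simps)
  moreover have "Suc (sum n A) + n x = Suc (sum n (insert x A))"
    using insert.hyps by simp
  ultimately show ?case by (simp only:)
qed

text \<open>
  The ideal quotient of \<open>N\<close> by \<open>c\<close>.
\<close>

lemma colon: "type_ideal {a. a * c \<in> N}"
  by unfold_locales (auto simp: zero_mem add_mem mult_mem distrib_right mult.assoc)

end

text \<open>
  Prime ideals of a ring that is given by a type; they are proper.
\<close>

locale type_prime = type_ideal +
  assumes one_notin: "1 \<notin> N"
    and prime: "a * b \<in> N \<Longrightarrow> a \<in> N \<or> b \<in> N"
begin

lemma power_memD: "a ^ n \<in> N \<Longrightarrow> a \<in> N"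
  by (induction n) (auto simp: one_notin dest: prime)

lemma unit_notin: "a * b = 1 \<Longrightarrow> a \<notin> N"
  using mult_mem_left[of a b] one_notin by auto

end

lemma type_ideal_Inter: "(\<And>P. P \<in> Z \<Longrightarrow> type_ideal P) \<Longrightarrow> type_ideal (\<Inter>Z)"
  unfolding type_ideal_def by blast

lemma a_inv_type_algebra:
  "a_inv (ring_of_type_algebra :: 'a::comm_ring_1 ring) x = - x"
proof -
  interpret cring "ring_of_type_algebra :: 'a ring" by (rule cring_from_type_algebra)
  show ?thesis by (rule minus_equality) (simp_all add: ring_of_type_algebra_def)
qed

lemma type_ideal_of_ideal:
  assumes "ideal N (ring_of_type_algebra :: 'a::comm_ring_1 ring)"
  shows "type_ideal N"
proof -
  interpret ideal N "ring_of_type_algebra :: 'a ring" by (rule assms)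
  show ?thesis
    using additive_subgroup.zero_closed[OF is_additive_subgroup]
      additive_subgroup.a_closed[OF is_additive_subgroup] I_l_closed
    by unfold_locales (simp_all add: ring_of_type_algebra_def)
qed

lemma ideal_of_type_ideal:
  fixes N :: "'a::comm_ring_1 set"
  assumes "type_ideal N"
  shows "ideal N ring_of_type_algebra"
proof -
  interpret N: type_ideal N by (rule assms)
  interpret R: cring "ring_of_type_algebra :: 'a ring" by (rule cring_from_type_algebra)
  show ?thesis
  proof (rule idealI)
    show "ring (ring_of_type_algebra :: 'a ring)" by (rule R.ring_axioms)
    show "subgroup N (add_monoid (ring_of_type_algebra :: 'a ring))"
    proof (rule R.add.subgroupI)
      show "N \<subseteq> carrier ring_of_type_algebra" by (simp add: ring_of_type_algebra_def)
      show "N \<noteq> {}" using N.zero_mem by blast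
      show "\<ominus>\<^bsub>ring_of_type_algebra\<^esub> a \<in> N" if "a \<in> N" for a
        using N.uminus_mem[OF that] by (simp only: a_inv_type_algebra)
      show "a \<oplus>\<^bsub>ring_of_type_algebra\<^esub> b \<in> N" if "a \<in> N" "b \<in> N" for a b
        using N.add_mem[OF that] by (simp add: ring_of_type_algebra_def)
    qed
  qed (simp_all add: ring_of_type_algebra_def N.mult_mem N.mult_mem_left)
qed

lemma type_prime_of_Spec:
  assumes "P \<in> Spec (ring_of_type_algebra :: 'a::comm_ring_1 ring)"
  shows "type_prime P"
proof -
  interpret primeideal P "ring_of_type_algebra :: 'a ring"
    using assms by (simp add: Spec_def)
  interpret N: type_ideal P by (rule type_ideal_of_ideal) (rule is_ideal)
  show ?thesis
  proof
    show "1 \<notin> P"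
      using I_notcarr N.mult_mem[of 1] by (auto simp: ring_of_type_algebra_def)
    show "a \<in> P \<or> b \<in> P" if "a * b \<in> P" for a b
      using I_prime[of a b] that by (simp add: ring_of_type_algebra_def)
  qed
qed

text \<open>
  Unital ring homomorphisms between commutative rings given by types.
\<close>

locale rhom =
  fixes h :: "'a::comm_ring_1 \<Rightarrow> 'b::comm_ring_1"
  assumes hom_add: "h (x + y) = h x + h y"
    and hom_mult: "h (x * y) = h x * h y"
    and hom_one: "h 1 = 1"
begin

lemma hom_zero: "h 0 = 0"
  using hom_add[of 0 0] by simp

lemma hom_uminus: "h (- x) = - h x"
  using hom_add[of x "- x"] by (simp add: hom_zero eq_neg_iff_add_eq_0 add.commute)

lemma hom_diff: "h (x - y) = h x - h y"
  using hom_add[of x "- y"] by (simp add: hom_uminus)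

lemma hom_sum: "h (sum f A) = (\<Sum>x\<in>A. h (f x))"
  by (induction A rule: infinite_finite_induct) (auto simp: hom_zero hom_add)

lemma hom_prod: "h (prod f A) = (\<Prod>x\<in>A. h (f x))"
  by (induction A rule: infinite_finite_induct) (auto simp: hom_one hom_mult)

lemma hom_power: "h (x ^ n) = h x ^ n"
  by (induction n) (auto simp: hom_one hom_mult)

end

lemma rhom_comp: "rhom g \<Longrightarrow> rhom h \<Longrightarrow> rhom (\<lambda>x. g (h x))"
  by (simp add: rhom_def)

lemma rhom_id: "rhom (\<lambda>x. x)"
  by (simp add: rhom_def)

section \<open>Polynomials\<close>

lemma rhom_PConst: "rhom PConst"
  by unfold_locales (simp_all add: PConst_def single_add mult_single)

lemma PVar_power: "PVar v ^ n = Poly_Mapping.single (Poly_Mapping.single v n) (1::'a::comm_ring_1)"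
  by (induction n) (simp_all add: PVar_def mult_single flip: single_add)

lemma poly_mapping_eq_sum_single:
  fixes f :: "'k \<Rightarrow>\<^sub>0 'a::comm_monoid_add"
  shows "f = (\<Sum>m\<in>Poly_Mapping.keys f. Poly_Mapping.single m (Poly_Mapping.lookup f m))"
  by (rule poly_mapping_eqI)
    (simp add: lookup_sum lookup_single when_def sum.delta in_keys_iff)

lemma pvars_PConst: "pvars (PConst c) = {}"
  by (simp add: pvars_def PConst_def)

lemma pvars_PVar: "pvars (PVar v :: ('v, 'a::comm_ring_1) mpoly) = {v}"
  by (simp add: pvars_def PVar_def)

lemma pvars_0: "pvars 0 = {}" and pvars_1: "pvars (1 :: ('v, 'a::comm_ring_1) mpoly) = {}"
  by (simp_all add: pvars_def)

lemma pvars_add: "pvars (f + g) \<subseteq> pvars f \<union> pvars g"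
  using keys_add[of f g] by (auto simp: pvars_def)

lemma pvars_uminus: "pvars (- f) = pvars (f :: ('v, 'a::comm_ring_1) mpoly)"
  by (simp add: pvars_def in_keys_iff set_eq_iff)

lemma pvars_mult: "pvars (f * g) \<subseteq> pvars f \<union> pvars (g :: ('v, 'a::comm_ring_1) mpoly)"
proof
  fix v assume "v \<in> pvars (f * g)"
  then obtain m where m: "m \<in> Poly_Mapping.keys (f * g)" "v \<in> Poly_Mapping.keys m"
    by (auto simp: pvars_def)
  then obtain a b where ab: "m = a + b" "a \<in> Poly_Mapping.keys f" "b \<in> Poly_Mapping.keys g"
    using keys_mult[of f g] by blast
  then show "v \<in> pvars f \<union> pvars g"
    using m(2) keys_add[of a b] by (auto simp: pvars_def)
qed

lemma pvars_sum: "(\<And>x. x \<in> A \<Longrightarrow> pvars (f x) \<subseteq> B) \<Longrightarrow> pvars (sum f A) \<subseteq> B"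
proof (induction A rule: infinite_finite_induct)
  case (insert x A)
  then show ?case using pvars_add[of "f x" "sum f A"] by auto
qed (auto simp: pvars_0)

lemma pvars_prod:
  fixes f :: "'x \<Rightarrow> ('v, 'a::comm_ring_1) mpoly"
  shows "(\<And>x. x \<in> A \<Longrightarrow> pvars (f x) \<subseteq> B) \<Longrightarrow> pvars (prod f A) \<subseteq> B"
proof (induction A rule: infinite_finite_induct)
  case (insert x A)
  then show ?case using pvars_mult[of "f x" "prod f A"] by auto
qed (auto simp: pvars_1)

lemma finite_pvars: "finite (pvars f)"
  by (simp add: pvars_def)

text \<open>
  Polynomials in the variables \<open>E\<close> are generated from constants by sums and products with a
  variable.
\<close>

lemma mpoly_induct [consumes 1, case_names const add var]:
  fixes f :: "('v, 'a::comm_ring_1) mpoly"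
  assumes "pvars f \<subseteq> E"
    and const: "\<And>c. P (PConst c)"
    and add: "\<And>f g. P f \<Longrightarrow> P g \<Longrightarrow> P (f + g)"
    and var: "\<And>v f. v \<in> E \<Longrightarrow> P f \<Longrightarrow> P (PVar v * f)"
  shows "P f"
proof -
  have single: "P (Poly_Mapping.single m c)"
    if "Poly_Mapping.keys m \<subseteq> E" "sum (Poly_Mapping.lookup m) (Poly_Mapping.keys m) = n" for m c n
    using that
  proof (induction n arbitrary: m)
    case 0
    then have "m = 0" by (metis finite_keys in_keys_iff keys_eq_empty sum_eq_0_iff equals0I)
    then show ?case using const[of c] by (simp add: PConst_def)
  next
    case (Suc n)
    then obtain v where v: "v \<in> Poly_Mapping.keys m" by (metis sum.neutral nat.distinct(1) empty_iff)
    define m' where "m' = m - Poly_Mapping.single v 1"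
    have m: "m = Poly_Mapping.single v 1 + m'"
      unfolding m'_def using v
      by (intro poly_mapping_eqI) (auto simp: lookup_add lookup_minus lookup_single when_def in_keys_iff)
    have sub: "Poly_Mapping.keys m' \<subseteq> Poly_Mapping.keys m"
      by (auto simp: m in_keys_iff lookup_add)
    have "sum (Poly_Mapping.lookup m) (Poly_Mapping.keys m) =
        sum (Poly_Mapping.lookup (Poly_Mapping.single v 1)) (Poly_Mapping.keys m)
        + sum (Poly_Mapping.lookup m') (Poly_Mapping.keys m)"
      by (subst (1) m) (simp add: lookup_add sum.distrib)
    also have "sum (Poly_Mapping.lookup (Poly_Mapping.single v 1)) (Poly_Mapping.keys m) = (1::nat)"
      using v by (simp add: lookup_single when_def sum.delta)
    also have "sum (Poly_Mapping.lookup m') (Poly_Mapping.keys m) =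
        sum (Poly_Mapping.lookup m') (Poly_Mapping.keys m')"
      using sub by (intro sum.mono_neutral_right) (auto simp: in_keys_iff)
    finally have "sum (Poly_Mapping.lookup m') (Poly_Mapping.keys m') = n"
      using Suc.prems by simp
    then have "P (Poly_Mapping.single m' c)" using Suc sub by blast
    then have "P (PVar v * Poly_Mapping.single m' c)" using var v Suc.prems by blast
    then show ?case by (simp add: PVar_def mult_single m)
  qed
  have "P (\<Sum>m\<in>K. Poly_Mapping.single m (Poly_Mapping.lookup f m))"
    if "finite K" "K \<subseteq> Poly_Mapping.keys f" for K
    using that
  proof (induction K rule: finite_induct)
    case empty
    have "PConst 0 = (0 :: ('v, 'a) mpoly)" by (rule rhom.hom_zero[OF rhom_PConst])
    then show ?case using const[of 0] by simp
  next
    case (insert m K)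
    have "Poly_Mapping.keys m \<subseteq> E" using insert.prems assms(1) by (auto simp: pvars_def)
    then show ?case using insert by (auto intro!: add single)
  qed
  then have "P (\<Sum>m\<in>Poly_Mapping.keys f. Poly_Mapping.single m (Poly_Mapping.lookup f m))"
    by simp
  then show ?thesis by (simp only: poly_mapping_eq_sum_single[of f, symmetric])
qed

lemma rhom_eqI:
  assumes "rhom h1" "rhom h2" "pvars f \<subseteq> E"
    "\<And>c. h1 (PConst c) = h2 (PConst c)" "\<And>v. v \<in> E \<Longrightarrow> h1 (PVar v) = h2 (PVar v)"
  shows "h1 f = h2 f"
  using assms(3)
  by (induction rule: mpoly_induct)
    (simp_all add: assms rhom.hom_add[OF assms(1)] rhom.hom_add[OF assms(2)]
      rhom.hom_mult[OF assms(1)] rhom.hom_mult[OF assms(2)])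

subsection \<open>Evaluation\<close>

lemma monomial_eval_superset:
  fixes g :: "'v \<Rightarrow> 'b::comm_ring_1"
  assumes "finite B" "Poly_Mapping.keys m \<subseteq> B"
  shows "(\<Prod>v\<in>Poly_Mapping.keys m. g v ^ Poly_Mapping.lookup m v) = (\<Prod>v\<in>B. g v ^ Poly_Mapping.lookup m v)"
  using assms by (intro prod.mono_neutral_left) (auto simp: in_keys_iff)

lemma peval_superset:
  assumes "rhom h" "finite K" "Poly_Mapping.keys f \<subseteq> K"
  shows "peval h g f = (\<Sum>m\<in>K. h (Poly_Mapping.lookup f m) *
      (\<Prod>v\<in>Poly_Mapping.keys m. g v ^ Poly_Mapping.lookup m v))"
  unfolding peval_def using assms
  by (intro sum.mono_neutral_left) (auto simp: in_keys_iff rhom.hom_zero)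

lemma peval_single:
  assumes "rhom h"
  shows "peval h g (Poly_Mapping.single m c) =
    h c * (\<Prod>v\<in>Poly_Mapping.keys m. g v ^ Poly_Mapping.lookup m v)"
  using peval_superset[OF assms, of "{m}" "Poly_Mapping.single m c" g] by simp

lemma rhom_peval:
  assumes "rhom h"
  shows "rhom (peval h g)"
proof -
  interpret rhom h by (rule assms)
  have add: "peval h g (f1 + f2) = peval h g f1 + peval h g f2" for f1 f2
  proof -
    let ?K = "Poly_Mapping.keys f1 \<union> Poly_Mapping.keys f2"
    have "Poly_Mapping.keys (f1 + f2) \<subseteq> ?K" by (rule keys_add)
    then show ?thesis
      by (simp add: peval_superset[OF assms, of ?K] lookup_add hom_add distrib_right sum.distrib)
  qed
  have zero: "peval h g 0 = 0" by (simp add: peval_def)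
  have sum: "peval h g (sum F A) = (\<Sum>x\<in>A. peval h g (F x))" for F :: "'x \<Rightarrow> _" and A
    by (induction A rule: infinite_finite_induct) (auto simp: zero add)
  have single: "peval h g (Poly_Mapping.single m a * Poly_Mapping.single l b) =
      peval h g (Poly_Mapping.single m a) * peval h g (Poly_Mapping.single l b)" for m l a b
  proof -
    let ?B = "Poly_Mapping.keys m \<union> Poly_Mapping.keys l"
    have "Poly_Mapping.keys (m + l) \<subseteq> ?B" by (rule keys_add)
    then have "(\<Prod>v\<in>Poly_Mapping.keys (m + l). g v ^ Poly_Mapping.lookup (m + l) v) =
        (\<Prod>v\<in>Poly_Mapping.keys m. g v ^ Poly_Mapping.lookup m v) *
        (\<Prod>v\<in>Poly_Mapping.keys l. g v ^ Poly_Mapping.lookup l v)"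
      using monomial_eval_superset[of ?B "m + l" g] monomial_eval_superset[of ?B m g]
        monomial_eval_superset[of ?B l g] by (simp add: lookup_add power_add prod.distrib)
    then show ?thesis
      by (simp add: mult_single peval_single[OF assms] hom_mult mult.assoc mult.left_commute)
  qed
  show ?thesis
  proof
    show "peval h g (x + y) = peval h g x + peval h g y" for x y by (rule add)
    show "peval h g 1 = 1"
      using peval_single[OF assms, of g 0 1] by (simp add: hom_one)
    show "peval h g (x * y) = peval h g x * peval h g y" for x y
    proof -
      note x = poly_mapping_eq_sum_single[of x, symmetric]
      note y = poly_mapping_eq_sum_single[of y, symmetric]
      have "peval h g (x * y) = peval h g
          ((\<Sum>m\<in>Poly_Mapping.keys x. Poly_Mapping.single m (Poly_Mapping.lookup x m)) *
          (\<Sum>m\<in>Poly_Mapping.keys y. Poly_Mapping.single m (Poly_Mapping.lookup y m)))"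
        by (simp only: x y)
      also have "\<dots> = peval h g (\<Sum>m\<in>Poly_Mapping.keys x. Poly_Mapping.single m (Poly_Mapping.lookup x m)) *
          peval h g (\<Sum>m\<in>Poly_Mapping.keys y. Poly_Mapping.single m (Poly_Mapping.lookup y m))"
        by (simp add: sum_product sum single)
      finally show ?thesis by (simp only: x y)
    qed
  qed
qed

lemma peval_PConst: "rhom h \<Longrightarrow> peval h g (PConst c) = h c"
  by (simp add: PConst_def peval_single)

lemma peval_PVar: "rhom h \<Longrightarrow> peval h g (PVar v) = g v"
  by (simp add: PVar_def peval_single rhom.hom_one)

lemma peval_PConst_PVar: "peval PConst PVar f = f"
proof (rule rhom_eqI[where E = UNIV and ?h1.0 = "peval PConst PVar" and ?h2.0 = "\<lambda>f. f"])
qed (simp_all add: peval_PConst peval_PVar rhom_PConst rhom_peval rhom_id)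

text \<open>
  The values of a polynomial at two points differ by a combination of the differences of the
  coordinates.
\<close>

lemma peval_diff_ex:
  assumes "rhom h" "finite E" "pvars f \<subseteq> E"
  shows "\<exists>c. peval h x f = peval h x' f + (\<Sum>v\<in>E. c v * (x v - x' v))"
  using assms(3)
proof (induction rule: mpoly_induct)
  case (const c)
  show ?case by (rule exI[of _ "\<lambda>_. 0"]) (simp add: peval_PConst[OF assms(1)])
next
  case (add f g)
  then obtain c d where c: "peval h x f = peval h x' f + (\<Sum>v\<in>E. c v * (x v - x' v))"
    and d: "peval h x g = peval h x' g + (\<Sum>v\<in>E. d v * (x v - x' v))" by blast
  show ?case
    by (rule exI[of _ "\<lambda>v. c v + d v"])
      (simp add: rhom.hom_add[OF rhom_peval[OF assms(1)]] c d distrib_right sum.distrib)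
next
  case (var u f)
  then obtain c where c: "peval h x f = peval h x' f + (\<Sum>v\<in>E. c v * (x v - x' v))" by blast
  define c' where "c' v = x u * c v + (if v = u then peval h x' f else 0)" for v
  have "(\<Sum>v\<in>E. c' v * (x v - x' v)) =
      (\<Sum>v\<in>E. x u * (c v * (x v - x' v)) + (if v = u then peval h x' f * (x u - x' u) else 0))"
    by (rule sum.cong) (auto simp: c'_def algebra_simps)
  also have "\<dots> = x u * (\<Sum>v\<in>E. c v * (x v - x' v)) + peval h x' f * (x u - x' u)"
    using var.hyps assms(2) by (simp add: sum.distrib sum_distrib_left sum.delta)
  finally have "peval h x (PVar u * f) = peval h x' (PVar u * f) + (\<Sum>v\<in>E. c' v * (x v - x' v))"
    by (simp add: rhom.hom_mult[OF rhom_peval[OF assms(1)]] peval_PVar[OF assms(1)] c algebra_simps)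
  then show ?case by blast
qed

section \<open>Ideals of truncated polynomials\<close>

text \<open>
  For an ideal \<open>P\<close>, this is the ideal generated by \<open>P\<close> and the powers \<open>\<epsilon>\<^sub>i ^ w i\<close>: only the
  coefficients at monomials divisible by none of these powers are constrained.
\<close>

definition jet_ideal :: "'r::comm_ring_1 set \<Rightarrow> ('v \<Rightarrow> nat) \<Rightarrow> ('v, 'r) mpoly set" where
  "jet_ideal P w = {g. \<forall>m. (\<forall>i. Poly_Mapping.lookup m i < w i) \<longrightarrow> Poly_Mapping.lookup g m \<in> P}"

lemma jet_ideal_Inter: "jet_ideal (\<Inter>Z) w = (\<Inter>P\<in>Z. jet_ideal P w)"
  by (auto simp: jet_ideal_def)

lemma lookup_PConst_mult: "Poly_Mapping.lookup (PConst c * f) m = c * Poly_Mapping.lookup f m"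
  unfolding PConst_def mult_map_scale_conv_mult[symmetric]
  by (simp add: map.rep_eq when_def)

lemma type_ideal_jet_ideal:
  assumes "type_ideal P"
  shows "type_ideal (jet_ideal P w)"
proof -
  interpret type_ideal P by (rule assms)
  show ?thesis
  proof
    fix f g :: "('b, 'a) mpoly"
    assume f: "f \<in> jet_ideal P w"
    show "g * f \<in> jet_ideal P w"
      unfolding jet_ideal_def
    proof (intro CollectI allI impI)
      fix m :: "'b \<Rightarrow>\<^sub>0 nat" assume m: "\<forall>i. Poly_Mapping.lookup m i < w i"
      have "Poly_Mapping.lookup f q \<in> P" if "m = l + q" for l q
      proof -
        have "Poly_Mapping.lookup q i < w i" for i
          using m[rule_format, of i] that by (simp add: lookup_add)
        then show ?thesis using f by (simp add: jet_ideal_def)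
      qed
      then show "Poly_Mapping.lookup (g * f) m \<in> P"
        unfolding lookup_mult
        by (intro Sum_any_mem mult_mem) (auto simp: when_def zero_mem)
    qed
  qed (auto simp: jet_ideal_def lookup_add zero_mem add_mem)
qed

lemma PConst_in_jet_ideal:
  assumes "type_ideal P" "c \<in> P"
  shows "PConst c \<in> jet_ideal P w"
  using assms by (auto simp: jet_ideal_def PConst_def lookup_single when_def intro: type_ideal.zero_mem)

lemma PVar_power_in_jet_ideal:
  assumes "type_ideal P" "w v \<le> n"
  shows "PVar v ^ n \<in> jet_ideal P w"
proof -
  have "\<exists>i. w i \<le> Poly_Mapping.lookup (Poly_Mapping.single v n) i"
    using assms(2) by (intro exI[of _ v]) simp
  then show ?thesis
    using type_ideal.zero_mem[OF assms(1)]
    by (auto simp: jet_ideal_def PVar_power lookup_single[of "Poly_Mapping.single v n"] when_def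
        simp flip: not_le)
qed

text \<open>
  The generators of \<^const>\<open>QQ\<close> are constants and powers of single variables, so membership can be
  tested on the coefficients.
\<close>

lemma QQ_eq_jet_ideal:
  fixes Z :: "('i, 'a::comm_ring_1) conf_ring set set"
  assumes "\<And>P. P \<in> Z \<Longrightarrow> type_ideal P"
  shows "QQ e U Z = jet_ideal (\<Inter>Z) (\<lambda>i. e (part_index U i))"
proof -
  let ?R = "ring_of_type_algebra :: (nat, ('i, 'a) conf_ring) mpoly ring"
  let ?S = "PConst ` radical_ideal Z \<union> range (\<lambda>i. PVar i ^ e (part_index U i))
    :: (nat, ('i, 'a) conf_ring) mpoly set"
  let ?w = "\<lambda>i. e (part_index U i)"
  interpret R: cring ?R by (rule cring_from_type_algebra)
  interpret I: type_ideal "\<Inter>Z" by (rule type_ideal_Inter) (rule assms)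
  interpret J: type_ideal "jet_ideal (\<Inter>Z) ?w :: (nat, ('i, 'a) conf_ring) mpoly set"
    by (rule type_ideal_jet_ideal) (rule I.type_ideal_axioms)
  have carr: "?S \<subseteq> carrier ?R" by (simp add: ring_of_type_algebra_def)
  interpret G: type_ideal "QQ e U Z"
    unfolding QQ_def by (rule type_ideal_of_ideal) (rule R.genideal_ideal[OF carr])
  have gen: "?S \<subseteq> QQ e U Z"
    unfolding QQ_def by (rule R.genideal_self[OF carr])
  show ?thesis
  proof
    show "QQ e U Z \<subseteq> jet_ideal (\<Inter>Z) ?w"
      unfolding QQ_def
    proof (rule R.genideal_minimal)
      show "ideal (jet_ideal (\<Inter>Z) ?w) ?R"
        by (rule ideal_of_type_ideal) (rule J.type_ideal_axioms)
      show "?S \<subseteq> jet_ideal (\<Inter>Z) ?w"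
        using PConst_in_jet_ideal[OF I.type_ideal_axioms]
          PVar_power_in_jet_ideal[OF I.type_ideal_axioms, of ?w]
        by (auto simp: radical_ideal_def)
    qed
    show "jet_ideal (\<Inter>Z) ?w \<subseteq> QQ e U Z"
    proof
      fix g assume g: "g \<in> jet_ideal (\<Inter>Z) ?w"
      have "Poly_Mapping.single m (Poly_Mapping.lookup g m) \<in> QQ e U Z" for m
      proof (cases "\<forall>i. Poly_Mapping.lookup m i < ?w i")
        case True
        then have "PConst (Poly_Mapping.lookup g m) \<in> QQ e U Z"
          using g gen by (auto simp: jet_ideal_def radical_ideal_def)
        then have "PConst (Poly_Mapping.lookup g m) * Poly_Mapping.single m 1 \<in> QQ e U Z"
          by (rule G.mult_mem_left)
        then show ?thesis by (simp add: PConst_def mult_single)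
      next
        case False
        then obtain i where i: "?w i \<le> Poly_Mapping.lookup m i" by (auto simp: not_less)
        let ?v = "Poly_Mapping.single i (?w i)"
        have "m = ?v + (m - ?v)"
          using i by (intro poly_mapping_eqI) (auto simp: lookup_add lookup_minus lookup_single when_def)
        then have "Poly_Mapping.single m (Poly_Mapping.lookup g m) =
            PVar i ^ ?w i * Poly_Mapping.single (m - ?v) (Poly_Mapping.lookup g m)"
          by (simp add: PVar_power mult_single)
        moreover have "PVar i ^ ?w i \<in> QQ e U Z" using gen by blast
        ultimately show ?thesis using G.mult_mem_left by metis
      qed
      then have "(\<Sum>m\<in>Poly_Mapping.keys g. Poly_Mapping.single m (Poly_Mapping.lookup g m)) \<in> QQ e U Z"
        by (intro G.sum_mem)
      then show "g \<in> QQ e U Z" by (simp only: poly_mapping_eq_sum_single[of g, symmetric])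
    qed
  qed
qed

text \<open>The elements that are not zero divisors modulo the ideal \<open>N\<close>.\<close>

definition regular_mod :: "'r::comm_ring_1 set \<Rightarrow> 'r \<Rightarrow> bool" where
  "regular_mod N u \<longleftrightarrow> (\<forall>x. u * x \<in> N \<longrightarrow> x \<in> N)"

lemma regular_modD: "regular_mod N u \<Longrightarrow> u * x \<in> N \<Longrightarrow> x \<in> N"
  by (simp add: regular_mod_def)

lemma regular_mod_1: "regular_mod N 1"
  by (simp add: regular_mod_def)

lemma regular_mod_mult:
  assumes "regular_mod N u" "regular_mod N v"
  shows "regular_mod N (u * v)"
  unfolding regular_mod_def
proof (intro allI impI)
  fix x assume "u * v * x \<in> N"
  then have "u * (v * x) \<in> N" by (simp only: mult.assoc)
  with assms show "x \<in> N" by (blast dest: regular_modD)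
qed

lemma regular_mod_power: "regular_mod N u \<Longrightarrow> regular_mod N (u ^ n)"
  by (induction n) (simp_all add: regular_mod_1 regular_mod_mult)

lemma regular_mod_prod: "(\<And>x. x \<in> S \<Longrightarrow> regular_mod N (u x)) \<Longrightarrow> regular_mod N (prod u S)"
  by (induction S rule: infinite_finite_induct) (simp_all add: regular_mod_1 regular_mod_mult)

text \<open>Modulo \<^const>\<open>jet_ideal\<close>, a constant outside the prime \<open>P\<close> plus a nilpotent is regular.\<close>

lemma regular_mod_jet_ideal:
  assumes "type_prime P" "c \<notin> P" "n ^ k \<in> jet_ideal P w"
  shows "regular_mod (jet_ideal P w) (PConst c + n)"
  unfolding regular_mod_def
proof (intro allI impI)
  fix x assume x: "(PConst c + n) * x \<in> jet_ideal P w"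
  interpret type_prime P by (rule assms)
  interpret J: type_ideal "jet_ideal P w" by (rule type_ideal_jet_ideal) (rule type_ideal_axioms)
  \<comment> \<open>\<open>c + n\<close> divides \<open>c ^ k - (- n) ^ k\<close>, which is \<open>c ^ k\<close> modulo the ideal.\<close>
  have "PConst c ^ k - (- n) ^ k =
      (PConst c + n) * (\<Sum>i<k. (- n) ^ (k - Suc i) * PConst c ^ i)"
    using power_diff_sumr2[of "PConst c" k "- n"] by simp
  then have "PConst c ^ k * x =
      (\<Sum>i<k. (- n) ^ (k - Suc i) * PConst c ^ i) * ((PConst c + n) * x) + (- n) ^ k * x"
    by (simp add: algebra_simps)
  also have "(- n) ^ k * x = n ^ k * ((- 1) ^ k * x)"
    unfolding power_minus[of n] by (simp add: mult.assoc mult.left_commute)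
  also have "(\<Sum>i<k. (- n) ^ (k - Suc i) * PConst c ^ i) * ((PConst c + n) * x) +
      n ^ k * ((- 1) ^ k * x) \<in> jet_ideal P w"
    by (rule J.add_mem[OF J.mult_mem[OF x] J.mult_mem_left[OF assms(3)]])
  finally have "PConst c ^ k * x \<in> jet_ideal P w" .
  then have "PConst (c ^ k) * x \<in> jet_ideal P w"
    by (simp only: rhom.hom_power[OF rhom_PConst])
  moreover have "c ^ k \<notin> P" using assms(2) power_memD by blast
  ultimately show "x \<in> jet_ideal P w"
    using prime by (fastforce simp: jet_ideal_def lookup_PConst_mult)
qed

section \<open>Divided differences of monomials\<close>

text \<open>
  For a nonempty list of nodes, \<open>divdiff xs (Suc a)\<close> is the divided difference of the polynomial \<open>X ^ a\<close>
  at the nodes \<open>xs\<close>, in other words the complete homogeneous symmetric polynomial of degree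
  \<open>Suc a - length xs\<close> in the nodes, or zero if \<open>Suc a < length xs\<close>.  The
  shift of the exponent makes the recursion uniform.
\<close>

fun divdiff :: "'r::comm_ring_1 list \<Rightarrow> nat \<Rightarrow> 'r" where
  "divdiff [] a = (if a = 0 then 1 else 0)"
| "divdiff (x # xs) 0 = 0"
| "divdiff (x # xs) (Suc a) = x * divdiff (x # xs) a + divdiff xs a"

lemma (in rhom) hom_divdiff: "h (divdiff xs a) = divdiff (map h xs) a"
  by (induction xs a rule: divdiff.induct) (simp_all add: hom_zero hom_one hom_add hom_mult)

lemma pvars_divdiff:
  fixes xs :: "('v, 'a::comm_ring_1) mpoly list"
  shows "(\<And>x. x \<in> set xs \<Longrightarrow> pvars x \<subseteq> E) \<Longrightarrow> pvars (divdiff xs a) \<subseteq> E"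
proof (induction xs a rule: divdiff.induct)
  case (3 x xs a)
  then have "pvars x \<subseteq> E" "pvars (divdiff (x # xs) a) \<subseteq> E" "pvars (divdiff xs a) \<subseteq> E" by simp_all
  then show ?case
    using pvars_add[of "x * divdiff (x # xs) a" "divdiff xs a"] pvars_mult[of x "divdiff (x # xs) a"] by simp blast
qed (simp_all add: pvars_0 pvars_1)

text \<open>
  The recursion that characterizes divided differences.
\<close>

lemma divdiff_diff: "(x - y) * divdiff (x # y # zs) a = divdiff (x # zs) a - divdiff (y # zs) a"
proof (induction a)
  case (Suc a)
  have "(x - y) * divdiff (x # y # zs) (Suc a) =
      x * ((x - y) * divdiff (x # y # zs) a) + (x - y) * divdiff (y # zs) a"
    by (simp add: algebra_simps)
  then show ?case unfolding Suc by (simp add: algebra_simps)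
qed simp

lemma divdiff_swap: "divdiff (x # y # zs) a = divdiff (y # x # zs) a"
proof (induction a)
  case (Suc a)
  have "divdiff (x # y # zs) (Suc a) - divdiff (y # x # zs) (Suc a) =
      (x - y) * divdiff (x # y # zs) a + divdiff (y # zs) a - divdiff (x # zs) a"
    using Suc by (simp add: algebra_simps)
  then show ?case unfolding divdiff_diff by simp
qed simp

lemma divdiff_Cons_cong: "(\<And>a. divdiff xs a = divdiff ys a) \<Longrightarrow> divdiff (x # xs) a = divdiff (x # ys) a"
  by (induction a) simp_all

lemma divdiff_move: "divdiff (xs @ y # ys) a = divdiff (y # xs @ ys) a"
proof (induction xs arbitrary: a)
  case (Cons x xs)
  have "divdiff (x # xs @ y # ys) a = divdiff (x # y # xs @ ys) a"
    by (rule divdiff_Cons_cong) (rule Cons.IH)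
  then show ?case by (simp add: divdiff_swap[of x])
qed simp

lemma divdiff_cong_mset: "mset xs = mset ys \<Longrightarrow> divdiff xs a = divdiff ys a"
proof (induction xs arbitrary: ys a)
  case (Cons x xs)
  then have "x \<in> set ys" by (metis list.set_intros(1) set_mset_mset)
  then obtain us vs where ys: "ys = us @ x # vs" by (meson split_list)
  then have "mset xs = mset (us @ vs)" using Cons.prems by simp
  then have "divdiff xs b = divdiff (us @ vs) b" for b by (rule Cons.IH)
  then show ?case by (simp add: ys divdiff_move divdiff_Cons_cong[of xs "us @ vs"])
qed simp

text \<open>
  If the differences of the nodes \<open>t \<alpha>\<close> are invertible, then the divided difference at nodes with
  multiplicities at most \<open>e\<close> is a linear combination of the divided differences at \<open>Suc j\<close> copies
  of one node \<open>t \<alpha>\<close>, \<open>j < e \<alpha>\<close>.  The coefficients \<open>c\<close> do not depend on the exponent \<open>a\<close> of the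
  monomial.
\<close>

lemma divdiff_partial_fractions:
  fixes t :: "'i \<Rightarrow> 'r::comm_ring_1"
  assumes "finite E" "\<And>\<alpha> \<beta>. \<alpha> \<in> E \<Longrightarrow> \<beta> \<in> E \<Longrightarrow> \<alpha> \<noteq> \<beta> \<Longrightarrow> \<exists>u. u * (t \<alpha> - t \<beta>) = 1"
    and "as \<noteq> []" "set as \<subseteq> E" "\<And>\<alpha>. count (mset as) \<alpha> \<le> e \<alpha>"
  shows "\<exists>c. \<forall>a. divdiff (map t as) a =
    (\<Sum>(\<alpha>, j)\<in>Sigma E (\<lambda>\<alpha>. {..<e \<alpha>}). c (\<alpha>, j) * divdiff (replicate (Suc j) (t \<alpha>)) a)"
  using assms(3-)
proof (induction as rule: length_induct)
  case (1 as)
  let ?D = "Sigma E (\<lambda>\<alpha>. {..<e \<alpha>})"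
  have fin: "finite ?D" using assms(1) by simp
  obtain \<alpha> bs where as: "as = \<alpha> # bs" using "1.prems"(1) by (cases as) auto
  show ?case
  proof (cases "\<exists>\<beta>\<in>set bs. \<beta> \<noteq> \<alpha>")
    case False
    then have bs: "bs = replicate (length bs) \<alpha>" by (metis replicate_length_same)
    then have "as = replicate (Suc (length bs)) \<alpha>" using as by simp
    then have "map t as = replicate (Suc (length bs)) (t \<alpha>)" by (metis map_replicate)
    moreover have "count (mset as) \<alpha> = Suc (length bs)"
      by (metis \<open>as = replicate (Suc (length bs)) \<alpha>\<close> count_replicate_mset mset_replicate)
    then have "(\<alpha>, length bs) \<in> ?D"
      using "1.prems"(2) "1.prems"(3)[of \<alpha>] as by auto
    then have "(\<Sum>(\<alpha>', j)\<in>?D. (if (\<alpha>', j) = (\<alpha>, length bs) then 1 else 0) *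
        divdiff (replicate (Suc j) (t \<alpha>')) a) = divdiff (replicate (Suc (length bs)) (t \<alpha>)) a" for a
      using fin by (subst sum.remove[of _ "(\<alpha>, length bs)"])
        (auto intro!: sum.neutral split: if_splits simp del: replicate_Suc)
    ultimately show ?thesis by (intro exI[of _ "\<lambda>p. if p = (\<alpha>, length bs) then 1 else 0"]) simp
  next
    case True
    then obtain \<beta> where "\<beta> \<in> set bs" and \<beta>1: "\<beta> \<noteq> \<alpha>" by blast
    then obtain us vs where \<beta>2: "bs = us @ \<beta> # vs" by (meson split_list)
    note \<beta> = \<beta>1 \<beta>2
    let ?zs = "us @ vs"
    have ms: "mset as = mset (\<alpha> # \<beta> # ?zs)" by (simp add: as \<beta>)
    have sub: "\<alpha> \<in> E" "\<beta> \<in> E" "set ?zs \<subseteq> E" using "1.prems"(2) by (auto simp: as \<beta>)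
    have cnt: "count (mset (\<alpha> # ?zs)) \<gamma> \<le> e \<gamma>" "count (mset (\<beta> # ?zs)) \<gamma> \<le> e \<gamma>" for \<gamma>
      using "1.prems"(3)[of \<gamma>] unfolding ms by (auto split: if_splits)
    obtain c1 where c1: "\<And>a. divdiff (map t (\<alpha> # ?zs)) a =
        (\<Sum>(\<alpha>, j)\<in>?D. c1 (\<alpha>, j) * divdiff (replicate (Suc j) (t \<alpha>)) a)"
      using "1.IH"[rule_format, of "\<alpha> # ?zs"] sub cnt by (force simp: as \<beta>)
    obtain c2 where c2: "\<And>a. divdiff (map t (\<beta> # ?zs)) a =
        (\<Sum>(\<alpha>, j)\<in>?D. c2 (\<alpha>, j) * divdiff (replicate (Suc j) (t \<alpha>)) a)"
      using "1.IH"[rule_format, of "\<beta> # ?zs"] sub cnt by (force simp: as \<beta>)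
    \<comment> \<open>Two distinct nodes are separated by \<open>divdiff_diff\<close>, which shortens the list.\<close>
    obtain u where u: "u * (t \<alpha> - t \<beta>) = 1" using assms(2)[of \<alpha> \<beta>] sub \<beta>(1) by metis
    have "divdiff (map t as) a = (\<Sum>(\<alpha>, j)\<in>?D. (u * (c1 (\<alpha>, j) - c2 (\<alpha>, j))) *
        divdiff (replicate (Suc j) (t \<alpha>)) a)" for a
    proof -
      have "divdiff (map t as) a = divdiff (map t (\<alpha> # \<beta> # ?zs)) a"
        using ms by (intro divdiff_cong_mset) (simp only: mset_map)
      also have "\<dots> = u * ((t \<alpha> - t \<beta>) * divdiff (t \<alpha> # t \<beta> # map t ?zs) a)"
        using u by (simp flip: mult.assoc)
      also have "\<dots> = u * (divdiff (map t (\<alpha> # ?zs)) a - divdiff (map t (\<beta> # ?zs)) a)"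
        unfolding divdiff_diff by simp
      also have "\<dots> = (\<Sum>(\<alpha>, j)\<in>?D. (u * (c1 (\<alpha>, j) - c2 (\<alpha>, j))) *
        divdiff (replicate (Suc j) (t \<alpha>)) a)"
        unfolding c1 c2 sum_subtractf[symmetric] sum_distrib_left
        by (intro sum.cong) (auto simp: algebra_simps)
      finally show ?thesis .
    qed
    then show ?thesis by (intro exI[of _ "\<lambda>p. u * (c1 p - c2 p)"]) simp
  qed
qed

text \<open>
  The functional that applies, in each variable \<open>\<xi>\<^sub>i\<close> with \<open>i \<in> B\<close>, the divided difference at the
  nodes \<open>L i\<close>.
\<close>

definition divdiff_eval :: "('a::comm_ring_1 \<Rightarrow> 'r) \<Rightarrow> 'v set \<Rightarrow> ('v \<Rightarrow> 'r list) \<Rightarrow>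
    ('v, 'a) mpoly \<Rightarrow> 'r::comm_ring_1" where
  "divdiff_eval h B L f = (\<Sum>m\<in>Poly_Mapping.keys f. h (Poly_Mapping.lookup f m) *
      (\<Prod>i\<in>B. divdiff (L i) (Suc (Poly_Mapping.lookup m i))))"

lemma divdiff_eval_cong: "(\<And>i. i \<in> B \<Longrightarrow> L i = L' i) \<Longrightarrow> divdiff_eval h B L f = divdiff_eval h B L' f"
  unfolding divdiff_eval_def
  by (intro sum.cong prod.cong refl arg_cong2[of _ _ _ _ "(*)"]) simp

lemma rhom_divdiff_eval:
  "rhom g \<Longrightarrow> g (divdiff_eval h B L f) = divdiff_eval (\<lambda>c. g (h c)) B (\<lambda>i. map g (L i)) f"
  by (simp add: divdiff_eval_def rhom.hom_sum rhom.hom_prod rhom.hom_mult rhom.hom_divdiff)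

lemma pvars_divdiff_eval:
  fixes L :: "'v \<Rightarrow> ('w, 'a::comm_ring_1) mpoly list"
  assumes "\<And>i x. i \<in> B \<Longrightarrow> x \<in> set (L i) \<Longrightarrow> pvars x \<subseteq> E"
  shows "pvars (divdiff_eval PConst B L f) \<subseteq> E"
  unfolding divdiff_eval_def
proof (rule pvars_sum)
  fix m
  have "pvars (\<Prod>i\<in>B. divdiff (L i) (Suc (Poly_Mapping.lookup m i))) \<subseteq> E"
    using assms by (intro pvars_prod pvars_divdiff)
  then show "pvars (PConst (Poly_Mapping.lookup f m) *
      (\<Prod>i\<in>B. divdiff (L i) (Suc (Poly_Mapping.lookup m i)))) \<subseteq> E"
    using pvars_mult[of "PConst (Poly_Mapping.lookup f m)"] by (fastforce simp: pvars_PConst)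
qed

text \<open>
  Multilinearity extends the decomposition into partial fractions to several variables: divided
  differences of \<open>f\<close> at mixed nodes lie in \<open>P\<close> if those at repeated single nodes do.
\<close>

lemma divdiff_eval_partial_fractions:
  fixes t :: "'i \<Rightarrow> 'r::comm_ring_1"
  assumes "type_ideal P" "finite B" "\<And>i. i \<in> B \<Longrightarrow> finite (E i)"
    and "\<And>\<alpha> \<beta>. \<alpha> \<noteq> \<beta> \<Longrightarrow> \<exists>u. u * (t \<alpha> - t \<beta>) = 1"
    and "\<And>i. i \<in> B \<Longrightarrow> as i \<noteq> []" "\<And>i. i \<in> B \<Longrightarrow> set (as i) \<subseteq> E i"
    and "\<And>i \<alpha>. i \<in> B \<Longrightarrow> count (mset (as i)) \<alpha> \<le> e \<alpha>"
    and mem: "\<And>p k. (\<And>i. i \<in> B \<Longrightarrow> p i \<in> E i) \<Longrightarrow> (\<And>i. i \<in> B \<Longrightarrow> k i < e (p i)) \<Longrightarrow>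
      divdiff_eval h B (\<lambda>i. replicate (Suc (k i)) (t (p i))) f \<in> P"
  shows "divdiff_eval h B (\<lambda>i. map t (as i)) f \<in> P"
proof -
  interpret type_ideal P by (rule assms)
  let ?D = "\<lambda>i. Sigma (E i) (\<lambda>\<alpha>. {..<e \<alpha>})"
  have "\<forall>i\<in>B. \<exists>c. \<forall>a. divdiff (map t (as i)) a =
    (\<Sum>p\<in>?D i. c p * divdiff (replicate (Suc (snd p)) (t (fst p))) a)"
  proof
    fix i assume "i \<in> B"
    then show "\<exists>c. \<forall>a. divdiff (map t (as i)) a =
        (\<Sum>p\<in>?D i. c p * divdiff (replicate (Suc (snd p)) (t (fst p))) a)"
      using divdiff_partial_fractions[of "E i" t "as i" e] assms(3-7)
      by (simp add: case_prod_beta)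
  qed
  then obtain c where c: "\<forall>i\<in>B. \<forall>a. divdiff (map t (as i)) a =
    (\<Sum>p\<in>?D i. c i p * divdiff (replicate (Suc (snd p)) (t (fst p))) a)"
    unfolding bchoice_iff by blast
  have "divdiff_eval h B (\<lambda>i. map t (as i)) f =
      (\<Sum>m\<in>Poly_Mapping.keys f. h (Poly_Mapping.lookup f m) *
      (\<Sum>q\<in>PiE B ?D. \<Prod>i\<in>B. c i (q i) *
        divdiff (replicate (Suc (snd (q i))) (t (fst (q i)))) (Suc (Poly_Mapping.lookup m i))))"
    unfolding divdiff_eval_def using assms(2,3) by (simp add: c prod_sum_PiE)
  also have "\<dots> = (\<Sum>q\<in>PiE B ?D. (\<Prod>i\<in>B. c i (q i)) *
      divdiff_eval h B (\<lambda>i. replicate (Suc (snd (q i))) (t (fst (q i)))) f)"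
    unfolding divdiff_eval_def sum_distrib_left
    by (subst sum.swap) (simp add: prod.distrib mult_ac)
  also have "\<dots> \<in> P"
  proof (intro sum_mem mult_mem mem)
    fix q i assume "q \<in> PiE B ?D" "i \<in> B"
    then have "q i \<in> ?D i" by (rule PiE_mem)
    then show "fst (q i) \<in> E i" "snd (q i) < e (fst (q i))" by auto
  qed
  finally show ?thesis .
qed

section \<open>Taylor coefficients\<close>

text \<open>
  The coefficient of \<open>\<epsilon> ^ k\<close> in \<open>(x + \<epsilon>) ^ a\<close> is the divided difference of \<open>X ^ a\<close> at
  \<open>Suc k\<close> copies of \<open>x\<close>.
\<close>

lemma lookup_linear_power_mult:
  fixes q :: "('v, 'r::comm_ring_1) mpoly"
  assumes "v \<notin> pvars q" "Poly_Mapping.lookup m v = 0"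
  shows "Poly_Mapping.lookup ((PConst x + PVar v) ^ a * q) (Poly_Mapping.single v k + m) =
    divdiff (replicate (Suc k) x) (Suc a) * Poly_Mapping.lookup q m"
proof (induction a arbitrary: k)
  case 0
  show ?case
  proof (cases k)
    case (Suc j)
    then have "v \<in> Poly_Mapping.keys (Poly_Mapping.single v k + m)"
      by (simp add: in_keys_iff lookup_add)
    then have "Poly_Mapping.single v k + m \<notin> Poly_Mapping.keys q"
      using assms(1) by (auto simp: pvars_def)
    then show ?thesis using Suc by (simp add: in_keys_iff)
  qed simp
next
  case (Suc a)
  let ?S = "(PConst x + PVar v) ^ a * q"
  have S: "(PConst x + PVar v) ^ Suc a * q = PConst x * ?S + PVar v * ?S"
    by (simp add: algebra_simps)
  show ?case
  proof (cases k)
    case 0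
    have "Poly_Mapping.lookup (PVar v * ?S) (Poly_Mapping.single v k + m) = 0"
      using 0 assms(2) by (intro lookup_PVar_mult_eq_0) (simp add: lookup_add)
    then show ?thesis
      using 0 Suc[of 0] by (simp only: S lookup_add lookup_PConst_mult) (simp add: mult.assoc)
  next
    case (Suc j)
    have k: "Poly_Mapping.single v k + m = Poly_Mapping.single v 1 + (Poly_Mapping.single v j + m)"
      by (simp add: Suc add.assoc[symmetric] single_add[symmetric])
    have "Poly_Mapping.lookup (PVar v * ?S) (Poly_Mapping.single v k + m) =
        divdiff (replicate k x) (Suc a) * Poly_Mapping.lookup q m"
      unfolding k lookup_PVar_mult Suc.IH by (simp add: Suc)
    then have "Poly_Mapping.lookup ((PConst x + PVar v) ^ Suc a * q) (Poly_Mapping.single v k + m) =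
        x * (divdiff (replicate (Suc k) x) (Suc a) * Poly_Mapping.lookup q m) +
        divdiff (replicate k x) (Suc a) * Poly_Mapping.lookup q m"
      by (simp only: S lookup_add lookup_PConst_mult Suc.IH)
    also have "\<dots> = divdiff (replicate (Suc k) x) (Suc (Suc a)) * Poly_Mapping.lookup q m"
      by (simp add: algebra_simps)
    finally show ?thesis .
  qed
qed

lemma pvars_linear_power: "pvars ((PConst (x :: 'r::comm_ring_1) + PVar v) ^ n) \<subseteq> {v}"
proof (induction n)
  case (Suc n)
  have "pvars (PConst x + PVar v) \<subseteq> {v}"
    using pvars_add[of "PConst x" "PVar v"] by (simp add: pvars_PConst pvars_PVar)
  then show ?case
    using Suc pvars_mult[of "PConst x + PVar v" "(PConst x + PVar v) ^ n"] by auto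
qed (simp add: pvars_1)

lemma lookup_prod_linear_power:
  fixes x :: "'v \<Rightarrow> 'r::comm_ring_1" and s :: "'v \<Rightarrow> 'w"
  assumes "finite B" "inj_on s B" "Poly_Mapping.keys m \<subseteq> s ` B"
  shows "Poly_Mapping.lookup (\<Prod>i\<in>B. (PConst (x i) + PVar (s i)) ^ a i) m =
    (\<Prod>i\<in>B. divdiff (replicate (Suc (Poly_Mapping.lookup m (s i))) (x i)) (Suc (a i)))"
  using assms
proof (induction B arbitrary: m rule: finite_induct)
  case empty
  then have "m = 0" by simp
  then show ?case by simp
next
  case (insert j B)
  let ?q = "\<Prod>i\<in>B. (PConst (x i) + PVar (s i)) ^ a i"
  define k where "k = Poly_Mapping.lookup m (s j)"
  define m' where "m' = m - Poly_Mapping.single (s j) k"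
  have m: "m = Poly_Mapping.single (s j) k + m'" and m'0: "Poly_Mapping.lookup m' (s j) = 0"
    by (auto intro!: poly_mapping_eqI
        simp: m'_def k_def lookup_add lookup_minus lookup_single when_def)
  have "v \<in> s ` B" if "v \<in> Poly_Mapping.keys m'" for v
  proof -
    have "v \<noteq> s j" using that m'0 by (auto simp: in_keys_iff)
    moreover have "v \<in> Poly_Mapping.keys m" using that by (simp add: m in_keys_iff lookup_add)
    ultimately show ?thesis using insert.prems(2) by auto
  qed
  then have keys: "Poly_Mapping.keys m' \<subseteq> s ` B" by blast
  have notin: "s j \<notin> s ` B" using insert by auto
  have "pvars ((PConst (x i) + PVar (s i)) ^ n) \<subseteq> s ` B" if "i \<in> B" for i n
    using that pvars_linear_power[of "x i" "s i" n] by blast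
  then have "pvars ?q \<subseteq> s ` B" by (intro pvars_prod)
  then have notq: "s j \<notin> pvars ?q" using notin by blast
  have eq: "Poly_Mapping.lookup m (s i) = Poly_Mapping.lookup m' (s i)" if "i \<in> B" for i
    using that notin by (subst m) (auto simp: lookup_add lookup_single when_def)
  have "Poly_Mapping.lookup (\<Prod>i\<in>insert j B. (PConst (x i) + PVar (s i)) ^ a i) m =
      Poly_Mapping.lookup ((PConst (x j) + PVar (s j)) ^ a j * ?q) (Poly_Mapping.single (s j) k + m')"
    using insert.hyps by (subst m) simp
  also have "\<dots> = divdiff (replicate (Suc k) (x j)) (Suc (a j)) * Poly_Mapping.lookup ?q m'"
    by (rule lookup_linear_power_mult[OF notq m'0])
  also have "Poly_Mapping.lookup ?q m' =
      (\<Prod>i\<in>B. divdiff (replicate (Suc (Poly_Mapping.lookup m' (s i))) (x i)) (Suc (a i)))"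
    using insert.prems keys by (intro insert.IH) auto
  also have "\<dots> = (\<Prod>i\<in>B. divdiff (replicate (Suc (Poly_Mapping.lookup m (s i))) (x i)) (Suc (a i)))"
    by (rule prod.cong) (simp_all only: eq)
  finally show ?case using insert.hyps by (simp add: k_def)
qed

lemma lookup_peval_taylor:
  fixes h :: "'a::comm_ring_1 \<Rightarrow> 'r::comm_ring_1"
  assumes "finite B" "inj_on s B" "pvars f \<subseteq> B"
  shows "Poly_Mapping.lookup (peval (\<lambda>c. PConst (h c)) (\<lambda>i. PConst (x i) + PVar (s i)) f) m =
    (if Poly_Mapping.keys m \<subseteq> s ` B
     then divdiff_eval h B (\<lambda>i. replicate (Suc (Poly_Mapping.lookup m (s i))) (x i)) f else 0)"
proof -
  have sub: "Poly_Mapping.keys l \<subseteq> B" if "l \<in> Poly_Mapping.keys f" for l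
    using that assms(3) by (auto simp: pvars_def)
  have "peval (\<lambda>c. PConst (h c)) (\<lambda>i. PConst (x i) + PVar (s i)) f =
      (\<Sum>l\<in>Poly_Mapping.keys f. PConst (h (Poly_Mapping.lookup f l)) *
        (\<Prod>i\<in>B. (PConst (x i) + PVar (s i)) ^ Poly_Mapping.lookup l i))" (is "?p = _")
    unfolding peval_def by (intro sum.cong) (simp_all add: monomial_eval_superset[OF assms(1) sub])
  note p = this
  show ?thesis
  proof (cases "Poly_Mapping.keys m \<subseteq> s ` B")
    case True
    then show ?thesis
      unfolding p divdiff_eval_def
      by (simp add: lookup_sum lookup_PConst_mult lookup_prod_linear_power[OF assms(1,2)])
  next
    case False
    have 1: "pvars ((PConst (x i) + PVar (s i)) ^ n) \<subseteq> s ` B" if "i \<in> B" for i n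
      using that pvars_linear_power[of "x i" "s i" n] by blast
    have "pvars ?p \<subseteq> s ` B"
      unfolding p
    proof (rule pvars_sum)
      fix l
      have "pvars (\<Prod>i\<in>B. (PConst (x i) + PVar (s i)) ^ Poly_Mapping.lookup l i) \<subseteq> s ` B"
        by (intro pvars_prod 1)
      then show "pvars (PConst (h (Poly_Mapping.lookup f l)) *
        (\<Prod>i\<in>B. (PConst (x i) + PVar (s i)) ^ Poly_Mapping.lookup l i)) \<subseteq> s ` B"
        using pvars_mult[of "PConst (h (Poly_Mapping.lookup f l))"]
        by (fastforce simp: pvars_PConst)
    qed
    then have "m \<notin> Poly_Mapping.keys ?p" using False by (auto simp: pvars_def)
    then show ?thesis using False by (simp add: in_keys_iff)
  qed
qed

text \<open>
  The expansion of \<open>f(x\<^sub>i + \<epsilon>\<^bsub>s i\<^esub>)\<close> lies in \<^const>\<open>jet_ideal\<close> iff its low order Taylor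
  coefficients lie in \<open>P\<close>.  Positivity of \<open>w\<close> is needed outside \<open>s ` B\<close>, where all
  exponents are \<open>0\<close>.
\<close>

lemma peval_in_jet_ideal_iff:
  fixes h :: "'a::comm_ring_1 \<Rightarrow> 'r::comm_ring_1"
  assumes "type_ideal P" "finite B" "inj_on s B" "pvars f \<subseteq> B" "\<And>j. 0 < w j"
  shows "peval (\<lambda>c. PConst (h c)) (\<lambda>i. PConst (x i) + PVar (s i)) f \<in> jet_ideal P w \<longleftrightarrow>
    (\<forall>k. (\<forall>i\<in>B. k i < w (s i)) \<longrightarrow> divdiff_eval h B (\<lambda>i. replicate (Suc (k i)) (x i)) f \<in> P)"
    (is "?p \<in> _ \<longleftrightarrow> ?R")
proof
  assume p: "?p \<in> jet_ideal P w"
  show ?R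
  proof (intro allI impI)
    fix k assume k: "\<forall>i\<in>B. k i < w (s i)"
    define m where "m = (\<Sum>i\<in>B. Poly_Mapping.single (s i) (k i))"
    have m: "Poly_Mapping.lookup m j = (\<Sum>i\<in>B. if s i = j then k i else 0)" for j
      by (simp add: m_def lookup_sum lookup_single when_def)
    have mB: "Poly_Mapping.lookup m (s i) = k i" if "i \<in> B" for i
    proof -
      have "Poly_Mapping.lookup m (s i) = (\<Sum>i'\<in>B. if i' = i then k i' else 0)"
        unfolding m using assms(3) that by (intro sum.cong) (auto dest: inj_onD)
      then show ?thesis using assms(2) that by (simp add: sum.delta)
    qed
    have m0: "Poly_Mapping.lookup m j = 0" if "j \<notin> s ` B" for j
      unfolding m using that by (intro sum.neutral) auto
    have "Poly_Mapping.lookup m j < w j" for j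
      using mB m0 k assms(5) by (cases "j \<in> s ` B") auto
    then have "Poly_Mapping.lookup ?p m \<in> P" using p by (simp add: jet_ideal_def)
    moreover have "Poly_Mapping.keys m \<subseteq> s ` B" using m0 by (auto simp: in_keys_iff)
    ultimately have "divdiff_eval h B (\<lambda>i. replicate (Suc (Poly_Mapping.lookup m (s i))) (x i)) f \<in> P"
      by (simp only: lookup_peval_taylor[OF assms(2-4)] if_True)
    moreover have "divdiff_eval h B (\<lambda>i. replicate (Suc (Poly_Mapping.lookup m (s i))) (x i)) f =
        divdiff_eval h B (\<lambda>i. replicate (Suc (k i)) (x i)) f"
      unfolding divdiff_eval_def by (simp add: mB)
    ultimately show "divdiff_eval h B (\<lambda>i. replicate (Suc (k i)) (x i)) f \<in> P" by simp
  qed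
next
  assume ?R
  then show "?p \<in> jet_ideal P w"
    unfolding jet_ideal_def
    by (auto simp: lookup_peval_taylor[OF assms(2-4)] simp del: replicate_Suc
        intro: type_ideal.zero_mem[OF assms(1)])
qed

section \<open>Points of the configuration space\<close>

lemma frac_rel_refl: "t \<in> diff_monoid \<Longrightarrow> frac_rel (f, t) (f, t)"
  by (simp add: frac_rel_iff)

lemma rhom_to_conf: "rhom to_conf"
  by unfold_locales
    (simp_all add: to_conf_def plus_conf_ring.abs_eq times_conf_ring.abs_eq one_conf_ring.abs_eq
      frac_rel_refl diff_monoid.one)

lemma to_conf_diff_unit:
  assumes "\<alpha> \<noteq> \<beta>"
  shows "\<exists>u. u * (to_conf (PVar \<alpha>) - to_conf (PVar \<beta>)) = 1"
proof
  let ?s = "PVar \<alpha> - PVar \<beta>"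
  have s: "?s \<in> diff_monoid" using diff_monoid.mult[OF diff_monoid.one assms] by simp
  have "abs_conf_ring (1, ?s) * (to_conf (PVar \<alpha>) - to_conf (PVar \<beta>)) =
      abs_conf_ring (1, ?s) * to_conf ?s"
    by (simp add: rhom.hom_diff[OF rhom_to_conf])
  also have "\<dots> = abs_conf_ring (?s, ?s)"
    by (simp add: to_conf_def times_conf_ring.abs_eq frac_rel_refl diff_monoid.one s)
  also have "\<dots> = 1"
    unfolding one_conf_ring.abs_eq
    by (rule Quotient_rel_abs[OF Quotient_conf_ring]) (simp add: frac_rel_iff s diff_monoid.one)
  finally show "abs_conf_ring (1, ?s) * (to_conf (PVar \<alpha>) - to_conf (PVar \<beta>)) = 1" .
qed

lemma type_prime_conf_space: "P \<in> topspace conf_space \<Longrightarrow> type_prime P"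
  unfolding conf_space_def topspace_zariski by (rule type_prime_of_Spec)

lemma emb_eq: "emb P = {f. to_conf f \<in> P}"
  by (simp add: emb_def spec_map_def poly_ring_def)

lemma type_prime_vimage:
  assumes "rhom h" "type_prime P"
  shows "type_prime {f. h f \<in> P}"
proof -
  interpret rhom h by (rule assms)
  interpret type_prime P by (rule assms)
  show ?thesis
    by unfold_locales
      (auto simp: hom_add hom_mult hom_one hom_zero add_mem mult_mem zero_mem one_notin dest: prime)
qed

lemma cring_poly_ring: "cring (poly_ring E :: ('v, 'a::comm_ring_1) mpoly ring)"
proof -
  let ?R = "ring_of_type_algebra :: ('v, 'a) mpoly ring"
  interpret R: cring ?R by (rule cring_from_type_algebra)
  have "subring {f. pvars f \<subseteq> E} ?R"
  proof (rule R.subringI)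
    show "{f. pvars f \<subseteq> E} \<subseteq> carrier ?R" by (simp add: ring_of_type_algebra_def)
    show "\<one>\<^bsub>?R\<^esub> \<in> {f. pvars f \<subseteq> E}" by (simp add: ring_of_type_algebra_def pvars_1)
    show "\<ominus>\<^bsub>?R\<^esub> f \<in> {f. pvars f \<subseteq> E}" if "f \<in> {f. pvars f \<subseteq> E}" for f
      using that by (simp only: a_inv_type_algebra) (simp add: pvars_uminus)
    show "f \<otimes>\<^bsub>?R\<^esub> g \<in> {f. pvars f \<subseteq> E}"
      if "f \<in> {f. pvars f \<subseteq> E}" "g \<in> {f. pvars f \<subseteq> E}" for f g
      using that pvars_mult[of f g] by (auto simp: ring_of_type_algebra_def)
    show "f \<oplus>\<^bsub>?R\<^esub> g \<in> {f. pvars f \<subseteq> E}"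
      if "f \<in> {f. pvars f \<subseteq> E}" "g \<in> {f. pvars f \<subseteq> E}" for f g
      using that pvars_add[of f g] by (auto simp: ring_of_type_algebra_def)
  qed
  then have "subcring {f. pvars f \<subseteq> E} ?R" by (rule R.subcringI')
  then show ?thesis
    using R.subcring_iff[of "{f. pvars f \<subseteq> E}"] by (simp add: poly_ring_def ring_of_type_algebra_def)
qed

text \<open>
  Contractions of prime ideals to \<open>A[t\<^sub>\<alpha>]\<close>, \<open>\<alpha> \<in> E\<close>, are prime.
\<close>

lemma spec_map_poly_ring:
  assumes "rhom h" "type_prime P"
  shows "spec_map (poly_ring E :: ('v, 'a::comm_ring_1) mpoly ring) h P \<in> Spec (poly_ring E)"
proof -
  let ?R = "poly_ring E :: ('v, 'a) mpoly ring"
  let ?I = "spec_map ?R h P"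
  interpret R: cring ?R by (rule cring_poly_ring)
  interpret rhom h by (rule assms)
  interpret P: type_prime P by (rule assms)
  have simps: "carrier ?R = {f. pvars f \<subseteq> E}" "\<And>f g. f \<oplus>\<^bsub>?R\<^esub> g = f + g"
    "\<And>f g. f \<otimes>\<^bsub>?R\<^esub> g = f * g" "\<zero>\<^bsub>?R\<^esub> = 0" "\<one>\<^bsub>?R\<^esub> = 1"
    by (simp_all add: poly_ring_def ring_of_type_algebra_def)
  have I: "f \<in> ?I \<longleftrightarrow> pvars f \<subseteq> E \<and> h f \<in> P" for f
    by (simp add: spec_map_def simps)
  have inv: "\<ominus>\<^bsub>?R\<^esub> f = - f" if "pvars f \<subseteq> E" for f
    using that by (intro R.minus_equality) (simp_all add: simps pvars_uminus)
  have closed_add: "pvars (f + g) \<subseteq> E" if "pvars f \<subseteq> E" "pvars g \<subseteq> E" for f g :: "('v, 'a) mpoly"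
    using that pvars_add[of f g] by blast
  have closed_mult: "pvars (f * g) \<subseteq> E" if "pvars f \<subseteq> E" "pvars g \<subseteq> E" for f g :: "('v, 'a) mpoly"
    using that pvars_mult[of f g] by blast
  have "ideal ?I ?R"
  proof (rule idealI)
    show "ring ?R" by (rule R.ring_axioms)
    show "subgroup ?I (add_monoid ?R)"
    proof (rule R.add.subgroupI)
      show "?I \<subseteq> carrier ?R" by (auto simp: I simps)
      show "?I \<noteq> {}" using I[of 0] P.zero_mem by (auto simp: pvars_0 hom_zero)
      show "\<ominus>\<^bsub>?R\<^esub> f \<in> ?I" if "f \<in> ?I" for f
        using that by (simp add: I inv pvars_uminus hom_uminus P.uminus_mem)
      show "f \<oplus>\<^bsub>?R\<^esub> g \<in> ?I" if "f \<in> ?I" "g \<in> ?I" for f g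
        using that closed_add by (simp add: I simps hom_add P.add_mem)
    qed
    show "x \<otimes>\<^bsub>?R\<^esub> a \<in> ?I" if "a \<in> ?I" "x \<in> carrier ?R" for a x
      using that closed_mult by (simp add: I simps hom_mult P.mult_mem)
    show "a \<otimes>\<^bsub>?R\<^esub> x \<in> ?I" if "a \<in> ?I" "x \<in> carrier ?R" for a x
      using that closed_mult by (simp add: I simps hom_mult P.mult_mem_left)
  qed
  then have "primeideal ?I ?R"
  proof (rule primeidealI)
    show "cring ?R" by (rule R.cring_axioms)
    have "1 \<in> carrier ?R" "1 \<notin> ?I"
      using P.one_notin by (simp_all add: I simps pvars_1 hom_one)
    then show "carrier ?R \<noteq> ?I" by blast
    show "a \<in> ?I \<or> b \<in> ?I" if "a \<in> carrier ?R" "b \<in> carrier ?R" "a \<otimes>\<^bsub>?R\<^esub> b \<in> ?I" for a b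
      using that P.prime[of "h a" "h b"] by (auto simp: I simps hom_mult)
  qed
  then show ?thesis by (simp add: Spec_def)
qed

text \<open>
  The closure in the definition of \<^const>\<open>Theta_pair\<close> is expressed by polynomials vanishing on \<open>Z\<close>.
\<close>

lemma Theta_pair_iff:
  fixes Z :: "('i, 'a::comm_ring_1) conf_ring set set"
  assumes "Z \<subseteq> topspace conf_space" "Q \<in> topspace conf_space"
  shows "Q \<in> Theta_pair E \<phi> Z \<longleftrightarrow> (\<forall>g. pvars g \<subseteq> E \<longrightarrow> (\<forall>P\<in>Z. to_conf g \<in> P) \<longrightarrow>
    to_conf (peval PConst (\<lambda>\<alpha>. PVar (\<phi> \<alpha>)) g) \<in> Q)"
proof -
  let ?R = "poly_ring E :: ('i, 'a) mpoly ring"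
  let ?d = "diag_map E \<phi> (emb Q)"
  have carr: "carrier ?R = {f. pvars f \<subseteq> E}" by (simp add: poly_ring_def)
  have prime_emb: "type_prime (emb P)" if "P \<in> topspace conf_space"
    for P :: "('j, 'a) conf_ring set"
    unfolding emb_eq using that by (intro type_prime_vimage rhom_to_conf type_prime_conf_space)
  have d: "?d \<in> Spec ?R"
    unfolding diag_map_def
    by (intro spec_map_poly_ring rhom_peval rhom_PConst prime_emb assms)
  have proj: "proj_map E (emb P) \<in> Spec ?R" if "P \<in> Z" for P
    unfolding proj_map_def using that assms(1) by (intro spec_map_poly_ring rhom_id prime_emb) blast
  have memd: "g \<in> ?d \<longleftrightarrow> pvars g \<subseteq> E \<and> to_conf (peval PConst (\<lambda>\<alpha>. PVar (\<phi> \<alpha>)) g) \<in> Q" for g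
    by (simp add: diag_map_def spec_map_def carr emb_eq)
  have memp: "g \<in> proj_map E (emb P) \<longleftrightarrow> pvars g \<subseteq> E \<and> to_conf g \<in> P"
    for g and P :: "('i, 'a) conf_ring set"
    by (simp add: proj_map_def spec_map_def carr emb_eq)
  have "Q \<in> Theta_pair E \<phi> Z \<longleftrightarrow>
      (\<forall>J\<subseteq>carrier ?R. \<not> J \<subseteq> ?d \<longrightarrow> (\<exists>P\<in>Z. \<not> J \<subseteq> proj_map E (emb P)))"
  proof
    assume "Q \<in> Theta_pair E \<phi> Z"
    then have *: "\<exists>y. y \<in> (\<lambda>P. proj_map E (emb P)) ` Z \<and> y \<in> T"
      if "?d \<in> T" "openin (zariski ?R) T" for T
      using that by (simp add: Theta_pair_def in_closure_of)
    show "\<forall>J\<subseteq>carrier ?R. \<not> J \<subseteq> ?d \<longrightarrow> (\<exists>P\<in>Z. \<not> J \<subseteq> proj_map E (emb P))"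
    proof (intro allI impI)
      fix J assume J: "J \<subseteq> carrier ?R" "\<not> J \<subseteq> ?d"
      have "openin (zariski ?R) {P \<in> Spec ?R. \<not> J \<subseteq> P}"
        unfolding openin_zariski using J(1) by blast
      from *[OF _ this] J(2) d show "\<exists>P\<in>Z. \<not> J \<subseteq> proj_map E (emb P)" by auto
    qed
  next
    assume *: "\<forall>J\<subseteq>carrier ?R. \<not> J \<subseteq> ?d \<longrightarrow> (\<exists>P\<in>Z. \<not> J \<subseteq> proj_map E (emb P))"
    have "\<exists>y. y \<in> (\<lambda>P. proj_map E (emb P)) ` Z \<and> y \<in> T"
      if T: "?d \<in> T" "openin (zariski ?R) T" for T
    proof -
      obtain J where J: "J \<subseteq> carrier ?R" "T = {P \<in> Spec ?R. \<not> J \<subseteq> P}"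
        using T(2) unfolding openin_zariski by blast
      then obtain P where "P \<in> Z" "\<not> J \<subseteq> proj_map E (emb P)" using * T(1) by blast
      then show ?thesis using proj J(2) by blast
    qed
    then show "Q \<in> Theta_pair E \<phi> Z"
      using assms(2) d by (simp add: Theta_pair_def in_closure_of topspace_zariski)
  qed
  also have "\<dots> \<longleftrightarrow> (\<forall>g. pvars g \<subseteq> E \<longrightarrow> (\<forall>P\<in>Z. to_conf g \<in> P) \<longrightarrow> g \<in> ?d)"
  proof (intro iffI allI impI)
    fix g
    assume "\<forall>J\<subseteq>carrier ?R. \<not> J \<subseteq> ?d \<longrightarrow> (\<exists>P\<in>Z. \<not> J \<subseteq> proj_map E (emb P))"
      and g: "pvars g \<subseteq> E" "\<forall>P\<in>Z. to_conf g \<in> P"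
    from this(1)[rule_format, of "{g}"] g show "g \<in> ?d"
      by (auto simp: carr memp)
  next
    fix J
    assume *: "\<forall>g. pvars g \<subseteq> E \<longrightarrow> (\<forall>P\<in>Z. to_conf g \<in> P) \<longrightarrow> g \<in> ?d"
      and J: "J \<subseteq> carrier ?R" "\<not> J \<subseteq> ?d"
    then obtain g where g: "g \<in> J" "g \<notin> ?d" "pvars g \<subseteq> E" by (auto simp: carr)
    then obtain P where "P \<in> Z" "to_conf g \<notin> P" using * by blast
    then show "\<exists>P\<in>Z. \<not> J \<subseteq> proj_map E (emb P)" using g(1) memp by blast
  qed
  finally show ?thesis by (auto simp: memd)
qed

section \<open>The ideals \<open>\<PP>(\<lambda>, e; Z)\<close> by evaluation\<close>

lemma part_index_eq:
  assumes "partition_of_type lam U"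
  shows "part_index U i = \<alpha> \<longleftrightarrow> i \<in> U \<alpha>"
proof -
  have dis: "disjoint_family U" and cover: "(\<Union>\<alpha>. U \<alpha>) = UNIV"
    using assms by (simp_all add: partition_of_type_def)
  have uniq: "\<beta> = \<gamma>" if "i \<in> U \<beta>" "i \<in> U \<gamma>" for \<beta> \<gamma>
    using dis that by (auto simp: disjoint_family_on_def)
  obtain \<beta> where \<beta>: "i \<in> U \<beta>" using cover by blast
  have "i \<in> U (part_index U i)"
    unfolding part_index_def
    by (rule theI[of "\<lambda>\<alpha>. i \<in> U \<alpha>" \<beta>]) (use \<beta> uniq[OF _ \<beta>] in blast)+
  then show ?thesis using uniq by blast
qed

text \<open>The homomorphism \<open>\<xi>\<^sub>i \<mapsto> t\<^bsub>\<pi> (\<sigma> i)\<^esub> + \<epsilon>\<^bsub>\<sigma> i\<^esub>\<close>.\<close>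

definition jet_eval :: "('i \<Rightarrow> nat set) \<Rightarrow> (nat \<Rightarrow> nat) \<Rightarrow> (nat, 'a::comm_ring_1) mpoly \<Rightarrow>
    (nat, ('i, 'a) conf_ring) mpoly" where
  "jet_eval U \<sigma> = peval (\<lambda>c. PConst (to_conf (PConst c)))
     (\<lambda>i. PConst (to_conf (PVar (part_index U (\<sigma> i)))) + PVar (\<sigma> i))"

lemma rhom_const_conf: "rhom (\<lambda>c. to_conf (PConst c))"
  by (rule rhom_comp[OF rhom_to_conf rhom_PConst])

lemma rhom_jet_eval_const: "rhom (\<lambda>c. PConst (to_conf (PConst c)))"
  by (rule rhom_comp[OF rhom_PConst rhom_const_conf])

lemma rhom_jet_eval: "rhom (jet_eval U \<sigma>)"
  unfolding jet_eval_def by (rule rhom_peval[OF rhom_jet_eval_const])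

lemma jet_eval_PVar:
  "jet_eval U \<sigma> (PVar i) = PConst (to_conf (PVar (part_index U (\<sigma> i)))) + PVar (\<sigma> i)"
  by (simp add: jet_eval_def peval_PVar[OF rhom_jet_eval_const])

lemma iota_perm_act: "iota U (perm_act \<sigma> f) = jet_eval U \<sigma> f"
proof (rule rhom_eqI[where E = UNIV and ?h1.0 = "\<lambda>f. iota U (perm_act \<sigma> f)"])
  show "rhom (\<lambda>f. iota U (perm_act \<sigma> f))"
    unfolding iota_def perm_act_def
    by (rule rhom_comp[OF rhom_peval[OF rhom_jet_eval_const] rhom_peval[OF rhom_PConst]])
qed (simp_all add: rhom_jet_eval, simp_all add: iota_def perm_act_def jet_eval_def
    peval_PConst peval_PVar rhom_jet_eval_const rhom_PConst)

lemma mem_PP_iff: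
  assumes "Z \<subseteq> topspace conf_space"
  shows "f \<in> PP e U Z \<longleftrightarrow>
    (\<forall>P\<in>Z. \<forall>\<sigma>\<in>fin_perms. jet_eval U \<sigma> f \<in> jet_ideal P (\<lambda>i. e (part_index U i)))"
proof -
  have "type_ideal P" if "P \<in> Z" for P
    using that assms type_prime_conf_space type_prime.axioms(1) by blast
  then show ?thesis
    unfolding PP_def iota_perm_act by (subst QQ_eq_jet_ideal) (auto simp: jet_ideal_Inter)
qed

lemma inj_fin_perm: "\<sigma> \<in> fin_perms \<Longrightarrow> inj \<sigma>"
  by (auto simp: fin_perms_def dest: permutes_inj)

lemma fin_perm_extend:
  fixes s :: "nat \<Rightarrow> nat"
  assumes "finite B" "inj_on s B"
  obtains \<sigma> where "\<sigma> \<in> fin_perms" "\<And>i. i \<in> B \<Longrightarrow> \<sigma> i = s i"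
proof -
  obtain n where n: "B \<union> s ` B \<subseteq> {..<n}"
    using finite_nat_bounded[of "B \<union> s ` B"] assms(1) by (auto simp: lessThan_def)
  have "card ({..<n} - B) = card ({..<n} - s ` B)"
    using n assms by (simp add: card_Diff_subset card_image)
  then obtain r where r: "bij_betw r ({..<n} - B) ({..<n} - s ` B)"
    using finite_same_card_bij[of "{..<n} - B" "{..<n} - s ` B"] by auto
  define \<sigma> where "\<sigma> i = (if i \<in> B then s i else if i < n then r i else i)" for i
  have "bij_betw \<sigma> B (s ` B)"
    using assms(2) by (simp add: \<sigma>_def bij_betw_def inj_on_def)
  moreover have "bij_betw \<sigma> ({..<n} - B) ({..<n} - s ` B)"
    using r by (subst bij_betw_cong[of _ _ r]) (auto simp: \<sigma>_def)
  ultimately have "bij_betw \<sigma> (B \<union> ({..<n} - B)) (s ` B \<union> ({..<n} - s ` B))"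
    by (rule bij_betw_combine) blast
  moreover have "B \<union> ({..<n} - B) = {..<n}" "s ` B \<union> ({..<n} - s ` B) = {..<n}"
    using n by auto
  ultimately have "bij_betw \<sigma> {..<n} {..<n}" by simp
  then have "\<sigma> permutes {..<n}"
    using n by (intro bij_imp_permutes) (auto simp: \<sigma>_def)
  then have "\<sigma> \<in> fin_perms" by (auto simp: fin_perms_def)
  then show ?thesis by (rule that) (simp add: \<sigma>_def)
qed

text \<open>
  A map from finitely many indices to the blocks of \<open>U\<close> is induced by a finitary permutation
  as soon as no block receives more indices than it has elements.
\<close>

lemma fin_perm_realize:
  assumes U: "partition_of_type lam U" and "finite B"
    and card: "\<And>\<alpha>. enat (card {i \<in> B. p i = \<alpha>}) \<le> lam \<alpha>"
  obtains \<sigma> where "\<sigma> \<in> fin_perms" "\<And>i. i \<in> B \<Longrightarrow> part_index U (\<sigma> i) = p i"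
proof -
  have "\<exists>r. inj_on r {i \<in> B. p i = \<alpha>} \<and> r ` {i \<in> B. p i = \<alpha>} \<subseteq> U \<alpha>" for \<alpha>
  proof -
    have "enat (card {i \<in> B. p i = \<alpha>}) \<le> set_size (U \<alpha>)"
      using card U by (simp add: partition_of_type_def)
    then have "\<exists>S\<subseteq>U \<alpha>. card S = card {i \<in> B. p i = \<alpha>} \<and> finite S"
      by (metis (full_types) enat_ord_simps(1) infinite_arbitrarily_large obtain_subset_with_card_n
          set_size_def)
    then obtain S where S: "S \<subseteq> U \<alpha>" "card S = card {i \<in> B. p i = \<alpha>}" "finite S" by blast
    then obtain r where "bij_betw r {i \<in> B. p i = \<alpha>} S"
      using finite_same_card_bij[of "{i \<in> B. p i = \<alpha>}" S] assms(2) by auto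
    then show ?thesis using S(1) by (auto simp: bij_betw_def)
  qed
  then have "\<forall>\<alpha>. \<exists>r. inj_on r {i \<in> B. p i = \<alpha>} \<and> r ` {i \<in> B. p i = \<alpha>} \<subseteq> U \<alpha>" ..
  from choice[OF this] obtain r where r: "\<And>\<alpha>. inj_on (r \<alpha>) {i \<in> B. p i = \<alpha>}"
    "\<And>\<alpha>. r \<alpha> ` {i \<in> B. p i = \<alpha>} \<subseteq> U \<alpha>" by blast
  define s where "s i = r (p i) i" for i
  have s: "part_index U (s i) = p i" if "i \<in> B" for i
    using r(2)[of "p i"] that by (auto simp: part_index_eq[OF U] s_def)
  have "inj_on s B"
  proof (rule inj_onI)
    fix i j assume ij: "i \<in> B" "j \<in> B" "s i = s j"
    then have "p i = p j" using s by metis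
    then show "i = j" using r(1)[of "p j"] ij by (auto simp: s_def dest: inj_onD)
  qed
  with assms(2) obtain \<sigma> where "\<sigma> \<in> fin_perms" "\<And>i. i \<in> B \<Longrightarrow> \<sigma> i = s i"
    by (rule fin_perm_extend) blast
  then show ?thesis using s by (intro that[of \<sigma>]) simp_all
qed

lemma jet_eval_mem_iff:
  assumes "P \<in> topspace conf_space" "weighting e" "\<sigma> \<in> fin_perms" "finite B" "pvars f \<subseteq> B"
  shows "jet_eval U \<sigma> f \<in> jet_ideal P (\<lambda>i. e (part_index U i)) \<longleftrightarrow>
    (\<forall>k. (\<forall>i\<in>B. k i < e (part_index U (\<sigma> i))) \<longrightarrow> divdiff_eval (\<lambda>c. to_conf (PConst c)) B
      (\<lambda>i. replicate (Suc (k i)) (to_conf (PVar (part_index U (\<sigma> i))))) f \<in> P)"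
  unfolding jet_eval_def
proof (rule peval_in_jet_ideal_iff)
  show "type_ideal P" using type_prime_conf_space[OF assms(1)] type_prime.axioms(1) by blast
  show "inj_on \<sigma> B" using inj_fin_perm[OF assms(3)] by (rule inj_on_subset) simp
  show "0 < e (part_index U j)" for j
    using assms(2) by (auto simp: weighting_def Suc_le_eq dest: spec)
qed (use assms in auto)

text \<open>
  The vanishing conditions on the elements of \<open>\<PP>(\<lambda>, e; Z)\<close>, for an arbitrary assignment \<open>p\<close> of
  the variables to the blocks.
\<close>

lemma PP_divdiff_eval:
  assumes "Z \<subseteq> topspace conf_space" "partition_of_type lam U" "weighting e"
    and "f \<in> PP e U Z" "P \<in> Z" "finite B" "pvars f \<subseteq> B"
    and "\<And>\<alpha>. enat (card {i \<in> B. p i = \<alpha>}) \<le> lam \<alpha>" "\<And>i. i \<in> B \<Longrightarrow> k i < e (p i)"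
  shows "divdiff_eval (\<lambda>c. to_conf (PConst c)) B
    (\<lambda>i. replicate (Suc (k i)) (to_conf (PVar (p i)))) f \<in> P"
proof -
  obtain \<sigma> where \<sigma>: "\<sigma> \<in> fin_perms" "\<And>i. i \<in> B \<Longrightarrow> part_index U (\<sigma> i) = p i"
    using fin_perm_realize[OF assms(2,6,8)] by blast
  have "divdiff_eval (\<lambda>c. to_conf (PConst c)) B
      (\<lambda>i. replicate (Suc (k i)) (to_conf (PVar (part_index U (\<sigma> i))))) f \<in> P"
    using assms \<sigma> jet_eval_mem_iff[of P e \<sigma> B f U] mem_PP_iff[OF assms(1), of f e U] by auto
  also have "divdiff_eval (\<lambda>c. to_conf (PConst c)) B
      (\<lambda>i. replicate (Suc (k i)) (to_conf (PVar (part_index U (\<sigma> i))))) f =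
      divdiff_eval (\<lambda>c. to_conf (PConst c)) B (\<lambda>i. replicate (Suc (k i)) (to_conf (PVar (p i)))) f"
    unfolding divdiff_eval_def by (simp add: \<sigma>(2))
  finally show ?thesis .
qed

section \<open>Degeneration of solutions\<close>

lemma ex_list_bounded_count:
  fixes e :: "'i \<Rightarrow> nat"
  assumes "finite E" "n \<le> sum e E"
  shows "\<exists>as. length as = n \<and> set as \<subseteq> E \<and> (\<forall>\<alpha>. count (mset as) \<alpha> \<le> e \<alpha>)"
  using assms
proof (induction E arbitrary: n rule: finite_induct)
  case empty
  then show ?case by simp
next
  case (insert \<beta> E)
  define k where "k = min n (e \<beta>)"
  have "n - k \<le> sum e E" using insert by (auto simp: k_def)
  then obtain as where as: "length as = n - k" "set as \<subseteq> E" "\<forall>\<alpha>. count (mset as) \<alpha> \<le> e \<alpha>"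
    using insert.IH by blast
  have "count (mset as) \<beta> = 0" using as(2) insert.hyps(2) by (auto simp: count_eq_zero_iff)
  moreover have "count (mset (replicate k \<beta> @ as)) \<alpha> =
      (if \<alpha> = \<beta> then k else 0) + count (mset as) \<alpha>" for \<alpha>
    by simp
  moreover have "k \<le> e \<beta>" by (simp add: k_def)
  ultimately have "count (mset (replicate k \<beta> @ as)) \<alpha> \<le> e \<alpha>" for \<alpha>
    using as(3)[rule_format, of \<alpha>] by (smt (verit) add_0 add.right_neutral)
  moreover have "length (replicate k \<beta> @ as) = n" using as(1) by (simp add: k_def)
  moreover have "set (replicate k \<beta> @ as) \<subseteq> insert \<beta> E" using as(2) by auto
  ultimately show ?case by blast
qed

text \<open>
  A finite set can be distributed over \<open>E\<close> within the capacities \<open>lam\<close> if they suffice in total.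
\<close>

lemma ex_bounded_fibers:
  fixes lam :: "'i \<Rightarrow> enat"
  assumes "finite E" "finite A" "enat (card A) \<le> sum lam E"
  shows "\<exists>p. (\<forall>i\<in>A. p i \<in> E) \<and> (\<forall>\<alpha>. enat (card {i \<in> A. p i = \<alpha>}) \<le> lam \<alpha>)"
  using assms
proof (induction E arbitrary: A rule: finite_induct)
  case empty
  then have "A = {}" by (simp add: zero_enat_def)
  then show ?case by (simp flip: zero_enat_def)
next
  case (insert \<beta> E)
  have "\<exists>C\<subseteq>A. enat (card C) \<le> lam \<beta> \<and> enat (card (A - C)) \<le> sum lam E"
  proof (cases "enat (card A) \<le> lam \<beta>")
    case True
    then show ?thesis by (intro exI[of _ A]) (simp flip: zero_enat_def)
  next
    case False
    then obtain n where n: "lam \<beta> = enat n" "n < card A" by (cases "lam \<beta>") auto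
    then obtain C where C: "C \<subseteq> A" "card C = n"
      by (metis less_imp_le obtain_subset_with_card_n)
    have "enat (card A) \<le> enat n + sum lam E" using insert n(1) by simp
    then have "enat (card (A - C)) \<le> sum lam E"
      using C insert.prems(1) by (cases "sum lam E") (auto simp: card_Diff_subset finite_subset)
    then show ?thesis using C n by auto
  qed
  then obtain C where C: "C \<subseteq> A" "enat (card C) \<le> lam \<beta>" "enat (card (A - C)) \<le> sum lam E"
    by blast
  obtain p where p: "\<forall>i\<in>A - C. p i \<in> E" "\<forall>\<alpha>. enat (card {i \<in> A - C. p i = \<alpha>}) \<le> lam \<alpha>"
    using insert.IH[of "A - C"] insert.prems(1) C(3) by auto
  define q where "q i = (if i \<in> C then \<beta> else p i)" for i
  have "{i \<in> A. q i = \<beta>} = C" using p(1) insert.hyps(2) C(1) by (auto simp: q_def)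
  moreover have "{i \<in> A. q i = \<alpha>} = {i \<in> A - C. p i = \<alpha>}" if "\<alpha> \<noteq> \<beta>" for \<alpha>
    using that by (auto simp: q_def)
  ultimately have "enat (card {i \<in> A. q i = \<alpha>}) \<le> lam \<alpha>" for \<alpha>
    using C(2) p(2) by (cases "\<alpha> = \<beta>") auto
  moreover have "\<forall>i\<in>A. q i \<in> insert \<beta> E" using p(1) by (auto simp: q_def)
  ultimately show ?case by blast
qed

theorem PP_subset_of_Theta:
  fixes lam :: "'i::finite \<Rightarrow> enat" and mu :: "'k \<Rightarrow> enat"
    and Z :: "('i, 'a::comm_ring_1) conf_ring set set"
  assumes "weighting e" "weighting d" "reduced mu d"
    and U: "partition_of_type lam U" and V: "partition_of_type mu V"
    and Z: "Z \<subseteq> topspace conf_space" and Y: "Y \<subseteq> topspace conf_space"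
    and sub: "Y \<subseteq> Theta mu d lam e Z"
  shows "PP e U Z \<subseteq> PP d V Y"
proof
  fix f assume f: "f \<in> PP e U Z"
  define B where "B = pvars f"
  have finB: "finite B" by (simp add: B_def finite_pvars)
  show "f \<in> PP d V Y"
    unfolding mem_PP_iff[OF Y]
  proof (intro ballI)
    fix Q and \<sigma> :: "nat \<Rightarrow> nat" assume Q: "Q \<in> Y" and \<sigma>: "\<sigma> \<in> fin_perms"
    define \<rho> where "\<rho> i = part_index V (\<sigma> i)" for i
    obtain E \<phi> where good: "good_pair mu d lam e E \<phi>" and QE: "Q \<in> Theta_pair E \<phi> Z"
      using sub Q by (auto simp: Theta_def)
    have QY: "Q \<in> topspace conf_space" using Q Y by blast
    have fiber: "enat (card {i \<in> B. \<rho> i = \<beta>}) \<le> mu \<beta>" for \<beta>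
    proof (cases "finite (V \<beta>)")
      case True
      have "inj_on \<sigma> {i \<in> B. \<rho> i = \<beta>}" using inj_fin_perm[OF \<sigma>] by (rule inj_on_subset) simp
      moreover have "\<sigma> ` {i \<in> B. \<rho> i = \<beta>} \<subseteq> V \<beta>" by (auto simp: \<rho>_def part_index_eq[OF V])
      ultimately have "card {i \<in> B. \<rho> i = \<beta>} \<le> card (V \<beta>)" using True by (rule card_inj_on_le)
      moreover have "set_size (V \<beta>) = mu \<beta>" using V by (simp add: partition_of_type_def)
      then have "mu \<beta> = enat (card (V \<beta>))" using True by (simp add: set_size_def)
      ultimately show ?thesis by simp
    next
      case False
      moreover have "set_size (V \<beta>) = mu \<beta>" using V by (simp add: partition_of_type_def)
      ultimately have "mu \<beta> = \<infinity>" by (simp add: set_size_def)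
      then show ?thesis by simp
    qed
    have "\<exists>p. (\<forall>i\<in>{i \<in> B. \<rho> i = \<beta>}. p i \<in> {\<alpha> \<in> E. \<phi> \<alpha> = \<beta>}) \<and>
        (\<forall>\<alpha>. enat (card {i \<in> {i \<in> B. \<rho> i = \<beta>}. p i = \<alpha>}) \<le> lam \<alpha>)" for \<beta>
    proof (rule ex_bounded_fibers)
      have "mu \<beta> \<le> sum lam {\<alpha> \<in> E. \<phi> \<alpha> = \<beta>}" using good by (simp add: good_pair_def)
      then show "enat (card {i \<in> B. \<rho> i = \<beta>}) \<le> sum lam {\<alpha> \<in> E. \<phi> \<alpha> = \<beta>}"
        using fiber order_trans by blast
    qed (use finB in auto)
    then have "\<forall>\<beta>. \<exists>p. (\<forall>i\<in>{i \<in> B. \<rho> i = \<beta>}. p i \<in> {\<alpha> \<in> E. \<phi> \<alpha> = \<beta>}) \<and>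
        (\<forall>\<alpha>. enat (card {i \<in> {i \<in> B. \<rho> i = \<beta>}. p i = \<alpha>}) \<le> lam \<alpha>)" ..
    then obtain p0 where p0: "\<forall>\<beta>. (\<forall>i\<in>{i \<in> B. \<rho> i = \<beta>}. p0 \<beta> i \<in> {\<alpha> \<in> E. \<phi> \<alpha> = \<beta>}) \<and>
        (\<forall>\<alpha>. enat (card {i \<in> {i \<in> B. \<rho> i = \<beta>}. p0 \<beta> i = \<alpha>}) \<le> lam \<alpha>)"
      by (rule choice[THEN exE])
    have p0E: "p0 (\<rho> i) i \<in> E \<and> \<phi> (p0 (\<rho> i) i) = \<rho> i" if "i \<in> B" for i
      using p0 that by blast
    have p0card: "enat (card {i \<in> {i \<in> B. \<rho> i = \<beta>}. p0 \<beta> i = \<alpha>}) \<le> lam \<alpha>" for \<alpha> \<beta>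
      using p0 by blast
    define \<tau> where "\<tau> i = p0 (\<rho> i) i" for i
    \<comment> \<open>The nodes for the variable \<open>i\<close>.  In an infinite block these are all infinite \<open>\<alpha>\<close> over it, as
      in (G2).  In a finite block \<open>d\<close> is \<open>1\<close>, and a single \<open>\<alpha>\<close> chosen by (G1) suffices.\<close>
    define F where "F i = (if mu (\<rho> i) = \<infinity> then {\<alpha> \<in> E. \<phi> \<alpha> = \<rho> i \<and> lam \<alpha> = \<infinity>} else {\<tau> i})" for i
    have FE: "\<alpha> \<in> E" "\<phi> \<alpha> = \<rho> i" if "i \<in> B" "\<alpha> \<in> F i" for i \<alpha>
      using that p0E[OF that(1)] by (auto simp: F_def \<tau>_def split: if_splits)
    have Fd: "d (\<rho> i) \<le> sum e (F i)" for i
    proof (cases "mu (\<rho> i) = \<infinity>")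
      case True
      then show ?thesis using good by (simp add: good_pair_def F_def)
    next
      case False
      then have "d (\<rho> i) = 1" using assms(3) by (simp add: reduced_def)
      moreover have "F i = {\<tau> i}" unfolding F_def using False by auto
      ultimately show ?thesis using assms(1) by (simp add: weighting_def)
    qed
    \<comment> \<open>Every choice of nodes respects the sizes of the blocks, as finite \<open>\<alpha>\<close> are used only by \<open>\<tau>\<close>.\<close>
    have Fcard: "enat (card {i \<in> B. p i = \<alpha>}) \<le> lam \<alpha>" if p: "\<And>i. i \<in> B \<Longrightarrow> p i \<in> F i" for p \<alpha>
    proof (cases "lam \<alpha> = \<infinity>")
      case False
      have "{i \<in> B. p i = \<alpha>} \<subseteq> {i \<in> {i \<in> B. \<rho> i = \<phi> \<alpha>}. p0 (\<phi> \<alpha>) i = \<alpha>}"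
      proof
        fix i assume i: "i \<in> {i \<in> B. p i = \<alpha>}"
        then have "\<alpha> \<in> F i" "i \<in> B" using p by auto
        then show "i \<in> {i \<in> {i \<in> B. \<rho> i = \<phi> \<alpha>}. p0 (\<phi> \<alpha>) i = \<alpha>}"
          using FE[of i \<alpha>] False by (auto simp: F_def \<tau>_def split: if_splits)
      qed
      then have "card {i \<in> B. p i = \<alpha>} \<le> card {i \<in> {i \<in> B. \<rho> i = \<phi> \<alpha>}. p0 (\<phi> \<alpha>) i = \<alpha>}"
        using finB by (intro card_mono) auto
      then show ?thesis using p0card[of "\<phi> \<alpha>" \<alpha>] by (meson enat_ord_simps(1) order_trans)
    qed simp
    have "divdiff_eval (\<lambda>c. to_conf (PConst c)) B
        (\<lambda>i. replicate (Suc (k i)) (to_conf (PVar (\<rho> i)))) f \<in> Q"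
      if k: "\<And>i. i \<in> B \<Longrightarrow> k i < d (\<rho> i)" for k
    proof -
      have "\<exists>as. length as = Suc (k i) \<and> set as \<subseteq> F i \<and> (\<forall>\<alpha>. count (mset as) \<alpha> \<le> e \<alpha>)"
        if "i \<in> B" for i
        using k[OF that] Fd[of i] by (intro ex_list_bounded_count) auto
      then obtain as where as: "\<And>i. i \<in> B \<Longrightarrow> length (as i) = Suc (k i)"
        "\<And>i. i \<in> B \<Longrightarrow> set (as i) \<subseteq> F i" "\<And>i \<alpha>. i \<in> B \<Longrightarrow> count (mset (as i)) \<alpha> \<le> e \<alpha>"
        by metis
      \<comment> \<open>The nodes become equal under \<open>\<phi>\<close>, so \<open>g\<close> specializes to a Taylor coefficient of \<open>f\<close>.\<close>
      define g where "g = divdiff_eval PConst B (\<lambda>i. map PVar (as i)) f"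
      have asE: "set (as i) \<subseteq> E" if "i \<in> B" for i
        using as(2)[OF that] FE(1)[OF that] by blast
      have gE: "pvars g \<subseteq> E"
        unfolding g_def by (intro pvars_divdiff_eval) (auto simp: pvars_PVar dest: subsetD[OF asE])
      have gZ: "to_conf g \<in> P" if P: "P \<in> Z" for P
      proof -
        have "divdiff_eval (\<lambda>c. to_conf (PConst c)) B (\<lambda>i. map (\<lambda>\<alpha>. to_conf (PVar \<alpha>)) (as i)) f \<in> P"
        proof (rule divdiff_eval_partial_fractions[where E = F and e = e])
          show "type_ideal P"
            using P Z type_prime_conf_space type_prime.axioms(1) by blast
          show "as i \<noteq> []" if "i \<in> B" for i using as(1)[OF that] by auto
          fix p k' assume "\<And>i. i \<in> B \<Longrightarrow> p i \<in> F i" "\<And>i. i \<in> B \<Longrightarrow> k' i < e (p i)"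
          then show "divdiff_eval (\<lambda>c. to_conf (PConst c)) B
              (\<lambda>i. replicate (Suc (k' i)) (to_conf (PVar (p i)))) f \<in> P"
            using Z U assms(1) f P finB Fcard by (intro PP_divdiff_eval) (auto simp: B_def)
        qed (use finB as to_conf_diff_unit in auto)
        then show ?thesis
          unfolding g_def rhom_divdiff_eval[OF rhom_to_conf] by (simp add: comp_def)
      qed
      have "to_conf (peval PConst (\<lambda>\<alpha>. PVar (\<phi> \<alpha>)) g) \<in> Q"
        using QE gE gZ Theta_pair_iff[OF Z QY] by blast
      also have "peval PConst (\<lambda>\<alpha>. PVar (\<phi> \<alpha>)) g =
          divdiff_eval PConst B (\<lambda>i. map (\<lambda>\<alpha>. PVar (\<phi> \<alpha>)) (as i)) f"
        unfolding g_def rhom_divdiff_eval[OF rhom_peval[OF rhom_PConst]]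
        by (simp add: comp_def peval_PConst peval_PVar rhom_PConst)
      also have "to_conf \<dots> = divdiff_eval (\<lambda>c. to_conf (PConst c)) B
          (\<lambda>i. map (\<lambda>\<alpha>. to_conf (PVar (\<phi> \<alpha>))) (as i)) f"
        unfolding rhom_divdiff_eval[OF rhom_to_conf] by (simp add: comp_def)
      also have "\<dots> = divdiff_eval (\<lambda>c. to_conf (PConst c)) B
          (\<lambda>i. replicate (Suc (k i)) (to_conf (PVar (\<rho> i)))) f"
      proof -
        have "map (\<lambda>\<alpha>. to_conf (PVar (\<phi> \<alpha>))) (as i) = replicate (Suc (k i)) (to_conf (PVar (\<rho> i)))"
          if "i \<in> B" for i
        proof -
          have "\<phi> \<alpha> = \<rho> i" if "\<alpha> \<in> set (as i)" for \<alpha>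
            using as(2)[OF \<open>i \<in> B\<close>] FE(2)[OF \<open>i \<in> B\<close>] that by blast
          then have "map (\<lambda>\<alpha>. to_conf (PVar (\<phi> \<alpha>))) (as i) = map (\<lambda>_. to_conf (PVar (\<rho> i))) (as i)"
            by (intro map_cong) simp_all
          then show ?thesis by (simp only: map_replicate_const as(1)[OF that])
        qed
        then show ?thesis by (rule divdiff_eval_cong)
      qed
      finally show ?thesis .
    qed
    then show "jet_eval V \<sigma> f \<in> jet_ideal Q (\<lambda>i. d (part_index V i))"
      using jet_eval_mem_iff[OF QY assms(2) \<sigma> finB, of f V] by (simp add: B_def \<rho>_def)
  qed
qed

section \<open>Vandermonde products\<close>

text \<open>
  The Vandermonde determinant of the family \<open>x\<close>, indexed by a linearly ordered set, in product form.
\<close>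

definition vandermonde :: "('v::linorder \<Rightarrow> 'r::comm_ring_1) \<Rightarrow> 'v set \<Rightarrow> 'r" where
  "vandermonde x F = (\<Prod>v\<in>F. \<Prod>u | u \<in> F \<and> u < v. x v - x u)"

lemma vandermonde_insert_max:
  assumes "finite A" "\<And>u. u \<in> A \<Longrightarrow> u < b"
  shows "vandermonde x (insert b A) = vandermonde x A * (\<Prod>u\<in>A. x b - x u)"
proof -
  have "b \<notin> A" using assms(2) by blast
  have "{u \<in> insert b A. u < b} = A" using assms(2) by auto
  moreover have "{u \<in> insert b A. u < v} = {u \<in> A. u < v}" if "v \<in> A" for v
    using assms(2)[OF that] by auto
  ultimately show ?thesis
    using assms(1) \<open>b \<notin> A\<close> by (simp add: vandermonde_def mult.commute)
qed

lemma (in rhom) hom_vandermonde: "h (vandermonde x F) = vandermonde (\<lambda>v. h (x v)) F"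
  by (simp add: vandermonde_def hom_prod hom_diff)

lemma vandermonde_shift:
  assumes "\<And>v. v \<in> F \<Longrightarrow> x v = c + y v"
  shows "vandermonde x F = vandermonde y F"
proof -
  have "x v - x u = y v - y u" if "v \<in> F" "u \<in> F" for u v
    using assms[OF that(1)] assms[OF that(2)] by simp
  then show ?thesis unfolding vandermonde_def by (intro prod.cong refl) blast
qed

text \<open>
  If a monic polynomial \<open>h\<close> of degree less than the number of nodes takes values in an ideal at
  all nodes, then the ideal contains the Vandermonde product: modulo the ideal the coefficient
  vector of \<open>h\<close> is in the kernel of the Vandermonde matrix, and one of its entries is \<open>1\<close>.  The
  induction divides \<open>h - h(x\<^sub>b)\<close> by \<open>X - x\<^sub>b\<close>.
\<close>

lemma vandermonde_mem:
  fixes x :: "'v::linorder \<Rightarrow> 'r::comm_ring_1"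
  assumes "type_ideal N" "finite F" "lead_coeff h = 1" "degree h < card F"
    and "\<And>v. v \<in> F \<Longrightarrow> poly h (x v) \<in> N"
  shows "vandermonde x F \<in> N"
  using assms
proof (induction "degree h" arbitrary: h F N)
  case 0
  interpret type_ideal N by (rule "0.prems"(1))
  obtain v where "v \<in> F" using "0.prems"(4) by fastforce
  moreover obtain a where "h = [:a:]" using "0.hyps" by (metis degree_eq_zeroE)
  then have "h = [:1:]" using "0.prems"(3) by simp
  ultimately have "1 \<in> N" using "0.prems"(5)[of v] by simp
  then show ?case using mult_mem[of 1] by simp
next
  case (Suc n)
  interpret type_ideal N by (rule Suc.prems(1))
  define b where "b = Max F"
  define A where "A = F - {b}"
  have "F \<noteq> {}" using Suc.prems(4) by auto
  then have b: "b \<in> F" using Suc.prems(2) by (simp add: b_def)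
  have A: "finite A" "F = insert b A" "b \<notin> A" using b Suc.prems(2) by (auto simp: A_def)
  have less: "u < b" if "u \<in> A" for u
    using that Suc.prems(2) Max_ge[of F u] by (auto simp: A_def b_def less_le)
  \<comment> \<open>The quotient \<open>h'\<close> takes values in the ideal quotient by \<open>C\<close> at the remaining nodes.\<close>
  define C where "C = (\<Prod>u\<in>A. x b - x u)"
  define h' where "h' = synthetic_div h (x b)"
  have deg: "degree h' = n" using Suc.hyps(2) by (simp add: h'_def degree_synthetic_div)
  have "coeff h (Suc n) + x b * coeff h' (Suc n) = coeff h' n"
    using arg_cong[OF synthetic_div_correct[of h "x b"], of "\<lambda>p. coeff p (Suc n)"]
    by (simp add: h'_def)
  moreover have "coeff h' (Suc n) = 0" using deg by (simp add: coeff_eq_0)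
  moreover have "coeff h (Suc n) = 1" using Suc.hyps(2) Suc.prems(3) by simp
  ultimately have lead: "lead_coeff h' = 1" using deg by simp
  have "vandermonde x A \<in> {a. a * C \<in> N}"
  proof (rule Suc.hyps(1))
    show "type_ideal {a. a * C \<in> N}" by (rule colon)
    show "degree h' < card A" using Suc.prems(4) Suc.hyps(2) A deg by simp
    fix u assume u: "u \<in> A"
    have "poly h (x u) = (x u - x b) * poly h' (x u) + poly h (x b)"
      using arg_cong[OF synthetic_div_correct'[of "x b" h], of "\<lambda>p. poly p (x u)"]
      by (simp add: h'_def algebra_simps)
    then have "(x b - x u) * poly h' (x u) = poly h (x b) - poly h (x u)"
      by (simp add: algebra_simps)
    also have "\<dots> \<in> N" using u A by (intro diff_mem Suc.prems(5)) auto
    finally have "(\<Prod>v\<in>A - {u}. x b - x v) * ((x b - x u) * poly h' (x u)) \<in> N" by (rule mult_mem)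
    also have "(\<Prod>v\<in>A - {u}. x b - x v) * ((x b - x u) * poly h' (x u)) = poly h' (x u) * C"
      unfolding C_def using u A(1) by (simp add: prod.remove[of A u] mult_ac)
    finally show "poly h' (x u) \<in> {a. a * C \<in> N}" by simp
  qed (use deg lead A in auto)
  then show ?case
    using vandermonde_insert_max[OF A(1) less, of x] by (simp add: A(2) C_def)
qed

lemma monic_prod_linear:
  fixes t :: "'i \<Rightarrow> 'r::comm_ring_1"
  assumes "finite A"
  shows "lead_coeff (\<Prod>\<alpha>\<in>A. [:- t \<alpha>, 1:] ^ e \<alpha>) = 1 \<and> degree (\<Prod>\<alpha>\<in>A. [:- t \<alpha>, 1:] ^ e \<alpha>) = sum e A"
proof -
  have mult: "lead_coeff (p * q) = 1 \<and> degree (p * q) = degree p + degree q"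
    if "lead_coeff p = 1" "lead_coeff q = 1" for p q :: "'r poly"
  proof -
    have "coeff (p * q) (degree p + degree q) = 1" using that by (simp add: coeff_mult_degree_sum)
    moreover from this have "degree (p * q) = degree p + degree q"
      using degree_mult_le[of p q] le_degree[of "p * q" "degree p + degree q"] by force
    ultimately show ?thesis by simp
  qed
  have power: "lead_coeff ([:- t \<alpha>, 1:] ^ n) = 1 \<and> degree ([:- t \<alpha>, 1:] ^ n) = n" for \<alpha> n
  proof (induction n)
    case (Suc n)
    have lin: "lead_coeff [:- t \<alpha>, 1:] = 1" "degree [:- t \<alpha>, 1:] = 1" by simp_all
    show ?case
      unfolding power_Suc using mult[OF lin(1), of "[:- t \<alpha>, 1:] ^ n"] Suc lin(2) by linarith
  qed simp
  show ?thesis using assms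
  proof (induction A rule: finite_induct)
    case (insert \<beta> A)
    note p = power[of \<beta> "e \<beta>"]
    have m: "lead_coeff ([:- t \<beta>, 1:] ^ e \<beta> * (\<Prod>\<alpha>\<in>A. [:- t \<alpha>, 1:] ^ e \<alpha>)) = 1 \<and>
        degree ([:- t \<beta>, 1:] ^ e \<beta> * (\<Prod>\<alpha>\<in>A. [:- t \<alpha>, 1:] ^ e \<alpha>)) =
        degree ([:- t \<beta>, 1:] ^ e \<beta>) + degree (\<Prod>\<alpha>\<in>A. [:- t \<alpha>, 1:] ^ e \<alpha>)"
      using p insert.IH by (intro mult) blast+
    show ?case
      unfolding prod.insert[OF insert.hyps] sum.insert[OF insert.hyps]
      using m p insert.IH by metis
  qed simp
qed

text \<open>
  If \<open>g\<close> does not involve \<open>\<epsilon>\<^sub>b\<close>, then, as a polynomial in \<open>\<epsilon>\<^sub>b\<close>, the product \<open>g \<cdot> \<Prod>\<^bsub>u \<in> A\<^esub> (\<epsilon>\<^sub>b - \<epsilon>\<^sub>u)\<close>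
  has degree at most \<open>card A\<close> and the coefficient \<open>g\<close> in that degree.
\<close>

lemma lookup_prod_PVar_diff:
  fixes g :: "('v, 'r::comm_ring_1) mpoly"
  assumes "b \<notin> pvars g" "finite A" "b \<notin> A"
  shows "(\<forall>m. Poly_Mapping.lookup (g * (\<Prod>u\<in>A. PVar b - PVar u)) m \<noteq> 0 \<longrightarrow>
        Poly_Mapping.lookup m b \<le> card A) \<and>
    (\<forall>m. Poly_Mapping.lookup m b = 0 \<longrightarrow>
        Poly_Mapping.lookup (g * (\<Prod>u\<in>A. PVar b - PVar u)) (Poly_Mapping.single b (card A) + m) =
        Poly_Mapping.lookup g m)"
  using assms(2,3)
proof (induction A rule: finite_induct)
  case empty
  have "Poly_Mapping.lookup m b = 0" if "Poly_Mapping.lookup g m \<noteq> 0" for m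
    using that assms(1) by (auto simp: pvars_def in_keys_iff)
  then show ?case by simp
next
  case (insert a A)
  define q where "q = g * (\<Prod>u\<in>A. PVar b - PVar u)"
  have ab: "a \<noteq> b" using insert.prems by auto
  have IH1: "Poly_Mapping.lookup m b \<le> card A" if "Poly_Mapping.lookup q m \<noteq> 0" for m
    using insert that by (simp add: q_def)
  have IH2: "Poly_Mapping.lookup q (Poly_Mapping.single b (card A) + m) = Poly_Mapping.lookup g m"
    if "Poly_Mapping.lookup m b = 0" for m
    using insert that by (simp add: q_def)
  have eq: "g * (\<Prod>u\<in>insert a A. PVar b - PVar u) = PVar b * q - PVar a * q"
    using insert.hyps by (simp add: q_def algebra_simps)
  have shift: "\<exists>m'. m = Poly_Mapping.single v 1 + m' \<and> Poly_Mapping.lookup q m' \<noteq> 0"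
    if "Poly_Mapping.lookup (PVar v * q) m \<noteq> 0" for v m
  proof -
    have "Poly_Mapping.lookup m v \<noteq> 0" using that lookup_PVar_mult_eq_0[of m v q] by blast
    then have m: "m = Poly_Mapping.single v 1 + (m - Poly_Mapping.single v 1)"
      by (intro poly_mapping_eqI) (auto simp: lookup_add lookup_minus lookup_single when_def)
    then have "Poly_Mapping.lookup q (m - Poly_Mapping.single v 1) \<noteq> 0"
      using that lookup_PVar_mult[of v q "m - Poly_Mapping.single v 1"] by metis
    then show ?thesis using m by blast
  qed
  have ba: "Poly_Mapping.lookup m b \<le> card A" if "Poly_Mapping.lookup (PVar a * q) m \<noteq> 0" for m
    using shift[OF that] IH1 ab by (auto simp: lookup_add lookup_single when_def)
  have bb: "Poly_Mapping.lookup m b \<le> Suc (card A)" if "Poly_Mapping.lookup (PVar b * q) m \<noteq> 0" for m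
    using shift[OF that] IH1 by (auto simp: lookup_add lookup_single when_def)
  have card: "card (insert a A) = Suc (card A)" using insert.hyps by simp
  show ?case
    unfolding eq card
  proof (intro conjI allI impI)
    fix m :: "'v \<Rightarrow>\<^sub>0 nat"
    assume "Poly_Mapping.lookup (PVar b * q - PVar a * q) m \<noteq> 0"
    then have "Poly_Mapping.lookup (PVar b * q) m \<noteq> 0 \<or> Poly_Mapping.lookup (PVar a * q) m \<noteq> 0"
      by (auto simp: lookup_minus)
    then show "Poly_Mapping.lookup m b \<le> Suc (card A)" using ba bb le_SucI by blast
  next
    fix m :: "'v \<Rightarrow>\<^sub>0 nat"
    assume m: "Poly_Mapping.lookup m b = 0"
    let ?m = "Poly_Mapping.single b (Suc (card A)) + m"
    have "Poly_Mapping.lookup (PVar a * q) ?m = 0"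
      using ba[of ?m] m by (auto simp: lookup_add)
    moreover have "?m = Poly_Mapping.single b 1 + (Poly_Mapping.single b (card A) + m)"
      by (simp add: add.assoc[symmetric] single_add[symmetric])
    then have "Poly_Mapping.lookup (PVar b * q) ?m = Poly_Mapping.lookup g m"
      using lookup_PVar_mult[of b q] IH2[OF m] by metis
    ultimately show "Poly_Mapping.lookup (PVar b * q - PVar a * q) ?m = Poly_Mapping.lookup g m"
      by (simp add: lookup_minus)
  qed
qed

lemma prod_PVar_diff_notin:
  assumes "g \<notin> jet_ideal P w" "b \<notin> pvars g" "finite A" "b \<notin> A" "card A < w b" "0 \<in> P"
  shows "g * (\<Prod>u\<in>A. PVar b - PVar u) \<notin> jet_ideal P w"
proof -
  obtain m where m: "\<And>i. Poly_Mapping.lookup m i < w i" "Poly_Mapping.lookup g m \<notin> P"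
    using assms(1) by (auto simp: jet_ideal_def)
  then have "Poly_Mapping.lookup g m \<noteq> 0" using assms(6) by metis
  then have mb: "Poly_Mapping.lookup m b = 0"
    using assms(2) by (auto simp: pvars_def in_keys_iff)
  let ?m = "Poly_Mapping.single b (card A) + m"
  have "Poly_Mapping.lookup ?m i < w i" for i
    using m(1)[of i] mb assms(5) by (auto simp: lookup_add lookup_single when_def)
  moreover have "Poly_Mapping.lookup (g * (\<Prod>u\<in>A. PVar b - PVar u)) ?m \<notin> P"
    using lookup_prod_PVar_diff[OF assms(2-4)] mb m(2) by simp
  ultimately show ?thesis by (auto simp: jet_ideal_def)
qed

lemma pvars_vandermonde:
  "pvars (vandermonde PVar A :: ('v::linorder, 'r::comm_ring_1) mpoly) \<subseteq> A"
  unfolding vandermonde_def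
proof (intro pvars_prod)
  fix v u assume "v \<in> A" "u \<in> {u \<in> A. u < v}"
  then show "pvars (PVar v - PVar u :: ('v, 'r) mpoly) \<subseteq> A"
    using pvars_add[of "PVar v" "- PVar u :: ('v, 'r) mpoly"]
    by (auto simp: pvars_uminus pvars_PVar)
qed

text \<open>
  Multiplying by the Vandermonde product in new variables \<open>F\<close> does not lead into the ideal if
  \<open>card F \<le> w v\<close> for these variables: the largest index \<open>b\<close> contributes \<open>\<epsilon>\<^sub>b\<close> to the power \<open>card F - 1\<close>.
\<close>

lemma vandermonde_notin:
  fixes g :: "('v::linorder, 'r::comm_ring_1) mpoly"
  assumes "finite F" "g \<notin> jet_ideal P w" "pvars g \<inter> F = {}" "\<And>v. v \<in> F \<Longrightarrow> card F \<le> w v" "0 \<in> P"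
  shows "g * vandermonde PVar F \<notin> jet_ideal P w"
  using assms
proof (induction F rule: finite_linorder_max_induct)
  case empty
  then show ?case by (simp add: vandermonde_def)
next
  case (insert b A)
  have bA: "b \<notin> A" using insert.hyps by blast
  have "card A \<le> w v" if "v \<in> A" for v
    using insert.prems(3)[of v] that insert.hyps(1) bA by simp
  then have IH: "g * vandermonde PVar A \<notin> jet_ideal P w"
    using insert.prems by (intro insert.IH) auto
  have "b \<notin> pvars (g * vandermonde PVar A)"
    using insert.prems(2) bA pvars_mult[of g "vandermonde PVar A"]
      pvars_vandermonde[of A, where ?'r = 'r] by blast
  moreover have "card A < w b"
    using insert.prems(3)[of b] insert.hyps(1) bA by simp
  ultimately have "(g * vandermonde PVar A) * (\<Prod>u\<in>A. PVar b - PVar u) \<notin> jet_ideal P w"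
    using insert.hyps(1) bA IH insert.prems(4) by (intro prod_PVar_diff_notin)
  then show ?case
    using insert.hyps by (simp add: vandermonde_insert_max mult.assoc)
qed

lemma prod_vandermonde_notin:
  fixes P :: "'r::comm_ring_1 set" and FF :: "nat set set"
  assumes "finite FF" "type_prime P" "\<And>i. 0 < w i" "disjoint FF"
    and "\<And>F. F \<in> FF \<Longrightarrow> finite F" "\<And>F v. F \<in> FF \<Longrightarrow> v \<in> F \<Longrightarrow> card F \<le> w v"
  shows "(\<Prod>F\<in>FF. vandermonde PVar F) \<notin> jet_ideal P w"
  using assms(1,4-)
proof (induction FF rule: finite_induct)
  case empty
  have "Poly_Mapping.lookup (1 :: (nat, 'r) mpoly) 0 \<notin> P"
    using type_prime.one_notin[OF assms(2)] by simp
  then show ?case using assms(3) by (auto simp: jet_ideal_def intro!: exI[of _ 0])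
next
  case (insert F FF)
  let ?g = "\<Prod>F\<in>FF. vandermonde PVar F :: (nat, 'r) mpoly"
  have "pvars ?g \<subseteq> \<Union>FF"
  proof (intro pvars_prod)
    fix G assume "G \<in> FF"
    then show "pvars (vandermonde PVar G :: (nat, 'r) mpoly) \<subseteq> \<Union>FF"
      using pvars_vandermonde[of G] by blast
  qed
  moreover have "G \<inter> F = {}" if "G \<in> FF" for G
    using insert.prems(1) insert.hyps(2) that by (auto simp: disjoint_def)
  ultimately have disj: "pvars ?g \<inter> F = {}" by blast
  have "disjoint FF" using insert.prems(1) by (rule pairwise_subset) blast
  then have "?g \<notin> jet_ideal P w" using insert.prems by (intro insert.IH) auto
  then have "?g * vandermonde PVar F \<notin> jet_ideal P w"
    using insert.prems disj type_ideal.zero_mem[OF type_prime.axioms(1)[OF assms(2)]]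
    by (intro vandermonde_notin) auto
  then show ?case using insert.hyps by (simp add: mult.commute)
qed

section \<open>Separating polynomials\<close>

lemma ex_disjoint_subsets:
  assumes "infinite S" "0 < d"
  shows "\<exists>FF. finite FF \<and> card FF = n \<and> disjoint FF \<and> (\<forall>F\<in>FF. finite F \<and> F \<subseteq> S \<and> card F = d)"
proof (induction n)
  case 0
  show ?case by (rule exI[of _ "{}"]) (simp add: disjoint_def)
next
  case (Suc n)
  then obtain FF where FF: "finite FF" "card FF = n" "disjoint FF"
    "\<forall>F\<in>FF. finite F \<and> F \<subseteq> S \<and> card F = d" by blast
  have "infinite (S - \<Union>FF)" using assms(1) FF by (intro Diff_infinite_finite) auto
  then obtain F where F: "F \<subseteq> S - \<Union>FF" "finite F" "card F = d"
    using infinite_arbitrarily_large by metis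
  have "F \<noteq> {}" using F(3) assms(2) by auto
  then have notin: "F \<notin> FF" using F(1) by blast
  have "disjoint (insert F FF)" using FF(3) F(1) by (auto simp: disjoint_def)
  then show ?case using FF F notin by (intro exI[of _ "insert F FF"]) auto
qed

text \<open>
  If \<open>\<sigma> (s \<alpha>)\<close> lies in the block \<open>\<psi> \<alpha>\<close>, then \<open>g\<close> in the variables \<open>\<xi>\<^bsub>s \<alpha>\<^esub>\<close> evaluates to \<open>g\<close> at the
  point \<open>t\<^bsub>\<psi> \<alpha>\<^esub>\<close>, up to the nilpotents \<open>\<epsilon>\<close>.
\<close>

lemma jet_eval_section:
  assumes "finite E" "pvars g \<subseteq> E" "\<And>\<alpha>. \<alpha> \<in> E \<Longrightarrow> part_index U (\<sigma> (s \<alpha>)) = \<psi> \<alpha>"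
  shows "\<exists>c. jet_eval U \<sigma> (peval PConst (\<lambda>\<alpha>. PVar (s \<alpha>)) g) =
    PConst (to_conf (peval PConst (\<lambda>\<alpha>. PVar (\<psi> \<alpha>)) g)) + (\<Sum>\<alpha>\<in>E. c \<alpha> * PVar (\<sigma> (s \<alpha>)))"
proof -
  let ?h = "\<lambda>c. PConst (to_conf (PConst c))"
  let ?x = "\<lambda>\<alpha>. PConst (to_conf (PVar (part_index U (\<sigma> (s \<alpha>))))) + PVar (\<sigma> (s \<alpha>))"
  let ?x' = "\<lambda>\<alpha>. PConst (to_conf (PVar (\<psi> \<alpha>)))"
  have 1: "jet_eval U \<sigma> (peval PConst (\<lambda>\<alpha>. PVar (s \<alpha>)) g) = peval ?h ?x g"
    by (rule rhom_eqI[where E = UNIV and ?h1.0 = "\<lambda>g. jet_eval U \<sigma> (peval PConst (\<lambda>\<alpha>. PVar (s \<alpha>)) g)",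
          OF rhom_comp[OF rhom_jet_eval rhom_peval[OF rhom_PConst]] rhom_peval[OF rhom_jet_eval_const]])
      (simp_all add: jet_eval_def peval_PConst peval_PVar rhom_PConst rhom_jet_eval_const)
  have 2: "PConst (to_conf (peval PConst (\<lambda>\<alpha>. PVar (\<psi> \<alpha>)) g)) = peval ?h ?x' g"
    by (rule rhom_eqI[where E = UNIV and
            ?h1.0 = "\<lambda>g. PConst (to_conf (peval PConst (\<lambda>\<alpha>. PVar (\<psi> \<alpha>)) g))",
          OF rhom_comp[OF rhom_comp[OF rhom_PConst rhom_to_conf] rhom_peval[OF rhom_PConst]]
            rhom_peval[OF rhom_jet_eval_const]])
      (simp_all add: peval_PConst peval_PVar rhom_PConst rhom_jet_eval_const)
  obtain c where c: "peval ?h ?x g = peval ?h ?x' g + (\<Sum>\<alpha>\<in>E. c \<alpha> * (?x \<alpha> - ?x' \<alpha>))"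
    using peval_diff_ex[OF rhom_jet_eval_const assms(1,2), of ?x ?x'] by blast
  have "(\<Sum>\<alpha>\<in>E. c \<alpha> * (?x \<alpha> - ?x' \<alpha>)) = (\<Sum>\<alpha>\<in>E. c \<alpha> * PVar (\<sigma> (s \<alpha>)))"
    using assms(3) by (intro sum.cong) simp_all
  with c have "peval ?h ?x g = peval ?h ?x' g + (\<Sum>\<alpha>\<in>E. c \<alpha> * PVar (\<sigma> (s \<alpha>)))"
    by (rule trans[OF _ arg_cong])
  then show ?thesis unfolding 1 2 by (intro exI[of _ c])
qed

lemma set_size_Un_le: "set_size (S \<union> T) \<le> set_size S + set_size T"
  using card_Un_le[of S T] by (cases "finite S"; cases "finite T") (simp_all add: set_size_def)

lemma set_size_UN_le:
  assumes "finite A"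
  shows "set_size (\<Union>\<alpha>\<in>A. U \<alpha>) \<le> (\<Sum>\<alpha>\<in>A. set_size (U \<alpha>))"
  using assms
proof (induction A rule: finite_induct)
  case empty
  then show ?case by (simp add: set_size_def zero_enat_def)
next
  case (insert \<beta> A)
  have "set_size (\<Union>\<alpha>\<in>insert \<beta> A. U \<alpha>) \<le> set_size (U \<beta>) + set_size (\<Union>\<alpha>\<in>A. U \<alpha>)"
    using set_size_Un_le[of "U \<beta>" "\<Union>\<alpha>\<in>A. U \<alpha>"] by simp
  also have "\<dots> \<le> set_size (U \<beta>) + (\<Sum>\<alpha>\<in>A. set_size (U \<alpha>))"
    using insert.IH by (rule add_left_mono)
  finally show ?case using insert.hyps by simp
qed

lemma set_size_inj_le:
  assumes "inj_on f S" "f ` S \<subseteq> T"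
  shows "set_size S \<le> set_size T"
proof (cases "finite T")
  case True
  then have "finite S" using assms by (meson finite_imageD finite_subset)
  then show ?thesis using card_inj_on_le[OF assms True] True by (simp add: set_size_def)
qed (simp add: set_size_def)

text \<open>
  The inclusion of ideals implies the inclusion of loci: a point \<open>Q\<close> of \<open>Y\<close> outside the locus
  yields the separating polynomial \<open>f = \<Delta> ^ K * (\<Gamma> ^ K * W)\<close>.
\<close>

theorem subset_Theta_of_PP_subset:
  fixes lam :: "'i::finite \<Rightarrow> enat" and mu :: "'k::finite \<Rightarrow> enat"
    and Z :: "('i, 'a::comm_ring_1) conf_ring set set"
  assumes e: "weighting e" and d: "weighting d"
    and U: "partition_of_type lam U" and V: "partition_of_type mu V"
    and Z: "Z \<subseteq> topspace conf_space" and Y: "Y \<subseteq> topspace conf_space"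
    and sub: "PP e U Z \<subseteq> PP d V Y"
  shows "Y \<subseteq> Theta mu d lam e Z"
proof (rule ccontr)
  assume "\<not> Y \<subseteq> Theta mu d lam e Z"
  then obtain Q where Q: "Q \<in> Y" "Q \<notin> Theta mu d lam e Z" by blast
  then have QY: "Q \<in> topspace conf_space" using Y by blast
  interpret Q: type_prime Q by (rule type_prime_conf_space) (rule QY)
  define \<rho> where "\<rho> = part_index V"
  define J where "J = (jet_ideal Q (\<lambda>i. d (\<rho> i)) :: (nat, ('k, 'a) conf_ring) mpoly set)"
  interpret J: type_ideal J unfolding J_def by (rule type_ideal_jet_ideal) (rule Q.type_ideal_axioms)
  have J_PVar: "PVar i ^ d (\<rho> i) \<in> J" for i
    unfolding J_def by (rule PVar_power_in_jet_ideal) (simp_all add: Q.type_ideal_axioms)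

  define G where "G = {p. good_pair mu d lam e (fst p) (snd p)}"
  \<comment> \<open>For each good pair \<open>p\<close>, \<open>g p\<close> vanishes on \<open>Z\<close> but not at the image of \<open>Q\<close>.\<close>
  have "\<exists>g. pvars g \<subseteq> fst p \<and> (\<forall>P\<in>Z. to_conf g \<in> P) \<and>
      to_conf (peval PConst (\<lambda>\<alpha>. PVar (snd p \<alpha>)) g) \<notin> Q" if "p \<in> G" for p
  proof -
    have "Q \<notin> Theta_pair (fst p) (snd p) Z"
      using Q(2) that by (auto simp: Theta_def G_def)
    then show ?thesis using Theta_pair_iff[OF Z QY] by blast
  qed
  then have "\<forall>p\<in>G. \<exists>g. pvars g \<subseteq> fst p \<and> (\<forall>P\<in>Z. to_conf g \<in> P) \<and>
      to_conf (peval PConst (\<lambda>\<alpha>. PVar (snd p \<alpha>)) g) \<notin> Q" ..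
  from bchoice[OF this] obtain g where g: "\<And>p. p \<in> G \<Longrightarrow> pvars (g p) \<subseteq> fst p"
    "\<And>p P. p \<in> G \<Longrightarrow> P \<in> Z \<Longrightarrow> to_conf (g p) \<in> P"
    "\<And>p. p \<in> G \<Longrightarrow> to_conf (peval PConst (\<lambda>\<alpha>. PVar (snd p \<alpha>)) (g p)) \<notin> Q" by blast

  define T where "T = (\<Union>\<alpha>\<in>{\<alpha>. lam \<alpha> \<noteq> \<infinity>}. U \<alpha>)"
  have sizeU: "set_size (U \<alpha>) = lam \<alpha>" for \<alpha> using U by (simp add: partition_of_type_def)
  have sizeV: "set_size (V \<beta>) = mu \<beta>" for \<beta> using V by (simp add: partition_of_type_def)
  have finU: "finite (U \<alpha>)" if "lam \<alpha> \<noteq> \<infinity>" for \<alpha>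
    using sizeU[of \<alpha>] that by (auto simp: set_size_def split: if_splits)
  have finV: "finite (V \<beta>) \<longleftrightarrow> mu \<beta> \<noteq> \<infinity>" for \<beta>
    using sizeV[of \<beta>, symmetric] by (simp add: set_size_def)
  have finT: "finite T" unfolding T_def using finU by auto
  \<comment> \<open>In each infinite block \<open>\<beta>\<close>, choose more disjoint groups of \<open>d \<beta>\<close> indices than the finite
    blocks of \<open>U\<close> have elements: for every permutation some group avoids these blocks.\<close>
  have "\<exists>FF. finite FF \<and> card FF = Suc (card T) \<and> disjoint FF \<and>
      (\<forall>F\<in>FF. finite F \<and> F \<subseteq> V \<beta> \<and> card F = d \<beta>)" if "\<beta> \<in> {\<beta>. mu \<beta> = \<infinity>}" for \<beta>
    using that finV[of \<beta>] d by (intro ex_disjoint_subsets) (auto simp: weighting_def Suc_le_eq)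
  then have "\<forall>\<beta>\<in>{\<beta>. mu \<beta> = \<infinity>}. \<exists>FF. finite FF \<and> card FF = Suc (card T) \<and> disjoint FF \<and>
      (\<forall>F\<in>FF. finite F \<and> F \<subseteq> V \<beta> \<and> card F = d \<beta>)" ..
  from bchoice[OF this] obtain FF where FF: "\<And>\<beta>. mu \<beta> = \<infinity> \<Longrightarrow> finite (FF \<beta>)"
    "\<And>\<beta>. mu \<beta> = \<infinity> \<Longrightarrow> card (FF \<beta>) = Suc (card T)"
    "\<And>\<beta>. mu \<beta> = \<infinity> \<Longrightarrow> disjoint (FF \<beta>)"
    "\<And>\<beta> F. mu \<beta> = \<infinity> \<Longrightarrow> F \<in> FF \<beta> \<Longrightarrow> finite F"
    "\<And>\<beta> F. mu \<beta> = \<infinity> \<Longrightarrow> F \<in> FF \<beta> \<Longrightarrow> F \<subseteq> V \<beta>"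
    "\<And>\<beta> F. mu \<beta> = \<infinity> \<Longrightarrow> F \<in> FF \<beta> \<Longrightarrow> card F = d \<beta>" by blast
  define AA where "AA = (\<Union>\<beta>\<in>{\<beta>. mu \<beta> = \<infinity>}. FF \<beta>)"
  have finAA: "finite AA" unfolding AA_def using FF(1) by auto
  have \<rho>V: "\<rho> i = \<beta> \<longleftrightarrow> i \<in> V \<beta>" for i \<beta> unfolding \<rho>_def by (rule part_index_eq[OF V])
  have disjAA: "disjoint AA"
  proof (rule disjointI)
    fix F F' assume "F \<in> AA" "F' \<in> AA" and ne: "F \<noteq> F'"
    then obtain \<beta> \<beta>' where F: "mu \<beta> = \<infinity>" "F \<in> FF \<beta>" and F': "mu \<beta>' = \<infinity>" "F' \<in> FF \<beta>'"
      by (auto simp: AA_def)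
    show "F \<inter> F' = {}"
    proof (cases "\<beta> = \<beta>'")
      case True
      then show ?thesis using FF(3)[OF F(1)] F F' ne by (auto simp: disjoint_def)
    next
      case False
      have "F \<subseteq> V \<beta>" "F' \<subseteq> V \<beta>'" using F F' FF(5) by blast+
      then have "\<rho> x = \<beta>" "\<rho> x = \<beta>'" if "x \<in> F" "x \<in> F'" for x
        using that \<rho>V by blast+
      then show ?thesis using False by blast
    qed
  qed
  define B where "B = (\<Union>\<beta>\<in>{\<beta>. mu \<beta> \<noteq> \<infinity>}. V \<beta>) \<union> \<Union>AA"
  have "finite (\<Union>\<beta>\<in>{\<beta>. mu \<beta> \<noteq> \<infinity>}. V \<beta>)" using finV by (intro finite_UN_I) auto
  moreover have "finite (\<Union>AA)"
    using finAA FF(4) by (intro finite_Union) (auto simp: AA_def)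
  ultimately have finB: "finite B" by (simp add: B_def)

  \<comment> \<open>\<open>K\<close> bounds the orders of nilpotency over \<open>Z\<close>, also of \<open>\<epsilon>\<^sub>i - \<epsilon>\<^sub>j\<close>; \<open>sec p\<close> are the choices of
    one variable for each element of the first component of \<open>p\<close>.\<close>
  define K where "K = 2 * Suc (sum e UNIV)"
  define sec where "sec p = {s \<in> PiE (fst p) (\<lambda>_. B). \<forall>\<alpha>\<in>fst p. \<rho> (s \<alpha>) = snd p \<alpha>}"
    for p :: "'i set \<times> ('i \<Rightarrow> 'k)"
  define D where "D = {(i, j) \<in> B \<times> B. \<rho> i \<noteq> \<rho> j}"
  define \<Delta> where "\<Delta> = (\<Prod>(i, j)\<in>D. PVar i - PVar j :: (nat, 'a) mpoly)"
  define \<Gamma> where "\<Gamma> = (\<Prod>(p, s)\<in>Sigma G sec. peval PConst (\<lambda>\<alpha>. PVar (s \<alpha>)) (g p))"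
  define W where "W = (\<Prod>F\<in>AA. vandermonde PVar F :: (nat, 'a) mpoly)"
  define f where "f = \<Delta> ^ K * (\<Gamma> ^ K * W)"
  have finD: "finite D" using finB by (intro finite_subset[of D "B \<times> B"]) (auto simp: D_def)
  have finG: "finite G" by simp
  have finsec: "finite (sec p)" for p
    unfolding sec_def using finB by (intro finite_subset[OF Collect_restrict] finite_PiE) simp_all
  have finS: "finite (Sigma G sec)" using finG finsec by blast

  have "f \<in> PP e U Z"
    unfolding mem_PP_iff[OF Z]
  proof (intro ballI)
    fix P and \<sigma> :: "nat \<Rightarrow> nat" assume P: "P \<in> Z" and \<sigma>: "\<sigma> \<in> fin_perms"
    have PZ: "P \<in> topspace conf_space" using P Z by blast
    interpret P: type_prime P by (rule type_prime_conf_space) (rule PZ)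
    define I where "I = (jet_ideal P (\<lambda>i. e (part_index U i)) :: (nat, ('i, 'a) conf_ring) mpoly set)"
    interpret I: type_ideal I
      unfolding I_def by (rule type_ideal_jet_ideal) (rule P.type_ideal_axioms)
    interpret ev: rhom "jet_eval U \<sigma> :: (nat, 'a) mpoly \<Rightarrow> _" by (rule rhom_jet_eval)
    have I_PVar: "PVar i ^ e (part_index U i) \<in> I" for i
      unfolding I_def by (rule PVar_power_in_jet_ideal) (simp_all add: P.type_ideal_axioms)
    define q where "q i = part_index U (\<sigma> i)" for i
    have f: "jet_eval U \<sigma> f = jet_eval U \<sigma> \<Delta> ^ K * (jet_eval U \<sigma> \<Gamma> ^ K * jet_eval U \<sigma> W)"
      by (simp add: f_def ev.hom_mult ev.hom_power)
    have ev_PVar: "jet_eval U \<sigma> (PVar i) = PConst (to_conf (PVar (q i))) + PVar (\<sigma> i)" for i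
      by (simp add: jet_eval_PVar q_def)
    have "jet_eval U \<sigma> f \<in> I"
    proof (cases "\<exists>i\<in>B. \<exists>j\<in>B. \<rho> i \<noteq> \<rho> j \<and> q i = q j")
      case True
      then obtain i j where ij: "(i, j) \<in> D" "q i = q j" by (auto simp: D_def)
      have "(PVar (\<sigma> i) - PVar (\<sigma> j)) ^ (e (q i) + e (q j)) \<in> I"
        using I_PVar[of "\<sigma> i"] I_PVar[of "\<sigma> j"] by (intro I.power_diff_mem) (simp_all add: q_def)
      moreover have "e (q i) \<le> sum e UNIV" "e (q j) \<le> sum e UNIV" by (simp_all add: member_le_sum)
      ultimately have "(PVar (\<sigma> i) - PVar (\<sigma> j)) ^ K \<in> I"
        by (elim I.power_mem_mono) (simp add: K_def)
      then have "jet_eval U \<sigma> (PVar i - PVar j) ^ K \<in> I"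
        by (simp add: ev.hom_diff ev_PVar ij(2))
      then have "(\<Prod>(i, j)\<in>D. jet_eval U \<sigma> (PVar i - PVar j) ^ K) \<in> I"
        using finD ij(1) by (intro I.prod_mem[of _ "(i, j)"]) auto
      then have "jet_eval U \<sigma> \<Delta> ^ K \<in> I"
        by (simp add: \<Delta>_def ev.hom_prod prod_power_distrib case_prod_beta)
      then show ?thesis unfolding f by (rule I.mult_mem_left)
    next
      case False
      \<comment> \<open>Indices in \<open>B\<close> with the same \<open>q\<close> lie in the same block of \<open>V\<close>, so \<open>\<rho>\<close> factors through \<open>q\<close> as \<open>\<phi> \<circ> q\<close>.\<close>
      define s where "s \<alpha> = (if \<alpha> \<in> q ` B then SOME i. i \<in> B \<and> q i = \<alpha> else undefined)" for \<alpha>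
      define \<phi> where "\<phi> \<alpha> = \<rho> (s \<alpha>)" for \<alpha>
      have s: "s \<alpha> \<in> B" "q (s \<alpha>) = \<alpha>" if "\<alpha> \<in> q ` B" for \<alpha>
      proof -
        have "\<exists>i. i \<in> B \<and> q i = \<alpha>" using that by blast
        from someI_ex[OF this] show "s \<alpha> \<in> B" "q (s \<alpha>) = \<alpha>" using that by (simp_all add: s_def)
      qed
      have \<phi>: "\<phi> (q i) = \<rho> i" if "i \<in> B" for i
        using False s[of "q i"] that by (auto simp: \<phi>_def)
      show ?thesis
      proof (cases "good_pair mu d lam e (q ` B) \<phi>")
        case True
        then have p: "(q ` B, \<phi>) \<in> G" by (simp add: G_def)
        have sec: "s \<in> sec (q ` B, \<phi>)"
          using s by (auto simp: sec_def \<phi>_def s_def)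
        let ?E = "q ` B" and ?g = "g (q ` B, \<phi>)"
        obtain c where c: "jet_eval U \<sigma> (peval PConst (\<lambda>\<alpha>. PVar (s \<alpha>)) ?g) =
            PConst (to_conf (peval PConst (\<lambda>\<alpha>. PVar \<alpha>) ?g)) + (\<Sum>\<alpha>\<in>?E. c \<alpha> * PVar (\<sigma> (s \<alpha>)))"
          using jet_eval_section[of ?E ?g U \<sigma> s "\<lambda>\<alpha>. \<alpha>"] g(1)[OF p] s(2) finB by (auto simp: q_def)
        have "(PConst (to_conf ?g) + (\<Sum>\<alpha>\<in>?E. c \<alpha> * PVar (\<sigma> (s \<alpha>)))) ^ Suc (sum e ?E) \<in> I"
        proof (rule I.power_add_sum_mem)
          show "finite ?E" using finB by simp
          show "PConst (to_conf ?g) \<in> I"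
            unfolding I_def using P.type_ideal_axioms g(2)[OF p P] by (rule PConst_in_jet_ideal)
          show "PVar (\<sigma> (s \<alpha>)) ^ e \<alpha> \<in> I" if "\<alpha> \<in> ?E" for \<alpha>
            using I_PVar[of "\<sigma> (s \<alpha>)"] s(2)[OF that] by (simp add: q_def)
        qed
        moreover have "Suc (sum e ?E) \<le> K"
          using sum_mono2[of UNIV ?E e] by (simp add: K_def)
        ultimately have "jet_eval U \<sigma> (peval PConst (\<lambda>\<alpha>. PVar (s \<alpha>)) ?g) ^ K \<in> I"
          unfolding c peval_PConst_PVar by (rule I.power_mem_mono)
        then have "(\<Prod>(p, s)\<in>Sigma G sec. jet_eval U \<sigma> (peval PConst (\<lambda>\<alpha>. PVar (s \<alpha>)) (g p)) ^ K) \<in> I"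
          using finS p sec by (intro I.prod_mem[of _ "((q ` B, \<phi>), s)"]) auto
        then have "jet_eval U \<sigma> \<Gamma> ^ K \<in> I"
          by (simp add: \<Gamma>_def ev.hom_prod prod_power_distrib case_prod_beta)
        then show ?thesis unfolding f by (intro I.mult_mem[of "_ * _"] I.mult_mem_left)
      next
        case False
        have inj: "inj_on \<sigma> S" for S using inj_fin_perm[OF \<sigma>] by (rule inj_on_subset) simp
        \<comment> \<open>Groups are disjoint, so elements that go to finite blocks are distinct elements of \<open>T\<close>.\<close>
        have big: "\<exists>F\<in>FF \<beta>. \<forall>v\<in>F. lam (q v) = \<infinity>" if \<beta>: "mu \<beta> = \<infinity>" for \<beta>
        proof (rule ccontr)
          assume "\<not> ?thesis"
          then have "\<forall>F\<in>FF \<beta>. \<exists>v. v \<in> F \<and> lam (q v) \<noteq> \<infinity>" by blast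
          from bchoice[OF this] obtain v where v: "\<And>F. F \<in> FF \<beta> \<Longrightarrow> v F \<in> F"
            "\<And>F. F \<in> FF \<beta> \<Longrightarrow> lam (q (v F)) \<noteq> \<infinity>" by blast
          have "inj_on (\<lambda>F. \<sigma> (v F)) (FF \<beta>)"
          proof (rule inj_onI)
            fix F F' assume F: "F \<in> FF \<beta>" "F' \<in> FF \<beta>" "\<sigma> (v F) = \<sigma> (v F')"
            then have "v F = v F'" using inj[of UNIV] by (auto dest: injD)
            then have "F \<inter> F' \<noteq> {}" using v(1)[OF F(1)] v(1)[OF F(2)] by auto
            then show "F = F'" using FF(3)[OF \<beta>] F by (auto simp: disjoint_def)
          qed
          moreover have "(\<lambda>F. \<sigma> (v F)) ` FF \<beta> \<subseteq> T"
            using v(2) part_index_eq[OF U, of "\<sigma> _"] by (fastforce simp: T_def q_def)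
          ultimately have "card (FF \<beta>) \<le> card T" using finT by (rule card_inj_on_le)
          then show False using FF(2)[OF \<beta>] by simp
        qed
        have FB: "F \<subseteq> B" if "mu \<beta> = \<infinity>" "F \<in> FF \<beta>" for \<beta> F
          using that by (auto simp: B_def AA_def)
        \<comment> \<open>Condition (G1) holds, so (G2) fails.\<close>
        have "mu \<beta> \<le> (\<Sum>\<alpha> | \<alpha> \<in> q ` B \<and> \<phi> \<alpha> = \<beta>. lam \<alpha>)" for \<beta>
        proof (cases "mu \<beta> = \<infinity>")
          case True
          then obtain F where F: "F \<in> FF \<beta>" "\<forall>v\<in>F. lam (q v) = \<infinity>" using big by blast
          have "card F \<noteq> 0" using FF(6)[OF True F(1)] d by (auto simp: weighting_def dest: spec[of _ \<beta>])
          then obtain v where v: "v \<in> F" by fastforce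
          then have "v \<in> B" "\<rho> v = \<beta>" using FB[OF True F(1)] FF(5)[OF True F(1)] \<rho>V by auto
          then have "q v \<in> {\<alpha>. \<alpha> \<in> q ` B \<and> \<phi> \<alpha> = \<beta>}" using \<phi> by auto
          then have "lam (q v) \<le> (\<Sum>\<alpha> | \<alpha> \<in> q ` B \<and> \<phi> \<alpha> = \<beta>. lam \<alpha>)"
            by (intro member_le_sum) auto
          moreover have "lam (q v) = \<infinity>" using F(2) v by blast
          ultimately show ?thesis by simp
        next
          case False
          have VB: "V \<beta> \<subseteq> B" using False by (auto simp: B_def)
          have "set_size (V \<beta>) \<le> set_size (\<Union>\<alpha>\<in>{\<alpha>. \<alpha> \<in> q ` B \<and> \<phi> \<alpha> = \<beta>}. U \<alpha>)"
          proof (rule set_size_inj_le[OF inj])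
            show "\<sigma> ` V \<beta> \<subseteq> (\<Union>\<alpha>\<in>{\<alpha>. \<alpha> \<in> q ` B \<and> \<phi> \<alpha> = \<beta>}. U \<alpha>)"
            proof
              fix j assume "j \<in> \<sigma> ` V \<beta>"
              then obtain i where i: "i \<in> V \<beta>" "j = \<sigma> i" by blast
              then have "i \<in> B" "\<rho> i = \<beta>" using VB \<rho>V by auto
              then have "q i \<in> {\<alpha>. \<alpha> \<in> q ` B \<and> \<phi> \<alpha> = \<beta>}" using \<phi> by auto
              moreover have "j \<in> U (q i)" using part_index_eq[OF U] i(2) by (auto simp: q_def)
              ultimately show "j \<in> (\<Union>\<alpha>\<in>{\<alpha>. \<alpha> \<in> q ` B \<and> \<phi> \<alpha> = \<beta>}. U \<alpha>)" by blast
            qed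
          qed
          also have "\<dots> \<le> (\<Sum>\<alpha> | \<alpha> \<in> q ` B \<and> \<phi> \<alpha> = \<beta>. set_size (U \<alpha>))"
            by (rule set_size_UN_le) simp
          finally show ?thesis by (simp add: sizeU sizeV)
        qed
        then obtain \<beta> where \<beta>: "mu \<beta> = \<infinity>"
          "(\<Sum>\<alpha> | \<alpha> \<in> q ` B \<and> \<phi> \<alpha> = \<beta> \<and> lam \<alpha> = \<infinity>. e \<alpha>) < d \<beta>"
          using False by (auto simp: good_pair_def not_le)
        define A where "A = {\<alpha>. \<alpha> \<in> q ` B \<and> \<phi> \<alpha> = \<beta> \<and> lam \<alpha> = \<infinity>}"
        obtain F where F: "F \<in> FF \<beta>" "\<forall>v\<in>F. lam (q v) = \<infinity>" using big \<beta>(1) by blast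
        define t where "t \<alpha> = (PConst (to_conf (PVar \<alpha>)) :: (nat, ('i, 'a) conf_ring) mpoly)" for \<alpha>
        define h where "h = (\<Prod>\<alpha>\<in>A. [:- t \<alpha>, 1:] ^ e \<alpha>)"
        have h: "lead_coeff h = 1" "degree h = sum e A"
          using monic_prod_linear[OF finite[of A], of t e, folded h_def] by blast+
        have "vandermonde (\<lambda>v. t (q v) + PVar (\<sigma> v)) F \<in> I"
        proof (rule vandermonde_mem[OF I.type_ideal_axioms])
          show "finite F" by (rule FF(4)[OF \<beta>(1) F(1)])
          show "lead_coeff h = 1" by (rule h)
          show "degree h < card F" using \<beta>(2) FF(6)[OF \<beta>(1) F(1)] h(2) by (simp add: A_def)
          fix v assume v: "v \<in> F"
          then have "v \<in> B" "\<rho> v = \<beta>" using FB[OF \<beta>(1) F(1)] FF(5)[OF \<beta>(1) F(1)] \<rho>V by auto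
          then have qA: "q v \<in> A" using \<phi> F(2) v by (auto simp: A_def)
          have "(\<Prod>\<alpha>\<in>A. (t (q v) + PVar (\<sigma> v) - t \<alpha>) ^ e \<alpha>) \<in> I"
            using qA I_PVar[of "\<sigma> v"] by (intro I.prod_mem[of A "q v"]) (simp_all add: q_def)
          then show "poly h (t (q v) + PVar (\<sigma> v)) \<in> I"
            by (simp add: h_def poly_prod)
        qed
        then have "jet_eval U \<sigma> (vandermonde PVar F) \<in> I"
          by (simp add: ev.hom_vandermonde ev_PVar t_def)
        moreover have "F \<in> AA" using F(1) \<beta>(1) by (auto simp: AA_def)
        ultimately have "jet_eval U \<sigma> W \<in> I"
          unfolding W_def ev.hom_prod using finAA by (intro I.prod_mem[of _ F])
        then show ?thesis unfolding f by (intro I.mult_mem)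
      qed
    qed
    then show "jet_eval U \<sigma> f \<in> jet_ideal P (\<lambda>i. e (part_index U i))" by (simp add: I_def)
  qed
  moreover have "f \<notin> PP d V Y"
  proof
    assume "f \<in> PP d V Y"
    moreover have id: "(\<lambda>i. i) \<in> fin_perms"
      by (simp add: fin_perms_def permutes_def)
    ultimately have fJ: "jet_eval V (\<lambda>i. i) f \<in> J"
      using mem_PP_iff[OF Y] Q(1) by (auto simp: J_def \<rho>_def)
    interpret ev: rhom "jet_eval V (\<lambda>i. i) :: (nat, 'a) mpoly \<Rightarrow> _" by (rule rhom_jet_eval)
    have ev_PVar: "jet_eval V (\<lambda>i. i) (PVar i) = PConst (to_conf (PVar (\<rho> i))) + PVar i" for i
      by (simp add: jet_eval_PVar \<rho>_def)
    have "regular_mod J (jet_eval V (\<lambda>i. i) \<Delta>)"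
      unfolding \<Delta>_def ev.hom_prod
    proof (rule regular_mod_prod)
      fix x assume "x \<in> D"
      then obtain i j where x: "x = (i, j)" "\<rho> i \<noteq> \<rho> j" by (auto simp: D_def)
      have "to_conf (PVar (\<rho> i)) - to_conf (PVar (\<rho> j)) \<notin> Q"
        using to_conf_diff_unit[OF x(2)] Q.unit_notin by (metis mult.commute)
      moreover have "(PVar i - PVar j) ^ (d (\<rho> i) + d (\<rho> j)) \<in> J"
        by (intro J.power_diff_mem J_PVar)
      ultimately have "regular_mod J (PConst (to_conf (PVar (\<rho> i)) - to_conf (PVar (\<rho> j))) + (PVar i - PVar j))"
        unfolding J_def by (rule regular_mod_jet_ideal[OF Q.type_prime_axioms])
      also have "PConst (to_conf (PVar (\<rho> i)) - to_conf (PVar (\<rho> j))) + (PVar i - PVar j) =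
          jet_eval V (\<lambda>i. i) (PVar i - PVar j :: (nat, 'a) mpoly)"
        by (simp add: ev.hom_diff ev_PVar rhom.hom_diff[OF rhom_PConst])
      finally show "regular_mod J (jet_eval V (\<lambda>i. i) (case x of (i, j) \<Rightarrow> PVar i - PVar j))"
        by (simp add: x(1))
    qed
    moreover have "regular_mod J (jet_eval V (\<lambda>i. i) \<Gamma>)"
      unfolding \<Gamma>_def ev.hom_prod
    proof (rule regular_mod_prod)
      fix x assume "x \<in> Sigma G sec"
      then obtain p s where x: "x = (p, s)" "p \<in> G" "s \<in> sec p" by auto
      have s: "part_index V (s \<alpha>) = snd p \<alpha>" if "\<alpha> \<in> fst p" for \<alpha>
        using x(3) that by (simp add: sec_def \<rho>_def)
      obtain c where c: "jet_eval V (\<lambda>i. i) (peval PConst (\<lambda>\<alpha>. PVar (s \<alpha>)) (g p)) =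
          PConst (to_conf (peval PConst (\<lambda>\<alpha>. PVar (snd p \<alpha>)) (g p))) +
          (\<Sum>\<alpha>\<in>fst p. c \<alpha> * PVar (s \<alpha>))"
        using jet_eval_section[of "fst p" "g p" V "\<lambda>i. i" s "snd p"] g(1)[OF x(2)] s by auto
      have "(0 + (\<Sum>\<alpha>\<in>fst p. c \<alpha> * PVar (s \<alpha>))) ^ Suc (\<Sum>\<alpha>\<in>fst p. d (\<rho> (s \<alpha>))) \<in> J"
        by (rule J.power_add_sum_mem) (simp_all add: J.zero_mem J_PVar)
      then have "regular_mod J (PConst (to_conf (peval PConst (\<lambda>\<alpha>. PVar (snd p \<alpha>)) (g p))) +
          (\<Sum>\<alpha>\<in>fst p. c \<alpha> * PVar (s \<alpha>)))"
        unfolding add_0_left J_def by (rule regular_mod_jet_ideal[OF Q.type_prime_axioms g(3)[OF x(2)]])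
      then show "regular_mod J (jet_eval V (\<lambda>i. i) (case x of (p, s) \<Rightarrow> peval PConst (\<lambda>\<alpha>. PVar (s \<alpha>)) (g p)))"
        by (simp add: x(1) c)
    qed
    ultimately have "jet_eval V (\<lambda>i. i) W \<in> J"
      using fJ unfolding f_def ev.hom_mult ev.hom_power by (blast dest: regular_modD regular_mod_power)
    also have "jet_eval V (\<lambda>i. i) W = (\<Prod>F\<in>AA. vandermonde PVar F)"
      unfolding W_def ev.hom_prod
    proof (rule prod.cong)
      fix F assume "F \<in> AA"
      then obtain \<beta> where "mu \<beta> = \<infinity>" "F \<in> FF \<beta>" by (auto simp: AA_def)
      then have "\<rho> v = \<beta>" if "v \<in> F" for v using FF(5) \<rho>V that by blast
      then show "jet_eval V (\<lambda>i. i) (vandermonde PVar F :: (nat, 'a) mpoly) = vandermonde PVar F"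
        unfolding ev.hom_vandermonde
        by (intro vandermonde_shift[where c = "PConst (to_conf (PVar \<beta>))"]) (simp add: ev_PVar)
    qed simp
    finally show False
    proof (rule notE[rotated])
      show "(\<Prod>F\<in>AA. vandermonde PVar F) \<notin> J"
        unfolding J_def
      proof (rule prod_vandermonde_notin[OF finAA Q.type_prime_axioms _ disjAA])
        show "0 < d (\<rho> i)" for i using d by (auto simp: weighting_def Suc_le_eq)
        fix F assume "F \<in> AA"
        then obtain \<beta> where \<beta>: "mu \<beta> = \<infinity>" "F \<in> FF \<beta>" by (auto simp: AA_def)
        show "finite F" using FF(4) \<beta> by blast
        show "card F \<le> d (\<rho> v)" if "v \<in> F" for v
        proof -
          have "\<rho> v = \<beta>" using FF(5)[OF \<beta>] \<rho>V that by blast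
          then show ?thesis using FF(6)[OF \<beta>] by simp
        qed
      qed
    qed
  qed
  ultimately show False using sub by blast
qed

theorem theorem6p2:
  fixes lam :: "'i::finite \<Rightarrow> enat" and e :: "'i \<Rightarrow> nat" and U :: "'i \<Rightarrow> nat set"
    and mu :: "'k::finite \<Rightarrow> enat" and d :: "'k \<Rightarrow> nat" and V :: "'k \<Rightarrow> nat set"
    and Z :: "('i, 'a::comm_ring_1) conf_ring set set"
    and Y :: "('k, 'a) conf_ring set set"
  assumes "inf_composition lam" and "inf_composition mu"
    and "weighting e" and "reduced lam e" and "weighting d" and "reduced mu d"
    and "partition_of_type lam U" and "partition_of_type mu V"
    and "closedin conf_space Z" and "closedin conf_space Y"
  shows "PP e U Z \<subseteq> PP d V Y \<longleftrightarrow> Y \<subseteq> Theta mu d lam e Z"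
proof
  have ZY: "Z \<subseteq> topspace conf_space" "Y \<subseteq> topspace conf_space"
    using assms(9,10) by (simp_all add: closedin_subset)
  show "Y \<subseteq> Theta mu d lam e Z" if "PP e U Z \<subseteq> PP d V Y"
    by (rule subset_Theta_of_PP_subset[OF assms(3,5,7,8) ZY that])
  show "PP e U Z \<subseteq> PP d V Y" if "Y \<subseteq> Theta mu d lam e Z"
    by (rule PP_subset_of_Theta[OF assms(3,5,6,7,8) ZY that])
qed

end
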